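(* Let $(M,L)$ be a pseudo-Finsler manifold with conic domain $A\subset TM\setminus\mathbf{0}$, and let $V$ be an $L$-admissible vector field on an open subset $\Omega\subset M$. Then there exists a unique affine connection $\nabla^V$ on $\Omega$ which is torsion-free and almost $g$-compatible, i.e. such that for all $X,Y,Z\in\mathfrak{X}(\Omega)$ $$\nabla^V_XY-\nabla^V_YX=[X,Y],$$ $$X(g_V(Y,Z))=g_V(\nabla^V_XY,Z)+g_V(Y,\nabla^V_XZ)+2C_V(\nabla^V_XV,Y,Z).$$
   Context: Let $M$ be a smooth manifold and $\pi:TM\to M$ its tangent bundle. An open subset $A\subset TM\setminus\mathbf{0}$ is conic if $\lambda v\in A$ for all $v\in A$, $\lambda>0$. A (two-homogeneous, conic) pseudo-Finsler metric is a smooth function $L:A\to\mathbb{R}$ with $L(\lambda v)=\lambda^2L(v)$ for all $v\in A$, $\lambda>0$, such that for every $v\in A$ the fundamental tensor $$g_v(u,w)=\frac12\frac{\partial^2}{\partial t\,\partial s}L(v+tu+sw)\Big|_{t=s=0},\qquad u,w\in T_{\pi(v)}M,$$ is non-degenerate. The pair $(M,L)$ is called a pseudo-Finsler manifold. The Cartan tensor is $$C_v(w_1,w_2,w_3)=\frac14\frac{\partial^3}{\partial s_3\partial s_2\partial s_1}L\Big(v+\sum_{i=1}^3s_iw_i\Big)\Big|_{s_1=s_2=s_3=0},\qquad v\in A,\ w_i\in T_{\pi(v)}M.$$ $\mathfrak{X}(\Omega)$ is the space of smooth vector fields on $\Omega$. A vector field $V$ on an open set $\Omega\subset M$ is $L$-admissible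 if $V(x)\in A\cap T_xM$ for every $x\in\Omega$. $g_V$ and $C_V$ denote the tensors on $\Omega$ obtained by evaluating $g$ and $C$ at $V$. *)

theory Defs
  imports "HOL-Analysis.Analysis"
begin

section \<open>Smooth maps between normed vector spaces\<close>

text \<open>Intended for open \<open>S\<close> and finite-dimensional domains, where it is the usual notion of
  class \<open>C\<^sup>k\<close> respectively \<open>C\<^sup>\<infinity>\<close>.\<close>

primrec Ck_on :: "nat \<Rightarrow> 'b set \<Rightarrow> ('b::real_normed_vector \<Rightarrow> 'c::real_normed_vector) \<Rightarrow> bool" where
  "Ck_on 0 S f \<longleftrightarrow> continuous_on S f"
| "Ck_on (Suc k) S f \<longleftrightarrow> (\<forall>x\<in>S. f differentiable (at x)) \<and>
     (\<forall>v. Ck_on k S (\<lambda>x. frechet_derivative f (at x) v))"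

definition smooth_on :: "'b set \<Rightarrow> ('b::real_normed_vector \<Rightarrow> 'c::real_normed_vector) \<Rightarrow> bool" where
  "smooth_on S f \<longleftrightarrow> (\<forall>k. Ck_on k S f)"


section \<open>Smooth manifolds\<close>

text \<open>A chart is a pair \<open>(U, \<phi>)\<close>; the values of \<open>\<phi>\<close> outside \<open>U\<close> are irrelevant. A manifold is
  represented by a (not necessarily maximal) smooth atlas; its underlying space is the union of the
  chart domains, an open subspace of the Hausdorff, second countable space \<open>'a\<close>.\<close>

type_synonym ('a, 'e) chart = "'a set \<times> ('a \<Rightarrow> 'e)"
type_synonym ('a, 'e) atlas = "('a, 'e) chart set"

definition chart_inv :: "('a, 'e) chart \<Rightarrow> 'e \<Rightarrow> 'a" where
  "chart_inv c = inv_into (fst c) (snd c)"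

definition is_chart :: "('a::topological_space, 'e::euclidean_space) chart \<Rightarrow> bool" where
  "is_chart c \<longleftrightarrow> open (fst c) \<and> open (snd c ` fst c) \<and>
     homeomorphism (fst c) (snd c ` fst c) (snd c) (chart_inv c)"

definition transition :: "('a, 'e) chart \<Rightarrow> ('a, 'e) chart \<Rightarrow> 'e \<Rightarrow> 'e" where
  "transition c d = snd d \<circ> chart_inv c"

definition smooth_manifold ::
  "('a::{t2_space,second_countable_topology}, 'e::euclidean_space) atlas \<Rightarrow> bool" where
  "smooth_manifold M \<longleftrightarrow> (\<forall>c\<in>M. is_chart c) \<and>
     (\<forall>c\<in>M. \<forall>d\<in>M. smooth_on (snd c ` (fst c \<inter> fst d)) (transition c d))"

definition carrier :: "('a, 'e) atlas \<Rightarrow> 'a set" where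
  "carrier M = (\<Union>c\<in>M. fst c)"

definition smooth_functions :: "('a, 'e::euclidean_space) atlas \<Rightarrow> 'a set \<Rightarrow> ('a \<Rightarrow> real) set" where
  "smooth_functions M \<Omega> = {f. \<forall>c\<in>M. smooth_on (snd c ` (fst c \<inter> \<Omega>)) (f \<circ> chart_inv c)}"


section \<open>The tangent bundle\<close>

text \<open>A tangent vector at \<open>p\<close> is the family of its coordinate vectors in the charts around \<open>p\<close>,
  which transform by the differentials of the transition maps. The family is \<open>0\<close> at all other
  indices, so that equality of tangent vectors is equality of functions, and the vector space
  operations are pointwise.\<close>

type_synonym ('a, 'e) tvec = "('a, 'e) chart \<Rightarrow> 'e"

definition tangent_space :: "('a, 'e::euclidean_space) atlas \<Rightarrow> 'a \<Rightarrow> ('a, 'e) tvec set" where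
  "tangent_space M p = {\<xi>.
     (\<forall>c. \<not> (c \<in> M \<and> p \<in> fst c) \<longrightarrow> \<xi> c = 0) \<and>
     (\<forall>c\<in>M. \<forall>d\<in>M. p \<in> fst c \<inter> fst d \<longrightarrow>
        \<xi> d = frechet_derivative (transition c d) (at (snd c p)) (\<xi> c))}"

definition tzero :: "('a, 'e::real_vector) tvec" where
  "tzero = (\<lambda>c. 0)"

definition tadd :: "('a, 'e::real_vector) tvec \<Rightarrow> ('a, 'e) tvec \<Rightarrow> ('a, 'e) tvec" (infixl "\<oplus>" 65) where
  "\<xi> \<oplus> \<eta> = (\<lambda>c. \<xi> c + \<eta> c)"

definition tsub :: "('a, 'e::real_vector) tvec \<Rightarrow> ('a, 'e) tvec \<Rightarrow> ('a, 'e) tvec" (infixl "\<ominus>" 65) where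
  "\<xi> \<ominus> \<eta> = (\<lambda>c. \<xi> c - \<eta> c)"

definition tscale :: "real \<Rightarrow> ('a, 'e::real_vector) tvec \<Rightarrow> ('a, 'e) tvec" (infixr "\<odot>" 75) where
  "r \<odot> \<xi> = (\<lambda>c. r *\<^sub>R \<xi> c)"

definition tangent_bundle :: "('a, 'e::euclidean_space) atlas \<Rightarrow> ('a \<times> ('a, 'e) tvec) set" where
  "tangent_bundle M = (SIGMA p : carrier M. tangent_space M p)"

definition zero_section :: "('a, 'e::euclidean_space) atlas \<Rightarrow> ('a \<times> ('a, 'e) tvec) set" where
  "zero_section M = carrier M \<times> {tzero}"

text \<open>The tangent vector at \<open>p\<close> with coordinate vector \<open>y\<close> in the chart \<open>c\<close>.\<close>

definition tvec_of :: "('a, 'e::euclidean_space) atlas \<Rightarrow> ('a, 'e) chart \<Rightarrow> 'a \<Rightarrow> 'e \<Rightarrow> ('a, 'e) tvec" where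
  "tvec_of M c p y = (\<lambda>d. if d \<in> M \<and> p \<in> fst d
     then frechet_derivative (transition c d) (at (snd c p)) y else 0)"

text \<open>The chart of the tangent bundle induced by \<open>c\<close>, and its inverse.\<close>

definition tchart :: "('a, 'e) chart \<Rightarrow> 'a \<times> ('a, 'e) tvec \<Rightarrow> 'e \<times> 'e" where
  "tchart c = (\<lambda>(p, \<xi>). (snd c p, \<xi> c))"

definition tchart_inv ::
  "('a, 'e::euclidean_space) atlas \<Rightarrow> ('a, 'e) chart \<Rightarrow> 'e \<times> 'e \<Rightarrow> 'a \<times> ('a, 'e) tvec" where
  "tchart_inv M c = (\<lambda>(x, y). (chart_inv c x, tvec_of M c (chart_inv c x) y))"

definition open_in_tangent_bundle ::
  "('a, 'e::euclidean_space) atlas \<Rightarrow> ('a \<times> ('a, 'e) tvec) set \<Rightarrow> bool" where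
  "open_in_tangent_bundle M A \<longleftrightarrow> A \<subseteq> tangent_bundle M \<and>
     (\<forall>c\<in>M. open (tchart c ` {(p, \<xi>) \<in> A. p \<in> fst c}))"

definition smooth_on_tangent_bundle ::
  "('a, 'e::euclidean_space) atlas \<Rightarrow> ('a \<times> ('a, 'e) tvec) set \<Rightarrow> ('a \<times> ('a, 'e) tvec \<Rightarrow> real) \<Rightarrow> bool" where
  "smooth_on_tangent_bundle M A L \<longleftrightarrow>
     (\<forall>c\<in>M. smooth_on (tchart c ` {(p, \<xi>) \<in> A. p \<in> fst c}) (L \<circ> tchart_inv M c))"


section \<open>Vector fields\<close>

text \<open>The derivative \<open>\<xi>(f)\<close> of a function \<open>f\<close> smooth near \<open>p\<close> along \<open>\<xi> \<in> T\<^sub>pM\<close>. By the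
  transformation rule for \<open>\<xi>\<close>, the value does not depend on the selected chart around \<open>p\<close>.\<close>

definition tapply :: "('a, 'e::euclidean_space) atlas \<Rightarrow> 'a \<Rightarrow> ('a, 'e) tvec \<Rightarrow> ('a \<Rightarrow> real) \<Rightarrow> real" where
  "tapply M p \<xi> f = (let c = (SOME c. c \<in> M \<and> p \<in> fst c)
     in frechet_derivative (f \<circ> chart_inv c) (at (snd c p)) (\<xi> c))"

text \<open>Vector fields on \<open>\<Omega>\<close> are extensional functions (\<open>undefined\<close> outside \<open>\<Omega>\<close>), so that two
  vector fields on \<open>\<Omega>\<close> are equal iff they agree on \<open>\<Omega>\<close>.\<close>

definition vector_fields :: "('a, 'e::euclidean_space) atlas \<Rightarrow> 'a set \<Rightarrow> ('a \<Rightarrow> ('a, 'e) tvec) set"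
  ("\<XX>") where
  "\<XX> M \<Omega> = {X \<in> Pi\<^sub>E \<Omega> (tangent_space M).
     \<forall>c\<in>M. smooth_on (snd c ` (fst c \<inter> \<Omega>)) (\<lambda>x. X (chart_inv c x) c)}"

definition vf_add ::
  "'a set \<Rightarrow> ('a \<Rightarrow> ('a, 'e::real_vector) tvec) \<Rightarrow> ('a \<Rightarrow> ('a, 'e) tvec) \<Rightarrow> 'a \<Rightarrow> ('a, 'e) tvec" where
  "vf_add \<Omega> X Y = (\<lambda>p\<in>\<Omega>. X p \<oplus> Y p)"

definition vf_sub ::
  "'a set \<Rightarrow> ('a \<Rightarrow> ('a, 'e::real_vector) tvec) \<Rightarrow> ('a \<Rightarrow> ('a, 'e) tvec) \<Rightarrow> 'a \<Rightarrow> ('a, 'e) tvec" where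
  "vf_sub \<Omega> X Y = (\<lambda>p\<in>\<Omega>. X p \<ominus> Y p)"

definition vf_scale ::
  "'a set \<Rightarrow> ('a \<Rightarrow> real) \<Rightarrow> ('a \<Rightarrow> ('a, 'e::real_vector) tvec) \<Rightarrow> 'a \<Rightarrow> ('a, 'e) tvec" where
  "vf_scale \<Omega> f X = (\<lambda>p\<in>\<Omega>. f p \<odot> X p)"

definition vf_apply ::
  "('a, 'e::euclidean_space) atlas \<Rightarrow> ('a \<Rightarrow> ('a, 'e) tvec) \<Rightarrow> ('a \<Rightarrow> real) \<Rightarrow> 'a \<Rightarrow> real" where
  "vf_apply M X f = (\<lambda>p. tapply M p (X p) f)"

text \<open>\<open>[X, Y]\<close> is the unique vector field with \<open>[X, Y](f) = X(Y(f)) - Y(X(f))\<close> for all smooth \<open>f\<close>.\<close>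

definition lie_bracket ::
  "('a, 'e::euclidean_space) atlas \<Rightarrow> 'a set \<Rightarrow> ('a \<Rightarrow> ('a, 'e) tvec) \<Rightarrow> ('a \<Rightarrow> ('a, 'e) tvec)
     \<Rightarrow> 'a \<Rightarrow> ('a, 'e) tvec" where
  "lie_bracket M \<Omega> X Y = (THE W. W \<in> \<XX> M \<Omega> \<and>
     (\<forall>f\<in>smooth_functions M \<Omega>. \<forall>p\<in>\<Omega>.
        vf_apply M W f p = vf_apply M X (vf_apply M Y f) p - vf_apply M Y (vf_apply M X f) p))"

text \<open>Connections are extensional in both arguments as well, so that equality of connections is
  equality on all pairs of vector fields on \<open>\<Omega>\<close>.\<close>

definition affine_connection ::
  "('a, 'e::euclidean_space) atlas \<Rightarrow> 'a set
     \<Rightarrow> (('a \<Rightarrow> ('a, 'e) tvec) \<Rightarrow> ('a \<Rightarrow> ('a, 'e) tvec) \<Rightarrow> 'a \<Rightarrow> ('a, 'e) tvec) \<Rightarrow> bool" where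
  "affine_connection M \<Omega> D \<longleftrightarrow>
     D \<in> \<XX> M \<Omega> \<rightarrow>\<^sub>E \<XX> M \<Omega> \<rightarrow>\<^sub>E \<XX> M \<Omega> \<and>
     (\<forall>X\<in>\<XX> M \<Omega>. \<forall>X'\<in>\<XX> M \<Omega>. \<forall>Y\<in>\<XX> M \<Omega>.
        D (vf_add \<Omega> X X') Y = vf_add \<Omega> (D X Y) (D X' Y)) \<and>
     (\<forall>f\<in>smooth_functions M \<Omega>. \<forall>X\<in>\<XX> M \<Omega>. \<forall>Y\<in>\<XX> M \<Omega>.
        D (vf_scale \<Omega> f X) Y = vf_scale \<Omega> f (D X Y)) \<and>
     (\<forall>X\<in>\<XX> M \<Omega>. \<forall>Y\<in>\<XX> M \<Omega>. \<forall>Y'\<in>\<XX> M \<Omega>.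
        D X (vf_add \<Omega> Y Y') = vf_add \<Omega> (D X Y) (D X Y')) \<and>
     (\<forall>f\<in>smooth_functions M \<Omega>. \<forall>X\<in>\<XX> M \<Omega>. \<forall>Y\<in>\<XX> M \<Omega>.
        D X (vf_scale \<Omega> f Y) = vf_add \<Omega> (vf_scale \<Omega> (vf_apply M X f) Y) (vf_scale \<Omega> f (D X Y)))"


section \<open>Pseudo-Finsler metrics\<close>

definition fundamental_tensor ::
  "('a \<times> ('a, 'e::real_vector) tvec \<Rightarrow> real) \<Rightarrow> 'a \<Rightarrow> ('a, 'e) tvec \<Rightarrow> ('a, 'e) tvec \<Rightarrow> ('a, 'e) tvec
     \<Rightarrow> real" where
  "fundamental_tensor L p v u w =
     1 / 2 * deriv (\<lambda>t. deriv (\<lambda>s. L (p, v \<oplus> t \<odot> u \<oplus> s \<odot> w)) 0) 0"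

definition cartan_tensor ::
  "('a \<times> ('a, 'e::real_vector) tvec \<Rightarrow> real) \<Rightarrow> 'a \<Rightarrow> ('a, 'e) tvec \<Rightarrow> ('a, 'e) tvec \<Rightarrow> ('a, 'e) tvec
     \<Rightarrow> ('a, 'e) tvec \<Rightarrow> real" where
  "cartan_tensor L p v w1 w2 w3 =
     1 / 4 * deriv (\<lambda>s3. deriv (\<lambda>s2. deriv (\<lambda>s1.
       L (p, v \<oplus> s1 \<odot> w1 \<oplus> s2 \<odot> w2 \<oplus> s3 \<odot> w3)) 0) 0) 0"

definition conic_domain ::
  "('a, 'e::euclidean_space) atlas \<Rightarrow> ('a \<times> ('a, 'e) tvec) set \<Rightarrow> bool" where
  "conic_domain M A \<longleftrightarrow> A \<subseteq> tangent_bundle M - zero_section M \<and> open_in_tangent_bundle M A \<and>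
     (\<forall>(p, v)\<in>A. \<forall>r>0. (p, r \<odot> v) \<in> A)"

text \<open>The values of \<open>L\<close> outside \<open>A\<close> are irrelevant.\<close>

definition pseudo_finsler_metric ::
  "('a, 'e::euclidean_space) atlas \<Rightarrow> ('a \<times> ('a, 'e) tvec) set \<Rightarrow> ('a \<times> ('a, 'e) tvec \<Rightarrow> real) \<Rightarrow> bool" where
  "pseudo_finsler_metric M A L \<longleftrightarrow>
     conic_domain M A \<and>
     smooth_on_tangent_bundle M A L \<and>
     (\<forall>(p, v)\<in>A. \<forall>r>0. L (p, r \<odot> v) = r\<^sup>2 * L (p, v)) \<and>
     (\<forall>(p, v)\<in>A. \<forall>u\<in>tangent_space M p.
        (\<forall>w\<in>tangent_space M p. fundamental_tensor L p v u w = 0) \<longrightarrow> u = tzero)"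

definition admissible ::
  "('a, 'e::euclidean_space) atlas \<Rightarrow> ('a \<times> ('a, 'e) tvec) set \<Rightarrow> 'a set \<Rightarrow> ('a \<Rightarrow> ('a, 'e) tvec) \<Rightarrow> bool" where
  "admissible M A \<Omega> V \<longleftrightarrow> V \<in> \<XX> M \<Omega> \<and> (\<forall>p\<in>\<Omega>. (p, V p) \<in> A)"

end

theory Submission
  imports Defs
begin

text \<open>In a chart, write \<open>\<nabla>\<^bsub>u\<^esub>y = \<partial>\<^bsub>u\<^esub>y + \<Gamma>(u, y)\<close> and \<open>N(u) = \<nabla>\<^bsub>u\<^esub>V\<close>. The Koszul trick gives
  \<open>g(\<Gamma>(u, y), z)\<close> as a sum of first derivatives of \<open>g\<^sub>V\<close> and of the terms \<open>C(N(u), y, z)\<close>,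
  \<open>C(N(y), u, z)\<close> and \<open>C(N(z), u, y)\<close>. The right hand side contains \<open>\<Gamma>\<close> only through \<open>N\<close>, and by
  homogeneity \<open>C\<close> vanishes as soon as one argument is \<open>V\<close>. So the formula determines first \<open>\<Gamma>(V, V)\<close>,
  then \<open>\<Gamma>(\<cdot>, V)\<close>, i.e. \<open>N\<close>, and then \<open>\<Gamma>\<close>.

  Applied to the difference of two solutions, the same three steps show that the solution is unique, at
  each single point. This pointwise uniqueness is also what makes the local solutions of different
  charts agree, so that the transformation law of the Christoffel symbols is never needed.\<close>

section \<open>Calculus of \<open>C\<^sup>k\<close> maps\<close>

text \<open>The obstacle is that the compatibility equation is implicit: the unknown also sits
  inside \<open>C\<close>, through the derivative of \<open>V\<close>. Adding the equations for
  \<open>(u, y, z)\<close> and \<open>(y, u, z)\<close> and subtracting the one for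
  \<open>(z, u, y)\<close> isolates \<open>2 * g(\<Gamma>(u, y), z)\<close>, and a \<open>V\<close>
  among the arguments removes the implicit terms one after the other. \<open>C\<close> vanishes on
  \<open>V\<close> because \<open>L\<close> has degree 2 on the fibres: its second fibre derivatives
  have degree 0 and are constant along the ray through \<open>V\<close>.

  Two analytic needs shape the rest. The form \<open>g\<close> may be indefinite and varies with the
  point, so smooth dependence of the solution \<open>w\<close> of \<open>g(w, z) = l(z)\<close> is
  obtained by differentiating the equation itself instead of inverting a matrix. And connections act
  on fields over the whole of \<Omega>, while the bracket is defined by its action on functions:
  bump functions supply fields with a prescribed value and functions with a prescribed differential
  at a point.\<close>

abbreviation fd :: "('b::real_normed_vector \<Rightarrow> 'c::real_normed_vector) \<Rightarrow> 'b \<Rightarrow> 'b \<Rightarrow> 'c" where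
  "fd f x \<equiv> frechet_derivative f (at x)"

section \<open>Rules for Frechet derivatives\<close>

lemma fd_eqI: "(f has_derivative f') (at x) \<Longrightarrow> fd f x = f'"
  by (metis frechet_derivative_at)

lemma has_derivative_fd: "f differentiable (at x) \<Longrightarrow> (f has_derivative fd f x) (at x)"
  by (simp add: frechet_derivative_works)

text \<open>A derivative only sees a neighbourhood. Chart expressions have arbitrary values off the
  chart image, so identities between them can be differentiated only on an open set where they
  hold.\<close>

lemma has_derivative_cong_open:
  assumes "open S" "x \<in> S" "\<And>y. y \<in> S \<Longrightarrow> f y = g y"
  shows "(f has_derivative f') (at x) \<longleftrightarrow> (g has_derivative f') (at x)"
  using assms has_derivative_transform_within_open by metis

lemma fd_cong_open:
  assumes "open S" "x \<in> S" "\<And>y. y \<in> S \<Longrightarrow> f y = g y"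
  shows "fd f x = fd g x"
  unfolding frechet_derivative_def using has_derivative_cong_open[OF assms] by simp

lemma differentiable_cong_open:
  assumes "open S" "x \<in> S" "\<And>y. y \<in> S \<Longrightarrow> f y = g y"
  shows "f differentiable (at x) \<longleftrightarrow> g differentiable (at x)"
  unfolding differentiable_def using has_derivative_cong_open[OF assms] by simp

lemma fd_add:
  assumes "f differentiable (at x)" "g differentiable (at x)"
  shows "fd (\<lambda>x. f x + g x) x v = fd f x v + fd g x v"
  by (rule fd_eqI[THEN fun_cong]) (intro has_derivative_add has_derivative_fd assms)

lemma fd_scaleR:
  fixes f :: "'b::real_normed_vector \<Rightarrow> real"
  assumes "f differentiable (at x)" "g differentiable (at x)"
  shows "fd (\<lambda>x. f x *\<^sub>R g x) x v = f x *\<^sub>R fd g x v + fd f x v *\<^sub>R g x"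
  by (rule fd_eqI[THEN fun_cong]) (intro has_derivative_scaleR has_derivative_fd assms)

lemma fd_sum:
  assumes "\<And>i. i \<in> I \<Longrightarrow> f i differentiable (at x)"
  shows "fd (\<lambda>x. \<Sum>i\<in>I. f i x) x v = (\<Sum>i\<in>I. fd (f i) x v)"
  by (rule fd_eqI[THEN fun_cong]) (intro has_derivative_sum has_derivative_fd assms)

lemma fd_bounded_linear:
  assumes "bounded_linear h" "f differentiable (at x)"
  shows "fd (\<lambda>x. h (f x)) x v = h (fd f x v)"
  by (rule fd_eqI[THEN fun_cong]) (intro bounded_linear.has_derivative[OF assms(1)] has_derivative_fd assms)

lemma fd_chain:
  assumes "g differentiable (at x)" "f differentiable (at (g x))"
  shows "fd (\<lambda>x. f (g x)) x v = fd f (g x) (fd g x v)"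
  using frechet_derivative_compose[OF assms] by (simp add: o_def)

lemma differentiable_chain:
  assumes "g differentiable (at x)" "f differentiable (at (g x))"
  shows "(\<lambda>x. f (g x)) differentiable (at x)"
  using differentiable_chain_at[OF assms] by (simp add: o_def)

section \<open>Closure properties of the class \<open>Ck_on\<close>\<close>

lemma Ck_on_cong:
  assumes "open S" "\<And>x. x \<in> S \<Longrightarrow> f x = g x"
  shows "Ck_on k S f \<longleftrightarrow> Ck_on k S g"
  using assms(2)
proof (induction k arbitrary: f g)
  case 0
  then show ?case by (simp cong: continuous_on_cong)
next
  case (Suc k)
  have "Ck_on k S (\<lambda>x. fd f x v) \<longleftrightarrow> Ck_on k S (\<lambda>x. fd g x v)" for v
    by (rule Suc.IH) (metis Suc.prems assms(1) fd_cong_open)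
  moreover have "f differentiable (at x) \<longleftrightarrow> g differentiable (at x)" if "x \<in> S" for x
    by (metis Suc.prems assms(1) that differentiable_cong_open)
  ultimately show ?case by simp
qed

lemma Ck_on_subset: "Ck_on k S f \<Longrightarrow> T \<subseteq> S \<Longrightarrow> Ck_on k T f"
  by (induction k arbitrary: f) (auto intro: continuous_on_subset)

lemma Ck_on_local:
  assumes "\<And>x. x \<in> S \<Longrightarrow> \<exists>T. open T \<and> x \<in> T \<and> Ck_on k T f"
  shows "Ck_on k S f"
  using assms
proof (induction k arbitrary: f)
  case 0
  then show ?case
    by (metis Ck_on.simps(1) continuous_at_imp_continuous_on continuous_on_eq_continuous_at)
next
  case (Suc k)
  then show ?case by (simp, metis)
qed

lemma Ck_on_SucD: "Ck_on (Suc k) S f \<Longrightarrow> Ck_on k S f"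
proof (induction k arbitrary: f)
  case 0
  then show ?case
    by (auto intro!: continuous_at_imp_continuous_on differentiable_imp_continuous_within)
next
  case (Suc k)
  from Suc.prems have "f differentiable (at x)" if "x \<in> S" for x
    using that by simp
  moreover from Suc.prems have "Ck_on (Suc k) S (\<lambda>x. fd f x v)" for v
    by (subst (asm) Ck_on.simps(2)) blast
  ultimately show ?case
    using Suc.IH by (subst Ck_on.simps(2)) blast
qed

lemma Ck_on_const: "Ck_on k S (\<lambda>x. c)"
  by (induction k arbitrary: c) auto

lemma Ck_on_add:
  assumes "open S" "Ck_on k S f" "Ck_on k S g"
  shows "Ck_on k S (\<lambda>x. f x + g x)"
  using assms(2,3)
proof (induction k arbitrary: f g)
  case 0
  then show ?case by (auto intro: continuous_on_add)
next
  case (Suc k)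
  have "Ck_on k S (\<lambda>x. fd (\<lambda>x. f x + g x) x v)" for v
  proof (subst Ck_on_cong[OF \<open>open S\<close>])
    show "fd (\<lambda>x. f x + g x) x v = fd f x v + fd g x v" if "x \<in> S" for x
      using that Suc.prems by (intro fd_add) auto
    show "Ck_on k S (\<lambda>x. fd f x v + fd g x v)"
      using Suc by simp
  qed
  then show ?case using Suc.prems by simp
qed

lemma Ck_on_scaleR:
  fixes f :: "'b::real_normed_vector \<Rightarrow> real"
  assumes "open S" "Ck_on k S f" "Ck_on k S g"
  shows "Ck_on k S (\<lambda>x. f x *\<^sub>R g x)"
  using assms(2,3)
proof (induction k arbitrary: f g)
  case 0
  then show ?case by (auto intro: continuous_on_scaleR)
next
  case (Suc k)
  have "Ck_on k S (\<lambda>x. fd (\<lambda>x. f x *\<^sub>R g x) x v)" for v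
  proof (subst Ck_on_cong[OF \<open>open S\<close>])
    show "fd (\<lambda>x. f x *\<^sub>R g x) x v = f x *\<^sub>R fd g x v + fd f x v *\<^sub>R g x" if "x \<in> S" for x
      using that Suc.prems by (intro fd_scaleR) auto
    show "Ck_on k S (\<lambda>x. f x *\<^sub>R fd g x v + fd f x v *\<^sub>R g x)"
      using Suc.prems Suc.prems[THEN Ck_on_SucD]
      by (intro Ck_on_add[OF \<open>open S\<close>] Suc.IH) auto
  qed
  then show ?case using Suc.prems by simp
qed

lemma Ck_on_bounded_linear:
  assumes "bounded_linear h" "open S" "Ck_on k S f"
  shows "Ck_on k S (\<lambda>x. h (f x))"
  using assms(3)
proof (induction k arbitrary: f)
  case 0
  then show ?case by (auto intro: bounded_linear.continuous_on[OF assms(1)])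
next
  case (Suc k)
  have "Ck_on k S (\<lambda>x. fd (\<lambda>x. h (f x)) x v)" for v
  proof (subst Ck_on_cong[OF \<open>open S\<close>])
    show "fd (\<lambda>x. h (f x)) x v = h (fd f x v)" if "x \<in> S" for x
      using that Suc.prems by (intro fd_bounded_linear assms) auto
    show "Ck_on k S (\<lambda>x. h (fd f x v))"
      using Suc by simp
  qed
  moreover have "(\<lambda>x. h (f x)) differentiable (at x)" if "x \<in> S" for x
    using Suc.prems that by (intro differentiable_chain[of f x h]
        bounded_linear_imp_differentiable[OF assms(1)]) auto
  ultimately show ?case by simp
qed

lemma Ck_on_ident: "Ck_on k S (\<lambda>x. x)"
proof (cases k)
  case (Suc j)
  then show ?thesis by (simp add: Ck_on_const)
qed auto

lemma Ck_on_minus: "open S \<Longrightarrow> Ck_on k S f \<Longrightarrow> Ck_on k S (\<lambda>x. - f x)"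
  by (rule Ck_on_bounded_linear[OF bounded_linear_minus[OF bounded_linear_ident]])

lemma Ck_on_diff:
  assumes "open S" "Ck_on k S f" "Ck_on k S g"
  shows "Ck_on k S (\<lambda>x. f x - g x)"
  using Ck_on_add[OF assms(1,2) Ck_on_minus[OF assms(1,3)]] by simp

lemma Ck_on_sum:
  assumes "open S" "\<And>i. i \<in> I \<Longrightarrow> Ck_on k S (f i)"
  shows "Ck_on k S (\<lambda>x. \<Sum>i\<in>I. f i x)"
  using assms(2)
  by (induction I rule: infinite_finite_induct) (auto intro: Ck_on_add[OF assms(1)] Ck_on_const)

lemma linear_expand:
  fixes u :: "'b::euclidean_space"
  assumes "linear f"
  shows "f u = (\<Sum>i\<in>Basis. (u \<bullet> i) *\<^sub>R f i)"
proof -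
  have "f u = f (\<Sum>i\<in>Basis. (u \<bullet> i) *\<^sub>R i)" by (simp add: euclidean_representation)
  also have "\<dots> = (\<Sum>i\<in>Basis. (u \<bullet> i) *\<^sub>R f i)"
    by (simp add: linear_sum[OF assms] linear_scale[OF assms])
  finally show ?thesis .
qed

text \<open>\<open>Ck_on\<close> differentiates in a fixed direction only. Arguments that move with
  the point are handled by expanding over \<open>Basis\<close>, which leaves a finite sum of scalar
  functions times \<open>B x i\<close>.\<close>

lemma Ck_on_linear_apply:
  fixes Y :: "'b::real_normed_vector \<Rightarrow> 'd::euclidean_space"
  assumes "open S" "\<And>x. x \<in> S \<Longrightarrow> linear (B x)"
    and "\<And>i. i \<in> Basis \<Longrightarrow> Ck_on k S (\<lambda>x. B x i)" "Ck_on k S Y"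
  shows "Ck_on k S (\<lambda>x. B x (Y x))"
proof (subst Ck_on_cong[OF \<open>open S\<close>])
  show "B x (Y x) = (\<Sum>i\<in>Basis. (Y x \<bullet> i) *\<^sub>R B x i)" if "x \<in> S" for x
    using linear_expand assms(2) that by blast
  show "Ck_on k S (\<lambda>x. \<Sum>i\<in>Basis. (Y x \<bullet> i) *\<^sub>R B x i)"
    by (intro Ck_on_sum[OF assms(1)] Ck_on_scaleR[OF assms(1)] assms
        Ck_on_bounded_linear[OF bounded_linear_inner_left])
qed

lemma fd_linear_apply:
  fixes Y :: "'b::real_normed_vector \<Rightarrow> 'd::euclidean_space"
  assumes "open S" "x \<in> S" "\<And>y. y \<in> S \<Longrightarrow> linear (B y)"
    and "\<And>i. i \<in> Basis \<Longrightarrow> (\<lambda>y. B y i) differentiable (at x)" "Y differentiable (at x)"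
  shows "(\<lambda>y. B y (Y y)) differentiable (at x)"
    and "fd (\<lambda>y. B y (Y y)) x v = fd (\<lambda>y. B y (Y x)) x v + B x (fd Y x v)"
proof -
  have eq: "B y (Z y) = (\<Sum>i\<in>Basis. (Z y \<bullet> i) *\<^sub>R B y i)" if "y \<in> S" for y and Z :: "'b \<Rightarrow> 'd"
    using linear_expand assms(3) that by blast
  have Yi: "(\<lambda>y. Z y \<bullet> i) differentiable (at x)" if "Z differentiable (at x)" for i and Z :: "'b \<Rightarrow> 'd"
    using that by simp
  have d: "(\<lambda>y. (Z y \<bullet> i) *\<^sub>R B y i) differentiable (at x)"
    if "i \<in> Basis" "Z differentiable (at x)" for i and Z :: "'b \<Rightarrow> 'd"
    by (intro differentiable_scaleR Yi assms(4) that)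
  show "(\<lambda>y. B y (Y y)) differentiable (at x)"
    by (subst differentiable_cong_open[OF assms(1,2) eq], assumption)
      (auto intro!: differentiable_sum d assms(5))
  \<comment> \<open>Used for \<open>Y\<close> and for the constant \<open>Y x\<close>: the two sums
    differ exactly by the terms that contain a derivative of \<open>Y\<close>.\<close>
  have key: "fd (\<lambda>y. B y (Z y)) x v =
      (\<Sum>i\<in>Basis. (Z x \<bullet> i) *\<^sub>R fd (\<lambda>y. B y i) x v + fd (\<lambda>y. Z y \<bullet> i) x v *\<^sub>R B x i)"
    if "Z differentiable (at x)" for Z :: "'b \<Rightarrow> 'd"
  proof -
    have "fd (\<lambda>y. B y (Z y)) x v = fd (\<lambda>y. \<Sum>i\<in>Basis. (Z y \<bullet> i) *\<^sub>R B y i) x v"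
      by (subst fd_cong_open[OF assms(1,2) eq]) auto
    also have "\<dots> = (\<Sum>i\<in>Basis. fd (\<lambda>y. (Z y \<bullet> i) *\<^sub>R B y i) x v)"
      by (intro fd_sum d that)
    also have "\<dots> = (\<Sum>i\<in>Basis. (Z x \<bullet> i) *\<^sub>R fd (\<lambda>y. B y i) x v + fd (\<lambda>y. Z y \<bullet> i) x v *\<^sub>R B x i)"
      by (intro sum.cong refl fd_scaleR Yi assms(4) that)
    finally show ?thesis .
  qed
  have "fd (\<lambda>y. Y y \<bullet> i) x v = fd Y x v \<bullet> i" for i
    by (intro fd_bounded_linear bounded_linear_inner_left assms)
  then show "fd (\<lambda>y. B y (Y y)) x v = fd (\<lambda>y. B y (Y x)) x v + B x (fd Y x v)"
    using key[OF assms(5)] key[of "\<lambda>y. Y x"] linear_expand[OF assms(3)[OF assms(2)], of "fd Y x v"]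
    by (simp add: sum.distrib)
qed

lemma linear_fd: "f differentiable (at x) \<Longrightarrow> linear (fd f x)"
  by (rule linear_frechet_derivative)

text \<open>By the chain rule the derivative is the linear family \<open>fd f (g x)\<close> applied
  to \<open>fd g x v\<close>. The induction hypothesis is needed for derivatives of \<open>f\<close>
  composed with the same \<open>g\<close>, hence only \<open>f\<close> is generalised.\<close>

lemma Ck_on_compose:
  fixes g :: "'b::real_normed_vector \<Rightarrow> 'd::euclidean_space"
  assumes "open S" "Ck_on k T f" "Ck_on k S g" "\<And>x. x \<in> S \<Longrightarrow> g x \<in> T"
  shows "Ck_on k S (\<lambda>x. f (g x))"
  using assms(2,3)
proof (induction k arbitrary: f)
  case 0
  then show ?case
    using assms(4) by (auto intro!: continuous_on_compose2[of T f S g])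
next
  case (Suc k)
  have df: "f differentiable (at (g x))" if "x \<in> S" for x
    using Suc.prems(1) assms(4)[OF that] by simp
  have dg: "g differentiable (at x)" if "x \<in> S" for x
    using Suc.prems(2) that by simp
  have "Ck_on k S (\<lambda>x. fd (\<lambda>x. f (g x)) x v)" for v
  proof (subst Ck_on_cong[OF \<open>open S\<close>])
    show "fd (\<lambda>x. f (g x)) x v = fd f (g x) (fd g x v)" if "x \<in> S" for x
      using that by (intro fd_chain df dg)
    show "Ck_on k S (\<lambda>x. fd f (g x) (fd g x v))"
    proof (rule Ck_on_linear_apply[OF \<open>open S\<close>])
      show "linear (fd f (g x))" if "x \<in> S" for x
        by (intro linear_fd df that)
      show "Ck_on k S (\<lambda>x. fd f (g x) i)" for i
        using Suc.prems Suc.prems(2)[THEN Ck_on_SucD] by (intro Suc.IH) auto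
      show "Ck_on k S (\<lambda>x. fd g x v)"
        using Suc.prems by simp
    qed
  qed
  then show ?case using differentiable_chain[OF dg df] by simp
qed

text \<open>Consider the second difference of \<open>f\<close> over the parallelogram with sides
  \<open>h *\<^sub>R u\<close> and \<open>h *\<^sub>R v\<close>. Taken in either order, the mean
  value theorem makes it \<open>h * h\<close> times a mixed derivative near \<open>x\<close>, and
  continuity rules out two different values at \<open>x\<close>.\<close>

lemma Ck_on_symmetric_real:
  fixes f :: "'b::real_normed_vector \<Rightarrow> real"
  assumes "open S" "Ck_on 2 S f" "x \<in> S"
  shows "fd (\<lambda>y. fd f y u) x v = fd (\<lambda>y. fd f y v) x u"
proof (rule ccontr)
  assume ne: "\<not> ?thesis"
  define F where "F = (\<lambda>u v y. fd (\<lambda>y. fd f y u) y v)"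
  \<comment> \<open>Half the supposed gap: numbers within \<open>e\<close> of the two mixed
    derivatives at \<open>x\<close> cannot coincide.\<close>
  define e where "e = \<bar>F u v x - F v u x\<bar> / 2"
  have "e > 0" using ne by (auto simp: e_def F_def)
  have C2: "Ck_on (Suc (Suc 0)) S f" using assms(2) by (simp add: numeral_2_eq_2)
  then have cont: "continuous_on S (F u v)" for u v by (simp add: F_def)
  have ev: "\<forall>\<^sub>F y in nhds x. y \<in> S \<and> \<bar>F u v y - F u v x\<bar> < e" for u v
  proof -
    have "isCont (F u v) x"
      using cont[of u v] assms(1,3) continuous_on_eq_continuous_at by blast
    then have "\<forall>\<^sub>F y in nhds x. dist (F u v y) (F u v x) < e"
      using \<open>e > 0\<close> by (simp add: isCont_def tendsto_at_iff_tendsto_nhds tendstoD)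
    moreover have "\<forall>\<^sub>F y in nhds x. y \<in> S"
      using assms(1,3) by (rule eventually_nhds_in_open)
    ultimately show ?thesis by eventually_elim (auto simp: dist_real_def)
  qed
  obtain d where "d > 0" and d:
    "\<And>y. dist y x < d \<Longrightarrow> y \<in> S \<and> \<bar>F u v y - F u v x\<bar> < e \<and> \<bar>F v u y - F v u x\<bar> < e"
    using eventually_conj[OF ev[of u v] ev[of v u]] unfolding eventually_nhds_metric by auto
  \<comment> \<open>Keeps the whole parallelogram within \<open>d / 2\<close> of \<open>x\<close>;
    the \<open>+ 1\<close> covers \<open>u = v = 0\<close>.\<close>
  define h where "h = d / (2 * (norm u + norm v + 1))"
  have pos: "norm u + norm v + 1 > 0"
    using norm_ge_zero[of u] norm_ge_zero[of v] by linarith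
  have "h > 0" using \<open>d > 0\<close> pos by (simp add: h_def)
  have near: "dist (x + s *\<^sub>R u + t *\<^sub>R v) x < d" if "0 \<le> s" "s \<le> h" "0 \<le> t" "t \<le> h" for s t
  proof -
    have "dist (x + s *\<^sub>R u + t *\<^sub>R v) x = norm (s *\<^sub>R u + t *\<^sub>R v)"
      by (simp add: dist_norm algebra_simps)
    also have "\<dots> \<le> s * norm u + t * norm v"
      by (rule order_trans[OF norm_triangle_ineq]) (use that in simp)
    also have "\<dots> \<le> h * norm u + h * norm v"
      using that by (intro add_mono mult_right_mono) auto
    also have "\<dots> \<le> h * (norm u + norm v + 1)"
      using \<open>h > 0\<close> by (simp add: algebra_simps)
    also have "d / (2 * m) * m = d / 2" if "m > 0" for m
      using that by simp
    from this[OF pos] have "h * (norm u + norm v + 1) = d / 2"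
      by (simp only: h_def)
    finally show ?thesis using \<open>d > 0\<close> by simp
  qed
  have line: "((\<lambda>s. G (a + s *\<^sub>R w)) has_real_derivative fd G (a + s *\<^sub>R w) w) (at s)"
    if "G differentiable (at (a + s *\<^sub>R w))" for G :: "'b \<Rightarrow> real" and a w s
  proof -
    have "((\<lambda>s. a + s *\<^sub>R w) has_derivative (\<lambda>h. h *\<^sub>R w)) (at s)"
      by (auto intro!: derivative_eq_intros)
    from has_derivative_compose[OF this has_derivative_fd[OF that]]
    have "((\<lambda>s. G (a + s *\<^sub>R w)) has_derivative (\<lambda>h. fd G (a + s *\<^sub>R w) (h *\<^sub>R w))) (at s)" .
    also have "(\<lambda>h. fd G (a + s *\<^sub>R w) (h *\<^sub>R w)) = (*) (fd G (a + s *\<^sub>R w) w)"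
      by (auto simp: linear_scale[OF linear_fd[OF that]])
    finally show ?thesis by (simp add: has_field_derivative_def)
  qed
  have diff: "f differentiable (at y)" "(\<lambda>y. fd f y w) differentiable (at y)" if "y \<in> S" for y w
    using C2 that by auto
  \<comment> \<open>The mean value theorem is applied along \<open>a\<close> to the difference of
    \<open>f\<close> on the two sides parallel to \<open>a\<close>, then along \<open>b\<close> to
    the resulting derivative.\<close>
  have double: "\<exists>\<xi> \<eta>. 0 < \<xi> \<and> \<xi> < h \<and> 0 < \<eta> \<and> \<eta> < h \<and>
      f (x + h *\<^sub>R a + h *\<^sub>R b) - f (x + h *\<^sub>R a) - (f (x + h *\<^sub>R b) - f x) =
      h * (h * F a b (x + \<xi> *\<^sub>R a + \<eta> *\<^sub>R b))"
    if near: "\<And>s t. 0 \<le> s \<Longrightarrow> s \<le> h \<Longrightarrow> 0 \<le> t \<Longrightarrow> t \<le> h \<Longrightarrow> x + s *\<^sub>R a + t *\<^sub>R b \<in> S" for a b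
  proof -
    have "\<exists>\<xi>. 0 < \<xi> \<and> \<xi> < h \<and> (\<lambda>s. f ((x + h *\<^sub>R b) + s *\<^sub>R a) - f (x + s *\<^sub>R a)) h
      - (\<lambda>s. f ((x + h *\<^sub>R b) + s *\<^sub>R a) - f (x + s *\<^sub>R a)) 0
      = (h - 0) * (fd f ((x + h *\<^sub>R b) + \<xi> *\<^sub>R a) a - fd f (x + \<xi> *\<^sub>R a) a)"
      using near[of _ h] near[of _ 0] \<open>h > 0\<close>
      by (intro MVT2 DERIV_diff line diff) (auto simp: add_ac)
    then obtain \<xi> where \<xi>: "0 < \<xi>" "\<xi> < h" and
      1: "f (x + h *\<^sub>R a + h *\<^sub>R b) - f (x + h *\<^sub>R a) - (f (x + h *\<^sub>R b) - f x) =
        h * (fd f (x + \<xi> *\<^sub>R a + h *\<^sub>R b) a - fd f (x + \<xi> *\<^sub>R a) a)"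
      by (auto simp: add_ac)
    have "\<exists>\<eta>. 0 < \<eta> \<and> \<eta> < h \<and> (\<lambda>t. fd f ((x + \<xi> *\<^sub>R a) + t *\<^sub>R b) a) h -
      (\<lambda>t. fd f ((x + \<xi> *\<^sub>R a) + t *\<^sub>R b) a) 0 =
      (h - 0) * F a b ((x + \<xi> *\<^sub>R a) + \<eta> *\<^sub>R b)"
      unfolding F_def using near[of \<xi>] \<xi> \<open>h > 0\<close>
      by (intro MVT2 line diff) auto
    then show ?thesis using 1 \<xi> by auto
  qed
  have "\<exists>\<xi> \<eta>. 0 < \<xi> \<and> \<xi> < h \<and> 0 < \<eta> \<and> \<eta> < h \<and>
      f (x + h *\<^sub>R u + h *\<^sub>R v) - f (x + h *\<^sub>R u) - (f (x + h *\<^sub>R v) - f x) =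
      h * (h * F u v (x + \<xi> *\<^sub>R u + \<eta> *\<^sub>R v))"
    using near d by (intro double) auto
  then obtain s1 t1 where 1: "0 < s1" "s1 < h" "0 < t1" "t1 < h"
    "f (x + h *\<^sub>R u + h *\<^sub>R v) - f (x + h *\<^sub>R u) - (f (x + h *\<^sub>R v) - f x) =
      h * (h * F u v (x + s1 *\<^sub>R u + t1 *\<^sub>R v))" by blast
  have "x + s *\<^sub>R v + t *\<^sub>R u \<in> S" if "0 \<le> s" "s \<le> h" "0 \<le> t" "t \<le> h" for s t
    using near[OF that(3,4,1,2)] d by (metis add.assoc add.commute)
  then have "\<exists>\<xi> \<eta>. 0 < \<xi> \<and> \<xi> < h \<and> 0 < \<eta> \<and> \<eta> < h \<and>
      f (x + h *\<^sub>R v + h *\<^sub>R u) - f (x + h *\<^sub>R v) - (f (x + h *\<^sub>R u) - f x) =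
      h * (h * F v u (x + \<xi> *\<^sub>R v + \<eta> *\<^sub>R u))"
    by (rule double)
  then obtain s2 t2 where 2: "0 < s2" "s2 < h" "0 < t2" "t2 < h"
    "f (x + h *\<^sub>R v + h *\<^sub>R u) - f (x + h *\<^sub>R v) - (f (x + h *\<^sub>R u) - f x) =
      h * (h * F v u (x + s2 *\<^sub>R v + t2 *\<^sub>R u))" by blast
  \<comment> \<open>Exchanging \<open>u\<close> and \<open>v\<close> only permutes the terms of the
    second difference.\<close>
  have "h * (h * F u v (x + s1 *\<^sub>R u + t1 *\<^sub>R v)) = h * (h * F v u (x + t2 *\<^sub>R u + s2 *\<^sub>R v))"
    using 1(5) 2(5) by (simp add: algebra_simps)
  then have "F u v (x + s1 *\<^sub>R u + t1 *\<^sub>R v) = F v u (x + t2 *\<^sub>R u + s2 *\<^sub>R v)"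
    using \<open>h > 0\<close> by simp
  moreover have "\<bar>F u v (x + s1 *\<^sub>R u + t1 *\<^sub>R v) - F u v x\<bar> < e"
    "\<bar>F v u (x + t2 *\<^sub>R u + s2 *\<^sub>R v) - F v u x\<bar> < e"
    using d near 1 2 by auto
  ultimately have "\<bar>F u v x - F v u x\<bar> < 2 * e" by linarith
  then show False by (simp add: e_def)
qed

lemma Ck_on_symmetric:
  fixes f :: "'b::real_normed_vector \<Rightarrow> 'c::euclidean_space"
  assumes "open S" "Ck_on 2 S f" "x \<in> S"
  shows "fd (\<lambda>y. fd f y u) x v = fd (\<lambda>y. fd f y v) x u"
proof (rule euclidean_eqI)
  fix i :: 'c assume "i \<in> Basis"
  have C2: "Ck_on (Suc (Suc 0)) S f" using assms(2) by (simp add: numeral_2_eq_2)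
  have 1: "fd (\<lambda>y. fd f y u) x v \<bullet> i = fd (\<lambda>y. fd (\<lambda>y. f y \<bullet> i) y u) x v" for u v
  proof -
    have "fd (\<lambda>y. fd (\<lambda>y. f y \<bullet> i) y u) x v = fd (\<lambda>y. fd f y u \<bullet> i) x v"
      using C2 by (subst fd_cong_open[OF assms(1,3), of _ "\<lambda>y. fd f y u \<bullet> i"])
        (auto intro!: fd_bounded_linear bounded_linear_inner_left)
    also have "\<dots> = fd (\<lambda>y. fd f y u) x v \<bullet> i"
      using C2 assms(3) by (intro fd_bounded_linear bounded_linear_inner_left) auto
    finally show ?thesis by simp
  qed
  show "fd (\<lambda>y. fd f y u) x v \<bullet> i = fd (\<lambda>y. fd f y v) x u \<bullet> i"
    unfolding 1
    by (intro Ck_on_symmetric_real[OF assms(1) _ assms(3)]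
        Ck_on_bounded_linear[OF bounded_linear_inner_left assms(1,2)])
qed

section \<open>Smooth solutions of linear equations and bump functions\<close>

lemma smooth_onI: "(\<And>k. Ck_on k S f) \<Longrightarrow> smooth_on S f"
  by (simp add: smooth_on_def)

lemma smooth_onD: "smooth_on S f \<Longrightarrow> Ck_on k S f"
  by (simp add: smooth_on_def)

lemma smooth_on_differentiable: "smooth_on S f \<Longrightarrow> x \<in> S \<Longrightarrow> f differentiable (at x)"
  using smooth_onD[of S f "Suc 0"] by simp

lemma smooth_on_fd: "smooth_on S f \<Longrightarrow> smooth_on S (\<lambda>x. fd f x v)"
  unfolding smooth_on_def by (metis Ck_on.simps(2))

lemma smooth_on_cong: "open S \<Longrightarrow> (\<And>x. x \<in> S \<Longrightarrow> f x = g x) \<Longrightarrow> smooth_on S f \<longleftrightarrow> smooth_on S g"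
  unfolding smooth_on_def using Ck_on_cong by blast

lemma smooth_on_subset: "smooth_on S f \<Longrightarrow> T \<subseteq> S \<Longrightarrow> smooth_on T f"
  unfolding smooth_on_def using Ck_on_subset by blast

lemma smooth_on_local:
  assumes "\<And>x. x \<in> S \<Longrightarrow> \<exists>T. open T \<and> x \<in> T \<and> smooth_on T f"
  shows "smooth_on S f"
  by (rule smooth_onI, rule Ck_on_local) (metis assms smooth_onD)

lemma smooth_on_const: "smooth_on S (\<lambda>x. c)"
  by (intro smooth_onI Ck_on_const)

lemma smooth_on_ident: "smooth_on S (\<lambda>x. x)"
  by (intro smooth_onI Ck_on_ident)

lemma smooth_on_bounded_linear:
  "bounded_linear h \<Longrightarrow> open S \<Longrightarrow> smooth_on S f \<Longrightarrow> smooth_on S (\<lambda>x. h (f x))"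
  by (rule smooth_onI, rule Ck_on_bounded_linear) (auto dest: smooth_onD)

lemma smooth_on_linear_apply:
  fixes Y :: "'b::real_normed_vector \<Rightarrow> 'd::euclidean_space"
  assumes "open S" "\<And>x. x \<in> S \<Longrightarrow> linear (B x)"
    and "\<And>i. smooth_on S (\<lambda>x. B x i)" "smooth_on S Y"
  shows "smooth_on S (\<lambda>x. B x (Y x))"
  by (rule smooth_onI, rule Ck_on_linear_apply) (use assms in \<open>auto dest: smooth_onD\<close>)

lemma smooth_on_compose:
  fixes g :: "'b::real_normed_vector \<Rightarrow> 'd::euclidean_space"
  assumes "open S" "smooth_on T f" "smooth_on S g" "\<And>x. x \<in> S \<Longrightarrow> g x \<in> T"
  shows "smooth_on S (\<lambda>x. f (g x))"
  by (rule smooth_onI, rule Ck_on_compose[of S _ T f g]) (use assms in \<open>auto dest: smooth_onD\<close>)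

lemma smooth_on_add: "open S \<Longrightarrow> smooth_on S f \<Longrightarrow> smooth_on S g \<Longrightarrow> smooth_on S (\<lambda>x. f x + g x)"
  by (rule smooth_onI, rule Ck_on_add) (auto dest: smooth_onD)

lemma smooth_on_diff: "open S \<Longrightarrow> smooth_on S f \<Longrightarrow> smooth_on S g \<Longrightarrow> smooth_on S (\<lambda>x. f x - g x)"
  by (rule smooth_onI, rule Ck_on_diff) (auto dest: smooth_onD)

lemma smooth_on_scaleR:
  fixes f :: "'b::real_normed_vector \<Rightarrow> real"
  shows "open S \<Longrightarrow> smooth_on S f \<Longrightarrow> smooth_on S g \<Longrightarrow> smooth_on S (\<lambda>x. f x *\<^sub>R g x)"
  by (rule smooth_onI, rule Ck_on_scaleR) (auto dest: smooth_onD)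

text \<open>A product rule for a factor \<open>a\<close> that is merely continuous:
  \<open>b y\<close> is of the order of \<open>y - x\<close> and \<open>a y\<close> tends to 0, so
  the product is of smaller order than \<open>y - x\<close>. It serves where \<open>a\<close> is a
  coordinate of a solution whose differentiability is still to be shown.\<close>

lemma has_derivative_scaleR_vanishing:
  fixes a :: "'b::real_normed_vector \<Rightarrow> real"
  assumes a: "isCont a x" "a x = 0" and b: "b differentiable (at x)" "b x = 0"
  shows "((\<lambda>y. a y *\<^sub>R b y) has_derivative (\<lambda>_. 0)) (at x)"
  unfolding has_derivative_at_alt
proof (intro conjI allI impI)
  show "bounded_linear (\<lambda>_. 0)" by (rule bounded_linear_zero)
  fix e :: real assume "e > 0"
  have D: "(b has_derivative fd b x) (at x)" by (rule has_derivative_fd[OF b(1)])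
  obtain K where "K > 0" and K: "\<And>h. norm (fd b x h) \<le> norm h * K"
    using bounded_linear.pos_bounded[OF has_derivative_bounded_linear[OF D]] by blast
  \<comment> \<open>Differentiability with tolerance 1; together with the bound \<open>K\<close> for
    the derivative it gives \<open>norm (b y) \<le> (K + 1) * norm (y - x)\<close>, which the
    quotient \<open>e / (K + 1)\<close> below compensates.\<close>
  obtain d where "d > 0" and d: "\<And>y. norm (y - x) < d \<Longrightarrow> norm (b y - fd b x (y - x)) \<le> norm (y - x)"
    using D b(2) unfolding has_derivative_at_alt by (metis diff_zero mult_1 zero_less_one)
  obtain d' where "d' > 0" and d': "\<And>y. norm (y - x) < d' \<Longrightarrow> \<bar>a y\<bar> < e / (K + 1)"
    using a \<open>e > 0\<close> \<open>K > 0\<close> unfolding continuous_at_eps_delta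
    by (metis add_pos_pos diff_zero dist_norm divide_pos_pos real_norm_def zero_less_one)
  show "\<exists>d>0. \<forall>y. norm (y - x) < d \<longrightarrow>
      norm (a y *\<^sub>R b y - a x *\<^sub>R b x - 0) \<le> e * norm (y - x)"
  proof (intro exI[of _ "min d d'"] conjI allI impI)
    show "min d d' > 0" using \<open>d > 0\<close> \<open>d' > 0\<close> by simp
    fix y assume y: "norm (y - x) < min d d'"
    have "norm (b y) \<le> norm (b y - fd b x (y - x)) + norm (fd b x (y - x))"
      by (metis diff_add_cancel norm_triangle_ineq)
    also have "\<dots> \<le> (K + 1) * norm (y - x)"
      using d[of y] K[of "y - x"] y by (simp add: algebra_simps)
    finally have "norm (b y) \<le> (K + 1) * norm (y - x)" .
    moreover have "\<bar>a y\<bar> \<le> e / (K + 1)" using d'[of y] y by simp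
    ultimately have "\<bar>a y\<bar> * norm (b y) \<le> e / (K + 1) * ((K + 1) * norm (y - x))"
      using \<open>e > 0\<close> \<open>K > 0\<close> by (intro mult_mono) auto
    then show "norm (a y *\<^sub>R b y - a x *\<^sub>R b x - 0) \<le> e * norm (y - x)"
      using a(2) \<open>K > 0\<close> by simp
  qed
qed

text \<open>Injectivity of \<open>A x\<close> gives a lower bound \<open>B\<close> for it. Near
  \<open>x\<close> the family moves by less than \<open>B / 2\<close>, so a lower bound
  \<open>B / 2\<close> survives and controls \<open>W y - W x\<close> by
  \<open>l y - A y (W x)\<close>, which tends to 0.\<close>

lemma linear_family_solution_isCont:
  fixes A :: "'b::real_normed_vector \<Rightarrow> 'e::euclidean_space \<Rightarrow> 'e"
  assumes "open S" "x \<in> S" and lin: "\<And>y. y \<in> S \<Longrightarrow> linear (A y)" and "inj (A x)"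
    and A: "\<And>u. isCont (\<lambda>y. A y u) x" and l: "isCont l x"
    and W: "\<And>y. y \<in> S \<Longrightarrow> A y (W y) = l y"
  shows "isCont W x"
proof -
  obtain B where "B > 0" and B: "\<And>w. B * norm w \<le> norm (A x w)"
    using linear_inj_bounded_below_pos[OF lin[OF assms(2)] \<open>inj (A x)\<close>] by blast
  \<comment> \<open>Bounds the operator norm of \<open>A y - A x\<close> by finitely many functions
    of \<open>y\<close>, each continuous at \<open>x\<close>.\<close>
  define s where "s = (\<lambda>y. \<Sum>i\<in>Basis. norm (A y i - A x i))"
  have "isCont s x" unfolding s_def
    by (intro continuous_intros A)
  then have "(s \<longlongrightarrow> 0) (at x)" by (simp add: isCont_def s_def)
  then have ev1: "\<forall>\<^sub>F y in at x. s y < B / 2"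
    using \<open>B > 0\<close> by (intro order_tendstoD(2)) auto
  have ev2: "\<forall>\<^sub>F y in at x. y \<in> S"
    using assms(1,2) by (simp add: eventually_at_in_open')
  have "\<forall>\<^sub>F y in at x. norm (W y - W x) \<le> 2 / B * norm (l y - A y (W x))"
    using ev1 ev2
  proof eventually_elim
    case (elim y)
    define w where "w = W y - W x"
    have "linear (\<lambda>w. A y w - A x w)"
      using lin elim(2) assms(2) by (intro linear_compose_sub) auto
    then have "norm (A y w - A x w) = norm (\<Sum>i\<in>Basis. (w \<bullet> i) *\<^sub>R (A y i - A x i))"
      by (subst linear_expand) auto
    also have "\<dots> \<le> (\<Sum>i\<in>Basis. norm w * norm (A y i - A x i))"
      by (intro sum_norm_le) (auto intro!: mult_right_mono Basis_le_norm)
    also have "\<dots> = norm w * s y" by (simp add: s_def sum_distrib_left)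
    also have "\<dots> \<le> norm w * (B / 2)" using elim by (intro mult_left_mono) auto
    finally have "norm (A y w - A x w) \<le> norm w * (B / 2)" .
    moreover have "norm (A x w) \<le> norm (A y w - A x w) + norm (A y w)"
      by (metis norm_minus_commute norm_triangle_sub add.commute)
    ultimately have "B * norm w \<le> norm w * (B / 2) + norm (A y w)"
      using B[of w] by linarith
    moreover have "A y w = l y - A y (W x)"
      using W[OF elim(2)] by (simp add: w_def linear_diff[OF lin[OF elim(2)]])
    ultimately have "B * norm w \<le> norm w * (B / 2) + norm (l y - A y (W x))"
      by simp
    then have "norm w \<le> 2 / B * norm (l y - A y (W x))"
      using \<open>B > 0\<close> by (simp add: field_simps)
    then show ?case by (simp only: w_def)
  qed
  moreover have "((\<lambda>y. 2 / B * norm (l y - A y (W x))) \<longlongrightarrow> 2 / B * norm (l x - A x (W x))) (at x)"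
    by (intro tendsto_intros A[unfolded isCont_def] l[unfolded isCont_def])
  then have "((\<lambda>y. 2 / B * norm (l y - A y (W x))) \<longlongrightarrow> 0) (at x)"
    using W[OF assms(2)] by simp
  ultimately have "((\<lambda>y. norm (W y - W x)) \<longlongrightarrow> 0) (at x)"
    by (rule tendsto_sandwich[rotated 1, OF _ tendsto_const]) simp
  then show ?thesis
    by (simp add: isCont_def LIM_zero_iff tendsto_norm_zero_iff)
qed

text \<open>The equation is solved with a left inverse of the single map \<open>A x\<close>. The
  error term still contains \<open>W\<close>, but only multiplied by a factor that vanishes at
  \<open>x\<close>, so continuity of \<open>W\<close> suffices there.\<close>

lemma linear_family_solution_differentiable:
  fixes A :: "'b::real_normed_vector \<Rightarrow> 'e::euclidean_space \<Rightarrow> 'e"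
  assumes "open S" "x \<in> S" and lin: "\<And>y. y \<in> S \<Longrightarrow> linear (A y)" and inj: "inj (A x)"
    and A: "\<And>u. (\<lambda>y. A y u) differentiable (at x)" and l: "l differentiable (at x)"
    and W: "\<And>y. y \<in> S \<Longrightarrow> A y (W y) = l y"
  shows "W differentiable (at x)"
proof -
  have cont: "isCont W x"
    by (rule linear_family_solution_isCont[of S x A l])
      (use assms in \<open>auto intro: differentiable_imp_continuous_within\<close>)
  obtain H where H: "linear H" "\<And>w. H (A x w) = w"
    using linear_injective_left_inverse[OF lin[OF assms(2)] inj]
    by (metis comp_apply id_apply)
  have blH: "bounded_linear H" by (rule linear_conv_bounded_linear[THEN iffD1, OF H(1)])
  \<comment> \<open>\<open>R y = (A y - A x) (W y - W x)\<close> is a sum of products of two factors vanishing at \<open>x\<close>.\<close>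
  define R where "R = (\<lambda>y. \<Sum>i\<in>Basis. ((W y - W x) \<bullet> i) *\<^sub>R (A y i - A x i))"
  have eq: "W y = W x + (H (l y - A y (W x)) - H (R y))" if "y \<in> S" for y
  proof -
    have "linear (\<lambda>w. A y w - A x w)"
      using lin that assms(2) by (intro linear_compose_sub) auto
    from linear_expand[OF this, of "W y - W x"]
    have "R y = A y (W y - W x) - A x (W y - W x)" by (simp add: R_def)
    then have "A x (W y - W x) = l y - A y (W x) - R y"
      using W[OF that] by (simp add: linear_diff[OF lin[OF that]])
    then have "W y - W x = H (l y - A y (W x) - R y)"
      by (metis H(2))
    then show ?thesis by (simp add: linear_diff[OF H(1)] linear_add[OF H(1)] algebra_simps)
  qed
  have "R differentiable (at x)" unfolding R_def
  proof (intro differentiable_sum ballI)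
    fix i :: 'e
    have "isCont (\<lambda>y. (W y - W x) \<bullet> i) x"
      by (intro continuous_intros cont)
    moreover have "(\<lambda>y. A y i - A x i) differentiable (at x)"
      by (intro differentiable_diff A) simp
    ultimately show "(\<lambda>y. ((W y - W x) \<bullet> i) *\<^sub>R (A y i - A x i)) differentiable (at x)"
      using has_derivative_scaleR_vanishing[of x "\<lambda>y. (W y - W x) \<bullet> i" "\<lambda>y. A y i - A x i"]
      by (auto intro: differentiableI)
  qed auto
  then have "(\<lambda>y. W x + (H (l y - A y (W x)) - H (R y))) differentiable (at x)"
    by (intro differentiable_add differentiable_diff differentiable_const A l
        differentiable_chain[of _ x H] bounded_linear_imp_differentiable[OF blH])
  then show ?thesis
    using differentiable_cong_open[OF assms(1,2) eq] by simp
qed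

lemma bilinearD:
  "bilinear g \<Longrightarrow> linear (g u)" "bilinear g \<Longrightarrow> linear (\<lambda>u. g u v)"
  by (auto simp: bilinear_def)

lemma linear_fd_param:
  assumes "open S" "x \<in> S" and B: "\<And>y. y \<in> S \<Longrightarrow> linear (B y)"
    and d: "\<And>u. (\<lambda>y. B y u) differentiable (at x)"
  shows "linear (\<lambda>u. fd (\<lambda>y. B y u) x v)"
proof (rule linearI)
  show "fd (\<lambda>y. B y (a + b)) x v = fd (\<lambda>y. B y a) x v + fd (\<lambda>y. B y b) x v" for a b
    by (subst fd_add[OF d d, symmetric], rule fun_cong[OF fd_cong_open[OF assms(1,2)]])
      (simp add: linear_add[OF B])
  show "fd (\<lambda>y. B y (r *\<^sub>R a)) x v = r *\<^sub>R fd (\<lambda>y. B y a) x v" for r a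
    by (subst fd_bounded_linear[OF bounded_linear_scaleR_right d, symmetric],
        rule fun_cong[OF fd_cong_open[OF assms(1,2)]])
      (simp add: linear_scale[OF B])
qed

lemma linear_gram:
  fixes g :: "'e::euclidean_space \<Rightarrow> 'e \<Rightarrow> real"
  assumes "bilinear g" shows "linear (\<lambda>w. \<Sum>i\<in>Basis. g w i *\<^sub>R i)"
  by (rule linearI)
    (simp_all add: bilinear_ladd[OF assms] bilinear_lmul[OF assms] scaleR_add_left sum.distrib scaleR_sum_right)

text \<open>Riesz representation without definiteness: nondegeneracy makes the Gram map
  \<open>G\<close> injective, and in finite dimension it is then surjective.\<close>

lemma nondegenerate_represents:
  fixes g :: "'e::euclidean_space \<Rightarrow> 'e \<Rightarrow> real"
  assumes g: "bilinear g" and nd: "\<And>u. (\<And>w. g u w = 0) \<Longrightarrow> u = 0" and l: "linear l"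
  shows "\<exists>!w. \<forall>z. g w z = l z"
proof -
  define G where "G = (\<lambda>w. \<Sum>i\<in>Basis. g w i *\<^sub>R i)"
  have linG: "linear G" unfolding G_def
    by (rule linear_gram[OF g])
  have Gi: "G w \<bullet> i = g w i" if "i \<in> Basis" for w i
    using that by (simp add: G_def inner_sum_left inner_Basis if_distrib cong: if_cong)
  have gext: "(\<forall>z. g w z = l' z) \<longleftrightarrow> (\<forall>i\<in>Basis. g w i = l' i)" if "linear l'" for w l'
    using linear_eq_stdbasis[OF bilinearD(1)[OF g] that] by metis
  have "G w = 0 \<Longrightarrow> w = 0" for w
    using Gi[of _ w] gext[OF linear_zero, of w] nd[of w] by auto
  then have "inj G" by (simp add: linear_injective_0[OF linG])
  then have "surj G" by (rule linear_injective_imp_surjective[OF linG]) simp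
  then obtain w where "G w = (\<Sum>i\<in>Basis. l i *\<^sub>R i)" by (metis surjD)
  then have "g w i = l i" if "i \<in> Basis" for i
    using Gi[OF that, of w] that by (simp add: inner_sum_left inner_Basis if_distrib cong: if_cong)
  then have "\<forall>z. g w z = l z" using gext[OF l] by blast
  moreover have "w' = w" if "\<forall>z. g w' z = l z" for w'
    using nd[of "w' - w"] that calculation by (simp add: bilinear_lsub[OF g])
  ultimately show ?thesis by blast
qed

text \<open>Differentiating \<open>g x (W x) z = l x z\<close> shows that \<open>fd W x v\<close>
  solves an equation with the same \<open>g\<close> and a new right hand side. The induction
  therefore runs over all \<open>l\<close> and \<open>W\<close> at once.\<close>

lemma Ck_on_represent:
  fixes g :: "'b::real_normed_vector \<Rightarrow> 'e::euclidean_space \<Rightarrow> 'e \<Rightarrow> real"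
  assumes S: "open S" and bil: "\<And>x. x \<in> S \<Longrightarrow> bilinear (g x)"
    and nd: "\<And>x u. x \<in> S \<Longrightarrow> (\<And>w. g x u w = 0) \<Longrightarrow> u = 0"
    and g: "\<And>u w. smooth_on S (\<lambda>x. g x u w)"
    and l: "\<And>z. Ck_on k S (\<lambda>x. l x z)"
    and W: "\<And>x z. x \<in> S \<Longrightarrow> g x (W x) z = l x z"
  shows "Ck_on k S W"
proof -
  define A where "A = (\<lambda>x w. \<Sum>i\<in>Basis. g x w i *\<^sub>R i)"
  have linA: "linear (A x)" if "x \<in> S" for x
    unfolding A_def by (rule linear_gram[OF bil[OF that]])
  have injA: "inj (A x)" if "x \<in> S" for x
    unfolding linear_injective_0[OF linA[OF that]]
  proof (intro allI impI)
    fix w assume "A x w = 0"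
    have "g x w i = A x w \<bullet> i" if "i \<in> Basis" for i
      using that by (simp add: A_def inner_sum_left inner_Basis if_distrib cong: if_cong)
    then have "g x w z = 0" for z
      using \<open>A x w = 0\<close> linear_expand[OF bilinearD(1)[OF bil[OF that]], of w z] by simp
    then show "w = 0" using nd that by blast
  qed
  have A_d: "(\<lambda>y. A y u) differentiable (at x)" if "x \<in> S" for x u
    unfolding A_def using smooth_on_differentiable[OF g that]
    by (intro differentiable_sum differentiable_scaleR) auto
  show ?thesis using l W
  proof (induction k arbitrary: l W)
    case 0
    have "isCont W x" if "x \<in> S" for x
    proof (rule linear_family_solution_isCont[of S x A "\<lambda>y. \<Sum>i\<in>Basis. l y i *\<^sub>R i", OF S that linA injA[OF that]])
      show "isCont (\<lambda>y. A y u) x" for u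
        using A_d[OF that] by (rule differentiable_imp_continuous_within)
      have "isCont (\<lambda>x. l x i) x" for i
        using 0(1)[of i] that S by (simp add: continuous_on_eq_continuous_at)
      then show "isCont (\<lambda>y. \<Sum>i\<in>Basis. l y i *\<^sub>R i) x" by (intro continuous_intros)
      show "A y (W y) = (\<Sum>i\<in>Basis. l y i *\<^sub>R i)" if "y \<in> S" for y
        using 0(2)[OF that] by (simp add: A_def)
    qed
    then show ?case by (simp add: continuous_at_imp_continuous_on)
  next
    case (Suc k)
    have W_d: "W differentiable (at x)" if "x \<in> S" for x
    proof (rule linear_family_solution_differentiable[of S x A "\<lambda>y. \<Sum>i\<in>Basis. l y i *\<^sub>R i", OF S that linA injA[OF that] A_d[OF that]])
      show "(\<lambda>y. \<Sum>i\<in>Basis. l y i *\<^sub>R i) differentiable (at x)"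
        using Suc.prems(1) that by (intro differentiable_sum differentiable_scaleR) auto
      show "A y (W y) = (\<Sum>i\<in>Basis. l y i *\<^sub>R i)" if "y \<in> S" for y
        using Suc.prems(2)[OF that] by (simp add: A_def)
    qed
    have "Ck_on k S (\<lambda>x. fd W x v)" for v
    proof (rule Suc.IH)
      \<comment> \<open>The new right hand side contains \<open>W\<close>, so the induction
        hypothesis is first used for \<open>W\<close> itself.\<close>
      have WC: "Ck_on k S W" by (rule Suc.IH[OF Ck_on_SucD[OF Suc.prems(1)] Suc.prems(2)])
      have gl: "linear (\<lambda>w. fd (\<lambda>y. g y w z) x v)" if "x \<in> S" for x z
        by (rule linear_fd_param[OF S that bilinearD(2)[OF bil] smooth_on_differentiable[OF g that]])
      show "Ck_on k S (\<lambda>x. fd (\<lambda>y. l y z) x v - fd (\<lambda>y. g y (W x) z) x v)" for z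
        using Suc.prems(1)[of z]
        by (intro Ck_on_diff[OF S] Ck_on_linear_apply[of S "\<lambda>x w. fd (\<lambda>y. g y w z) x v", OF S _ _ WC])
          (auto intro: gl smooth_onD smooth_on_fd g)
      show "g x (fd W x v) z = fd (\<lambda>y. l y z) x v - fd (\<lambda>y. g y (W x) z) x v" if "x \<in> S" for x z
      proof -
        have "fd (\<lambda>y. l y z) x v = fd (\<lambda>y. g y (W y) z) x v"
          by (rule fun_cong[OF fd_cong_open[OF S that]]) (simp add: Suc.prems(2))
        also have "\<dots> = fd (\<lambda>y. g y (W x) z) x v + g x (fd W x v) z"
          using fd_linear_apply(2)[OF S that, of "\<lambda>y w. g y w z" W v] bil W_d[OF that]
            smooth_on_differentiable[OF g that] by (auto simp: bilinear_def)
        finally show ?thesis by simp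
      qed
    qed
    then show ?case using W_d by simp
  qed
qed

text \<open>The usual flat function is the case \<open>n = 0\<close>. The powers in the denominator
  make the family closed under differentiation up to linear combinations, so one induction gives
  smoothness of all members.\<close>

definition bump_exp :: "nat \<Rightarrow> real \<Rightarrow> real" where
  "bump_exp n t = (if t > 0 then exp (- 1 / t) / t ^ n else 0)"

lemma bump_exp_tendsto_0: "((\<lambda>t. exp (- 1 / t) / t ^ n) \<longlongrightarrow> (0::real)) (at_right 0)"
proof -
  have "((\<lambda>t::real. (inverse t) ^ n / exp (inverse t)) \<longlongrightarrow> 0) (at_right 0)"
    by (rule filterlim_compose[OF tendsto_power_div_exp_0 filterlim_inverse_at_top_right])
  moreover have "(inverse t) ^ n / exp (inverse t) = exp (- 1 / t) / t ^ n" for t :: real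
    by (simp add: exp_minus field_simps)
  ultimately show ?thesis by simp
qed

text \<open>One formula covers all \<open>t\<close>, since every member of the family is 0 for
  \<open>t \<le> 0\<close>. The delicate point is \<open>t = 0\<close>.\<close>

lemma DERIV_bump_exp:
  "(bump_exp n has_real_derivative bump_exp (n + 2) t - real n * bump_exp (n + 1) t) (at t)"
proof (cases t "0::real" rule: linorder_cases)
  case less
  have "((\<lambda>_. 0) has_real_derivative 0) (at t)" by simp
  then have "(bump_exp n has_real_derivative 0) (at t)"
    by (rule has_field_derivative_transform_within_open[of _ _ _ "{..<0}"])
      (use less in \<open>auto simp: bump_exp_def\<close>)
  then show ?thesis using less by (simp add: bump_exp_def)
next
  case greater
  have "((\<lambda>t. exp (- 1 / t) / t ^ n) has_real_derivative
      bump_exp (n + 2) t - real n * bump_exp (n + 1) t) (at t)"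
  proof (rule DERIV_cong)
    have "((\<lambda>t. exp (- 1 / t)) has_real_derivative exp (- 1 / t) * (1 / t\<^sup>2)) (at t)"
      using greater by (auto intro!: derivative_eq_intros simp: power2_eq_square)
    from DERIV_divide[OF this DERIV_pow]
    show "((\<lambda>t. exp (- 1 / t) / t ^ n) has_real_derivative (exp (- 1 / t) * (1 / t\<^sup>2) * t ^ n -
      exp (- 1 / t) * (real n * t ^ (n - Suc 0))) / (t ^ n * t ^ n)) (at t)"
      using greater by simp
    show "(exp (- 1 / t) * (1 / t\<^sup>2) * t ^ n - exp (- 1 / t) * (real n * t ^ (n - Suc 0))) /
      (t ^ n * t ^ n) = bump_exp (n + 2) t - real n * bump_exp (n + 1) t"
      \<comment> \<open>Splitting on \<open>n\<close> resolves the truncated exponent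
        \<open>n - Suc 0\<close> of the power rule.\<close>
      using greater by (cases n) (simp_all add: bump_exp_def field_simps power2_eq_square)
  qed
  then show ?thesis
    by (rule has_field_derivative_transform_within_open[of _ _ _ "{0<..}"])
      (use greater in \<open>auto simp: bump_exp_def\<close>)
next
  case equal
  have "((\<lambda>h. (bump_exp n (0 + h) - bump_exp n 0) / h) \<longlongrightarrow> 0) (at 0)"
  proof (rule filterlim_split_at)
    show "((\<lambda>h. (bump_exp n (0 + h) - bump_exp n 0) / h) \<longlongrightarrow> 0) (at_left 0)"
      by (rule tendsto_eventually) (auto simp: eventually_at_filter bump_exp_def)
    \<comment> \<open>Dividing by \<open>h > 0\<close> raises the power in the denominator by one,
      hence the limit for \<open>Suc n\<close>.\<close>
    show "((\<lambda>h. (bump_exp n (0 + h) - bump_exp n 0) / h) \<longlongrightarrow> 0) (at_right 0)"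
      by (rule Lim_transform_eventually[OF bump_exp_tendsto_0[of "Suc n"]])
        (auto simp: eventually_at_filter bump_exp_def)
  qed
  then show ?thesis using equal by (simp add: DERIV_def bump_exp_def)
qed

lemma smooth_on_bump_exp: "smooth_on UNIV (bump_exp n)"
proof (rule smooth_onI)
  show "Ck_on k UNIV (bump_exp n)" for k
  proof (induction k arbitrary: n)
    case 0
    show ?case using DERIV_isCont[OF DERIV_bump_exp] by (simp add: continuous_at_imp_continuous_on)
  next
    case (Suc k)
    have D: "(bump_exp n has_derivative
      (\<lambda>v. v * (bump_exp (n + 2) t - real n * bump_exp (n + 1) t))) (at t)" for t
      using DERIV_bump_exp[of n t]
      by (simp add: has_field_derivative_def mult_commute_abs)
    have "Ck_on k UNIV (\<lambda>t. v *\<^sub>R (bump_exp (n + 2) t - real n *\<^sub>R bump_exp (n + 1) t))" for v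
      by (intro Ck_on_scaleR Ck_on_diff Ck_on_const Suc.IH) auto
    then show ?case using D by (auto simp: fd_eqI[OF D] differentiable_def)
  qed
qed

text \<open>The quadratic function \<open>q\<close> is positive exactly on the ball, and
  \<open>bump_exp 0\<close> cuts it off smoothly where it is not. The constant factor normalises the
  value at the centre, where \<open>q a = r\<^sup>2\<close>.\<close>

lemma exists_bump_function:
  fixes a :: "'e::euclidean_space"
  assumes "r > 0"
  obtains b :: "'e \<Rightarrow> real" where "smooth_on UNIV b" "b a = 1" "\<And>x. x \<notin> ball a r \<Longrightarrow> b x = 0"
proof
  define q where "q = (\<lambda>x. r\<^sup>2 - (x - a) \<bullet> (x - a))"
  define b where "b = (\<lambda>x. inverse (bump_exp 0 (r\<^sup>2)) *\<^sub>R bump_exp 0 (q x))"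
  have sub: "smooth_on UNIV (\<lambda>x. x - a)"
    by (intro smooth_on_diff smooth_on_const smooth_on_ident) auto
  have "smooth_on UNIV (\<lambda>x. (x - a) \<bullet> (x - a))"
    by (rule smooth_on_linear_apply[OF open_UNIV _ _ sub])
      (rule bounded_linear.linear[OF bounded_linear_inner_right],
       rule smooth_on_bounded_linear[OF bounded_linear_inner_left open_UNIV sub])
  then have "smooth_on UNIV q" unfolding q_def
    by (intro smooth_on_diff smooth_on_const) auto
  then have "smooth_on UNIV (\<lambda>x. bump_exp 0 (q x))"
    by (rule smooth_on_compose[OF open_UNIV smooth_on_bump_exp]) simp
  then show "smooth_on UNIV b" unfolding b_def
    by (intro smooth_on_scaleR smooth_on_const) auto
  show "b a = 1" using assms by (simp add: b_def q_def bump_exp_def)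
  show "b x = 0" if "x \<notin> ball a r" for x
  proof -
    have "r \<le> norm (x - a)"
      using that by (simp add: dist_norm norm_minus_commute)
    then have "r\<^sup>2 \<le> (norm (x - a))\<^sup>2"
      using assms by (intro power_mono) auto
    then have "r\<^sup>2 \<le> (x - a) \<bullet> (x - a)"
      by (simp only: power2_norm_eq_inner)
    then show ?thesis by (simp add: b_def q_def bump_exp_def)
  qed
qed

section \<open>The Koszul formula in a chart\<close>

text \<open>Pure algebra at one point. \<open>F\<close> stands for the fields, \<open>ev\<close> for
  their values at the point, \<open>K X Y Z\<close> for the common left hand side
  \<open>X(g(Y, Z))\<close>. The difference \<open>T\<close> stays a function of fields; only the
  second and third arguments of \<open>C\<close> and the test vector in \<open>g\<close> are seen
  through \<open>ev\<close>.\<close>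

lemma almost_compatible_unique:
  fixes g :: "'v::real_vector \<Rightarrow> 'v \<Rightarrow> real" and C :: "'v \<Rightarrow> 'v \<Rightarrow> 'v \<Rightarrow> real" and ev :: "'s \<Rightarrow> 'v"
  assumes g: "bilinear g" "\<And>u w. g u w = g w u" and nd: "\<And>u. (\<And>w. g u w = 0) \<Longrightarrow> u = 0"
    and C: "\<And>y z. linear (\<lambda>a. C a y z)" "\<And>a y z. C a y z = C a z y" "\<And>a y. C a y (ev V) = 0"
    and F: "V \<in> F" "\<And>w. \<exists>Z\<in>F. ev Z = w"
    and torsion: "\<And>X Y. X \<in> F \<Longrightarrow> Y \<in> F \<Longrightarrow> D X Y - D Y X = D' X Y - D' Y X"
    and D: "\<And>X Y Z. X \<in> F \<Longrightarrow> Y \<in> F \<Longrightarrow> Z \<in> F \<Longrightarrow>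
      K X Y Z = g (D X Y) (ev Z) + g (ev Y) (D X Z) + 2 * C (D X V) (ev Y) (ev Z)"
    and D': "\<And>X Y Z. X \<in> F \<Longrightarrow> Y \<in> F \<Longrightarrow> Z \<in> F \<Longrightarrow>
      K X Y Z = g (D' X Y) (ev Z) + g (ev Y) (D' X Z) + 2 * C (D' X V) (ev Y) (ev Z)"
    and XY: "X \<in> F" "Y \<in> F"
  shows "D X Y = D' X Y"
proof -
  define T where "T = (\<lambda>X Y. D X Y - D' X Y)"
  have sym: "T X Y = T Y X" if "X \<in> F" "Y \<in> F" for X Y
    using torsion[OF that] by (simp add: T_def algebra_simps)
  have E: "g (T X Y) (ev Z) + g (T X Z) (ev Y) + 2 * C (T X V) (ev Y) (ev Z) = 0"
    if "X \<in> F" "Y \<in> F" "Z \<in> F" for X Y Z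
    using D[OF that] D'[OF that]
    by (simp add: T_def bilinear_lsub[OF g(1)] linear_diff[OF C(1)] g(2)[of "ev Y"] algebra_simps)
  \<comment> \<open>\<open>E X Y Z + E Y X Z - E Z X Y\<close>, halved; by \<open>sym\<close> the
    other \<open>g\<close> terms cancel.\<close>
  have koszul: "g (T X Y) (ev Z) =
      C (T Z V) (ev X) (ev Y) - C (T X V) (ev Y) (ev Z) - C (T Y V) (ev X) (ev Z)"
    if "X \<in> F" "Y \<in> F" "Z \<in> F" for X Y Z
    using E[of X Y Z] E[of Y X Z] E[of Z X Y] that sym[of Y X] sym[of Z X] sym[of Z Y] by simp
  have zero: "T X Y = 0" if "\<And>Z. Z \<in> F \<Longrightarrow> g (T X Y) (ev Z) = 0" for X Y
    using nd F(2) that by metis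
  have CV: "C a (ev V) z = 0" for a z
    using C(2,3) by metis
  \<comment> \<open>For \<open>X = Y = V\<close> each \<open>C\<close> term has \<open>V\<close> in
    a slot where \<open>C\<close> vanishes. For \<open>Y = V\<close> the one remaining term contains
    \<open>T V V\<close>. After that every \<open>C\<close> term has a zero first argument.\<close>
  have VV: "T V V = 0"
    using koszul[OF F(1) F(1)] C(3) CV by (intro zero) simp
  have XV: "T X V = 0" if "X \<in> F" for X
    using koszul[OF that F(1)] C(3) CV VV linear_0[OF C(1)] by (intro zero) simp
  have "T X Y = 0"
    using koszul[OF XY] XV XY linear_0[OF C(1)] by (intro zero) simp
  then show ?thesis by (simp add: T_def)
qed

lemma smooth_on_bilinear_apply:
  fixes B :: "'b::real_normed_vector \<Rightarrow> 'd::euclidean_space \<Rightarrow> 'd \<Rightarrow> 'c::real_normed_vector"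
  assumes "open S" "\<And>x. x \<in> S \<Longrightarrow> bilinear (B x)" "\<And>u w. smooth_on S (\<lambda>x. B x u w)"
    and "smooth_on S Y" "smooth_on S Z"
  shows "smooth_on S (\<lambda>x. B x (Y x) (Z x))"
proof (rule smooth_on_linear_apply[OF assms(1) _ _ assms(5)])
  show "linear (B x (Y x))" if "x \<in> S" for x
    by (rule bilinearD(1)[OF assms(2)[OF that]])
  show "smooth_on S (\<lambda>x. B x (Y x) w)" for w
    by (rule smooth_on_linear_apply[of S "\<lambda>x u. B x u w", OF assms(1) _ assms(3) assms(4)])
      (rule bilinearD(2)[OF assms(2)])
qed

lemma linear_multI: "linear f \<Longrightarrow> linear (\<lambda>x. c * f x :: real)"
  by (auto simp: linear_iff algebra_simps)

lemma smooth_on_mult_const: "open S \<Longrightarrow> smooth_on S f \<Longrightarrow> smooth_on S (\<lambda>x. c * f x :: real)"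
  by (rule smooth_on_bounded_linear[OF bounded_linear_mult_right])

text \<open>The formulas forced on a solution are taken as definitions. What has to be checked is
  consistency: the provisional values \<open>N0 x\<close> and \<open>N x u\<close> must be the
  covariant derivatives of \<open>V\<close> with respect to the final \<open>\<Gamma>\<close>. Then
  symmetry of \<open>\<Gamma>\<close> is symmetry of \<open>l\<close> in \<open>u\<close> and
  \<open>y\<close>.\<close>

lemma exists_christoffel:
  fixes g :: "'e::euclidean_space \<Rightarrow> 'e \<Rightarrow> 'e \<Rightarrow> real" and C :: "'e \<Rightarrow> 'e \<Rightarrow> 'e \<Rightarrow> 'e \<Rightarrow> real"
  assumes S: "open S"
    and g: "\<And>x. x \<in> S \<Longrightarrow> bilinear (g x)" "\<And>x u w. x \<in> S \<Longrightarrow> g x u w = g x w u"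
      "\<And>u w. smooth_on S (\<lambda>x. g x u w)"
    and nd: "\<And>x u. x \<in> S \<Longrightarrow> (\<And>w. g x u w = 0) \<Longrightarrow> u = 0"
    and C: "\<And>x y z. x \<in> S \<Longrightarrow> linear (\<lambda>a. C x a y z)" "\<And>x a z. x \<in> S \<Longrightarrow> linear (\<lambda>y. C x a y z)"
      "\<And>x a y z. x \<in> S \<Longrightarrow> C x a y z = C x a z y" "\<And>x a y. x \<in> S \<Longrightarrow> C x a y (V x) = 0"
      "\<And>a y z. smooth_on S (\<lambda>x. C x a y z)"
    and V: "smooth_on S V"
  obtains \<Gamma> where "\<And>x. x \<in> S \<Longrightarrow> bilinear (\<Gamma> x)" "\<And>x u w. x \<in> S \<Longrightarrow> \<Gamma> x u w = \<Gamma> x w u"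
    "\<And>u w. smooth_on S (\<lambda>x. \<Gamma> x u w)"
    "\<And>x u y z. x \<in> S \<Longrightarrow> fd (\<lambda>x. g x y z) x u =
      g x (\<Gamma> x u y) z + g x y (\<Gamma> x u z) + 2 * C x (fd V x u + \<Gamma> x u (V x)) y z"
proof
  define G where "G = (\<lambda>x u y z. fd (\<lambda>x. g x y z) x u)"
  have Glin1: "linear (\<lambda>u. G x u y z)" if "x \<in> S" for x y z
    unfolding G_def by (rule linear_fd[OF smooth_on_differentiable[OF g(3) that]])
  have Glin2: "linear (\<lambda>y. G x u y z)" if "x \<in> S" for x u z
    unfolding G_def
    by (rule linear_fd_param[OF S that bilinearD(2)[OF g(1)] smooth_on_differentiable[OF g(3) that]])
  have Glin3: "linear (\<lambda>z. G x u y z)" if "x \<in> S" for x u y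
    unfolding G_def
    by (rule linear_fd_param[OF S that bilinearD(1)[OF g(1)] smooth_on_differentiable[OF g(3) that]])
  have Gsym: "G x u y z = G x u z y" if "x \<in> S" for x u y z
    unfolding G_def using that by (intro fun_cong[OF fd_cong_open[OF S that]] g(2))
  have Gsm: "smooth_on S (\<lambda>x. G x u y z)" for u y z
    unfolding G_def by (intro smooth_on_fd g(3))
  have Clin3: "linear (\<lambda>z. C x a y z)" if "x \<in> S" for x a y
    using C(2)[OF that, of a y] by (simp add: C(3)[OF that, of a y])
  \<comment> \<open>Raising an index: \<open>R x\<close> inverts \<open>w \<mapsto> g x w\<close> on
    linear forms.\<close>
  define R where "R = (\<lambda>x l. THE w. \<forall>z. g x w z = l z)"
  have gR: "g x (R x l) z = l z" if "x \<in> S" "linear l" for x l z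
    unfolding R_def
    using theI'[OF nondegenerate_represents[OF g(1)[OF that(1)] nd[OF that(1)] that(2)]] by blast
  have eqI: "w = w'" if "x \<in> S" "\<And>z. g x w z = g x w' z" for x w w'
    using nd[OF that(1), of "w - w'"] that(2) by (simp add: bilinear_lsub[OF g(1)[OF that(1)]])
  have Rsm: "smooth_on S (\<lambda>x. R x (l x))"
    if "\<And>x. x \<in> S \<Longrightarrow> linear (l x)" "\<And>z. smooth_on S (\<lambda>x. l x z)" for l
    by (rule smooth_onI, rule Ck_on_represent[where l = l, OF S g(1) nd g(3)])
      (use that gR in \<open>auto dest: smooth_onD\<close>)
  have Rlin: "linear (\<lambda>u. R x (l u))" if "x \<in> S" "\<And>u. linear (l u)" "\<And>z. linear (\<lambda>u. l u z)" for x l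
    by (rule linearI; rule eqI[OF that(1)])
      (simp_all add: gR that bilinear_ladd[OF g(1)[OF that(1)]] bilinear_lmul[OF g(1)[OF that(1)]]
        linear_add[OF that(3)] linear_scale[OF that(3)])
  \<comment> \<open>\<open>l0\<close>, \<open>l1\<close> and \<open>l\<close> are the Koszul expressions for \<open>g(\<Gamma>(V, V), z)\<close>, \<open>g(\<Gamma>(u, V), z)\<close> and
    \<open>g(\<Gamma>(u, y), z)\<close>; each uses only the values of \<open>\<Gamma>\<close> obtained before.\<close>
  define l0 where "l0 = (\<lambda>x z. G x (V x) (V x) z - 1/2 * G x z (V x) (V x))"
  define N0 where "N0 = (\<lambda>x. fd V x (V x) + R x (l0 x))"
  define l1 where "l1 = (\<lambda>x u z. 1/2 * (G x u (V x) z + G x (V x) u z - G x z u (V x)) - C x (N0 x) u z)"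
  define N where "N = (\<lambda>x u. fd V x u + R x (l1 x u))"
  define l where "l = (\<lambda>x u y z. 1/2 * (G x u y z + G x y u z - G x z u y) -
    C x (N x u) y z - C x (N x y) u z + C x (N x z) u y)"
  define \<Gamma> where "\<Gamma> = (\<lambda>x u y. R x (l x u y))"
  have Vd: "linear (fd V x)" if "x \<in> S" for x
    by (rule linear_fd[OF smooth_on_differentiable[OF V that]])
  note lin = linear_compose_add linear_compose_sub linear_multI Glin1 Glin2 Glin3
  have lin0: "linear (l0 x)" if "x \<in> S" for x
    unfolding l0_def by (intro lin that)
  have lin1: "linear (l1 x u)" "linear (\<lambda>u. l1 x u z)" if "x \<in> S" for x u z
    unfolding l1_def by (intro lin C(2) Clin3 that)+
  have Nlin: "linear (N x)" if "x \<in> S" for x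
    unfolding N_def by (intro linear_compose_add Vd Rlin lin1 that)
  have CN: "linear (\<lambda>u. C x (N x u) y z)" if "x \<in> S" for x y z
    using linear_compose[OF Nlin[OF that] C(1)[OF that]] by (simp add: o_def)
  have linl: "linear (l x u y)" "linear (\<lambda>u. l x u y z)" if "x \<in> S" for x u y z
    unfolding l_def by (intro lin C(2) Clin3 CN that)+
  have lsym: "l x u y = l x y u" if "x \<in> S" for x u y
    by (rule ext) (simp add: l_def Gsym[OF that, of _ u y] C(3)[OF that, of _ u y])
  have CV: "C x a (V x) z = 0" if "x \<in> S" for x a z
    using C(3,4)[OF that] by metis
  \<comment> \<open>The three consistency checks: setting \<open>u = V\<close> in the second stage
    returns the first, and setting \<open>y = V\<close> in the third returns the second, because the
    additional \<open>C\<close> terms have an argument \<open>V\<close>.\<close>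
  have R1V: "R x (l1 x (V x)) = R x (l0 x)" if "x \<in> S" for x
    by (rule arg_cong[of _ _ "R x"])
      (auto simp: l1_def l0_def CV[OF that])
  then have NV: "N x (V x) = N0 x" if "x \<in> S" for x
    using that by (simp add: N_def N0_def)
  have \<Gamma>V: "\<Gamma> x u (V x) = R x (l1 x u)" if "x \<in> S" for x u
    unfolding \<Gamma>_def
    by (rule arg_cong[of _ _ "R x"])
      (auto simp: l_def l1_def CV[OF that] C(4)[OF that] NV[OF that])
  show sym: "\<Gamma> x u w = \<Gamma> x w u" if "x \<in> S" for x u w
    using lsym[OF that] by (simp add: \<Gamma>_def)
  have lin\<Gamma>: "linear (\<lambda>u. \<Gamma> x u y)" if "x \<in> S" for x y
    unfolding \<Gamma>_def by (intro Rlin linl that)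
  show "bilinear (\<Gamma> x)" if "x \<in> S" for x
  proof -
    have "linear (\<Gamma> x u)" for u
      using lin\<Gamma>[OF that, of u] by (simp add: sym[OF that, of _ u])
    then show ?thesis using lin\<Gamma>[OF that] by (simp add: bilinear_def)
  qed
  show "fd (\<lambda>x. g x y z) x u =
      g x (\<Gamma> x u y) z + g x y (\<Gamma> x u z) + 2 * C x (fd V x u + \<Gamma> x u (V x)) y z"
    if "x \<in> S" for x u y z
  proof -
    have "fd V x u + \<Gamma> x u (V x) = N x u" by (simp add: \<Gamma>V[OF that] N_def)
    moreover have "g x y (\<Gamma> x u z) = l x u z y" "g x (\<Gamma> x u y) z = l x u y z"
      by (simp_all add: g(2)[OF that, of y] \<Gamma>_def gR linl that)
    \<comment> \<open>In \<open>l x u y z + l x u z y\<close> all terms antisymmetric in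
      \<open>y\<close> and \<open>z\<close> cancel, which leaves
      \<open>G x u y z - 2 * C x (N x u) y z\<close>.\<close>
    moreover have "fd (\<lambda>x. g x y z) x u = l x u y z + l x u z y + 2 * C x (N x u) y z"
      using Gsym[OF that, of u y z] C(3)[OF that, of "N x u" y z]
      by (simp add: l_def G_def add_divide_distrib diff_divide_distrib)
    ultimately show ?thesis by simp
  qed
  have fdV: "smooth_on S (\<lambda>x. fd V x (V x))"
    by (rule smooth_on_linear_apply[OF S Vd smooth_on_fd[OF V] V])
  have GVV: "bilinear (\<lambda>u y. G x u y z)" "bilinear (\<lambda>y z. G x u y z)" if "x \<in> S" for x z u
    by (simp_all add: bilinear_def Glin1 Glin2 Glin3 that)
  have N0sm: "smooth_on S N0" unfolding N0_def
  proof (intro smooth_on_add[OF S] fdV Rsm lin0)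
    show "smooth_on S (\<lambda>x. l0 x z)" for z unfolding l0_def
      using smooth_on_bilinear_apply[OF S GVV(1) Gsm V V] smooth_on_bilinear_apply[OF S GVV(2) Gsm V V]
      by (intro smooth_on_diff[OF S] smooth_on_mult_const[OF S])
  qed
  have Nsm: "smooth_on S (\<lambda>x. N x u)" for u unfolding N_def
  proof (intro smooth_on_add[OF S] smooth_on_fd V Rsm lin1)
    show "smooth_on S (\<lambda>x. l1 x u z)" for z unfolding l1_def
      using smooth_on_linear_apply[OF S Glin1 Gsm V] smooth_on_linear_apply[OF S Glin2 Gsm V]
        smooth_on_linear_apply[OF S Glin3 Gsm V] smooth_on_linear_apply[OF S C(1) C(5) N0sm]
      by (intro smooth_on_add[OF S] smooth_on_diff[OF S] smooth_on_mult_const[OF S])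
  qed
  show "smooth_on S (\<lambda>x. \<Gamma> x u w)" for u w unfolding \<Gamma>_def
  proof (intro Rsm linl)
    have "smooth_on S (\<lambda>x. C x (N x a) y z)" for a y z
      by (rule smooth_on_linear_apply[OF S C(1) C(5) Nsm])
    then show "smooth_on S (\<lambda>x. l x u w z)" for z unfolding l_def
      by (intro smooth_on_add[OF S] smooth_on_diff[OF S] smooth_on_mult_const[OF S] Gsm)
  qed
qed

lemma fd_bilinear_apply:
  fixes B :: "'b::real_normed_vector \<Rightarrow> 'd::euclidean_space \<Rightarrow> 'd \<Rightarrow> 'c::real_normed_vector"
  assumes S: "open S" "x \<in> S" and B: "\<And>x. x \<in> S \<Longrightarrow> bilinear (B x)"
    and d: "\<And>u w. (\<lambda>y. B y u w) differentiable (at x)"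
    and Y: "Y differentiable (at x)" and Z: "Z differentiable (at x)"
  shows "fd (\<lambda>y. B y (Y y) (Z y)) x v =
    fd (\<lambda>y. B y (Y x) (Z x)) x v + B x (fd Y x v) (Z x) + B x (Y x) (fd Z x v)"
proof -
  have 1: "(\<lambda>y. B y (Y y) w) differentiable (at x)"
    "fd (\<lambda>y. B y (Y y) w) x v = fd (\<lambda>y. B y (Y x) w) x v + B x (fd Y x v) w" for w
    by (rule fd_linear_apply[OF S, of "\<lambda>y u. B y u w"]; intro bilinearD(2) B d Y; assumption)+
  have "fd (\<lambda>y. B y (Y y) (Z y)) x v = fd (\<lambda>y. B y (Y y) (Z x)) x v + B x (Y x) (fd Z x v)"
    by (rule fd_linear_apply(2)[OF S, of "\<lambda>y. B y (Y y)"]; intro bilinearD(1) B 1 Z; assumption)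
  then show ?thesis using 1(2) by simp
qed

lemma fd_derivative_along:
  fixes f :: "'e::euclidean_space \<Rightarrow> 'c::real_normed_vector"
  assumes S: "open S" "x \<in> S" and f: "smooth_on S f" and Y: "smooth_on S Y"
  shows "fd (\<lambda>y. fd f y (Y y)) x v = fd (\<lambda>y. fd f y (Y x)) x v + fd f x (fd Y x v)"
  by (rule fd_linear_apply(2)[OF S, of "fd f"])
    (intro linear_fd smooth_on_differentiable[OF f] smooth_on_differentiable[OF smooth_on_fd[OF f] S(2)]
      smooth_on_differentiable[OF Y S(2)]; assumption)+

text \<open>In \<open>XYf - YXf\<close> the second derivatives of \<open>f\<close> cancel by
  symmetry. The values of \<open>f\<close> may be vectors, so that the identity also applies to
  transition maps.\<close>

lemma fd_commutator:
  fixes f :: "'e::euclidean_space \<Rightarrow> 'c::euclidean_space"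
  assumes S: "open S" "x \<in> S" and f: "smooth_on S f" and "smooth_on S X" "smooth_on S Y"
  shows "fd (\<lambda>y. fd f y (Y y)) x (X x) - fd (\<lambda>y. fd f y (X y)) x (Y x) =
    fd f x (fd Y x (X x) - fd X x (Y x))"
  using fd_derivative_along[OF S f assms(4)] fd_derivative_along[OF S f assms(5)]
    Ck_on_symmetric[OF S(1) smooth_onD[OF f] S(2), of "Y x" "X x"]
    linear_diff[OF linear_fd[OF smooth_on_differentiable[OF f S(2)]]]
  by simp

section \<open>Charts, tangent vectors and vector fields\<close>

abbreviation chart_image :: "('a, 'e) chart \<Rightarrow> 'a set \<Rightarrow> 'e set" where
  "chart_image c W \<equiv> snd c ` (fst c \<inter> W)"

abbreviation comp_in :: "('a, 'e) chart \<Rightarrow> ('a \<Rightarrow> ('a, 'e) tvec) \<Rightarrow> 'e \<Rightarrow> 'e" where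
  "comp_in c X \<equiv> (\<lambda>x. X (chart_inv c x) c)"

locale manifold =
  fixes M :: "('a::{t2_space,second_countable_topology}, 'e::euclidean_space) atlas"
  assumes smooth_manifold: "smooth_manifold M"
begin

section \<open>Charts and transition maps\<close>

lemma is_chart: "c \<in> M \<Longrightarrow> is_chart c"
  using smooth_manifold by (simp add: smooth_manifold_def)

lemma open_chart: "c \<in> M \<Longrightarrow> open (fst c)"
  using is_chart by (auto simp: is_chart_def)

lemma chart_inv_chart [simp]: "c \<in> M \<Longrightarrow> p \<in> fst c \<Longrightarrow> chart_inv c (snd c p) = p"
  using is_chart[of c] by (auto simp: is_chart_def homeomorphism_def)

lemma continuous_on_chart_inv: "c \<in> M \<Longrightarrow> continuous_on (snd c ` fst c) (chart_inv c)"
  using is_chart[of c] by (auto simp: is_chart_def homeomorphism_def)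

lemma open_chart_image:
  assumes "c \<in> M" "open W" shows "open (chart_image c W)"
proof -
  have "openin (top_of_set (fst c)) (fst c \<inter> W)"
    using assms by (intro openin_open_Int)
  then have "openin (top_of_set (snd c ` fst c)) (chart_image c W)"
    using is_chart[OF assms(1)] homeomorphism_imp_open_map unfolding is_chart_def by metis
  then show ?thesis
    using is_chart[OF assms(1)] unfolding is_chart_def by (metis openin_open_trans)
qed

lemma transition_chart [simp]:
  "c \<in> M \<Longrightarrow> p \<in> fst c \<Longrightarrow> transition c d (snd c p) = snd d p"
  by (simp add: transition_def)

lemma smooth_transition: "c \<in> M \<Longrightarrow> d \<in> M \<Longrightarrow> smooth_on (chart_image c (fst d)) (transition c d)"
  using smooth_manifold by (simp add: smooth_manifold_def)

lemma differentiable_transition: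
  assumes "c \<in> M" "d \<in> M" "p \<in> fst c" "p \<in> fst d"
  shows "transition c d differentiable (at (snd c p))"
  by (rule smooth_on_differentiable[OF smooth_transition]) (use assms in auto)

lemma fd_transition_self:
  assumes "c \<in> M" "p \<in> fst c" shows "fd (transition c c) (snd c p) v = v"
proof -
  have "fd (transition c c) (snd c p) = fd (\<lambda>x. x) (snd c p)"
    by (rule fd_cong_open[OF open_chart_image[OF assms(1) open_UNIV]]) (use assms in auto)
  then show ?thesis by simp
qed

text \<open>The chain rule gives the cocycle identity of the differentials, which is why
  \<open>tvec_of\<close> yields tangent vectors.\<close>

lemma fd_transition_trans:
  assumes "c \<in> M" "d \<in> M" "e \<in> M" "p \<in> fst c" "p \<in> fst d" "p \<in> fst e"
  shows "fd (transition d e) (snd d p) (fd (transition c d) (snd c p) v) = fd (transition c e) (snd c p) v"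
proof -
  have "fd (transition c e) (snd c p) v = fd (\<lambda>x. transition d e (transition c d x)) (snd c p) v"
    by (rule fun_cong[OF fd_cong_open], rule open_chart_image[OF assms(1) open_chart[OF assms(2)]])
      (use assms in auto)
  also have "fd (\<lambda>x. transition d e (transition c d x)) (snd c p) v =
      fd (transition d e) (transition c d (snd c p)) (fd (transition c d) (snd c p) v)"
    using assms by (intro fd_chain) (auto intro: differentiable_transition)
  finally show ?thesis using assms by simp
qed

lemma linear_fd_transition:
  assumes "c \<in> M" "d \<in> M" "p \<in> fst c" "p \<in> fst d"
  shows "linear (fd (transition c d) (snd c p))"
  by (rule linear_fd[OF differentiable_transition[OF assms]])

section \<open>Tangent vectors and their coordinates\<close>

lemma tangent_spaceI:
  assumes "\<And>c. \<not> (c \<in> M \<and> p \<in> fst c) \<Longrightarrow> \<xi> c = 0"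
    and "\<And>c d. c \<in> M \<Longrightarrow> d \<in> M \<Longrightarrow> p \<in> fst c \<Longrightarrow> p \<in> fst d \<Longrightarrow>
      \<xi> d = fd (transition c d) (snd c p) (\<xi> c)"
  shows "\<xi> \<in> tangent_space M p"
  using assms unfolding tangent_space_def by blast

lemma tangent_spaceD:
  assumes "\<xi> \<in> tangent_space M p" "c \<in> M" "d \<in> M" "p \<in> fst c" "p \<in> fst d"
  shows "\<xi> d = fd (transition c d) (snd c p) (\<xi> c)"
  using assms unfolding tangent_space_def by blast

lemma tangent_space_outside:
  "\<xi> \<in> tangent_space M p \<Longrightarrow> \<not> (c \<in> M \<and> p \<in> fst c) \<Longrightarrow> \<xi> c = 0"
  unfolding tangent_space_def by blast

text \<open>One chart around \<open>p\<close> determines the whole family: the other charts around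
  \<open>p\<close> follow by the transformation rule, and all remaining entries are 0. Equalities of
  tangent vectors can thus be checked in any one chart.\<close>

lemma tangent_space_eqI:
  assumes "\<xi> \<in> tangent_space M p" "\<eta> \<in> tangent_space M p" "c \<in> M" "p \<in> fst c" "\<xi> c = \<eta> c"
  shows "\<xi> = \<eta>"
  using assms tangent_spaceD tangent_space_outside by (metis ext)

lemma tangent_space_tadd:
  assumes "\<xi> \<in> tangent_space M p" "\<eta> \<in> tangent_space M p" shows "\<xi> \<oplus> \<eta> \<in> tangent_space M p"
proof (rule tangent_spaceI)
  show "(\<xi> \<oplus> \<eta>) d = fd (transition c d) (snd c p) ((\<xi> \<oplus> \<eta>) c)"
    if "c \<in> M" "d \<in> M" "p \<in> fst c" "p \<in> fst d" for c d
    using tangent_spaceD[OF assms(1) that] tangent_spaceD[OF assms(2) that]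
    by (simp add: tadd_def linear_add[OF linear_fd_transition[OF that]])
qed (simp add: tadd_def tangent_space_outside[OF assms(1)] tangent_space_outside[OF assms(2)])

lemma tangent_space_tsub:
  assumes "\<xi> \<in> tangent_space M p" "\<eta> \<in> tangent_space M p" shows "\<xi> \<ominus> \<eta> \<in> tangent_space M p"
proof (rule tangent_spaceI)
  show "(\<xi> \<ominus> \<eta>) d = fd (transition c d) (snd c p) ((\<xi> \<ominus> \<eta>) c)"
    if "c \<in> M" "d \<in> M" "p \<in> fst c" "p \<in> fst d" for c d
    using tangent_spaceD[OF assms(1) that] tangent_spaceD[OF assms(2) that]
    by (simp add: tsub_def linear_diff[OF linear_fd_transition[OF that]])
qed (simp add: tsub_def tangent_space_outside[OF assms(1)] tangent_space_outside[OF assms(2)])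

lemma tangent_space_tscale:
  assumes "\<xi> \<in> tangent_space M p" shows "r \<odot> \<xi> \<in> tangent_space M p"
proof (rule tangent_spaceI)
  show "(r \<odot> \<xi>) d = fd (transition c d) (snd c p) ((r \<odot> \<xi>) c)"
    if "c \<in> M" "d \<in> M" "p \<in> fst c" "p \<in> fst d" for c d
    using tangent_spaceD[OF assms(1) that]
    by (simp add: tscale_def linear_scale[OF linear_fd_transition[OF that]])
qed (simp add: tscale_def tangent_space_outside[OF assms(1)])

lemma tangent_space_tzero: "tzero \<in> tangent_space M p"
  by (rule tangent_spaceI) (simp_all add: tzero_def linear_0[OF linear_fd_transition])

lemma tvec_of_tangent:
  assumes "c \<in> M" "p \<in> fst c" shows "tvec_of M c p y \<in> tangent_space M p"
  by (rule tangent_spaceI) (use assms in \<open>auto simp: tvec_of_def fd_transition_trans\<close>)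

lemma tvec_of_same [simp]: "c \<in> M \<Longrightarrow> p \<in> fst c \<Longrightarrow> tvec_of M c p y c = y"
  by (simp add: tvec_of_def fd_transition_self)

lemma tvec_of_coord: "\<xi> \<in> tangent_space M p \<Longrightarrow> c \<in> M \<Longrightarrow> p \<in> fst c \<Longrightarrow> tvec_of M c p (\<xi> c) = \<xi>"
  by (rule tangent_space_eqI[OF tvec_of_tangent]) auto

lemma tapply_chart:
  assumes "c \<in> M" "p \<in> fst c" "\<xi> \<in> tangent_space M p"
    and "(\<lambda>x. f (chart_inv c x)) differentiable (at (snd c p))"
  shows "tapply M p \<xi> f = fd (\<lambda>x. f (chart_inv c x)) (snd c p) (\<xi> c)"
proof -
  define d where "d = (SOME d. d \<in> M \<and> p \<in> fst d)"
  have d: "d \<in> M" "p \<in> fst d"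
    using someI[of "\<lambda>d. d \<in> M \<and> p \<in> fst d" c] assms by (auto simp: d_def)
  have "fd (f \<circ> chart_inv d) (snd d p) (\<xi> d) = fd (\<lambda>x. f (chart_inv c (transition d c x))) (snd d p) (\<xi> d)"
    by (rule fun_cong[OF fd_cong_open], rule open_chart_image[OF d(1) open_chart[OF assms(1)]])
      (use assms d in auto)
  also have "fd (\<lambda>x. f (chart_inv c (transition d c x))) (snd d p) (\<xi> d) =
      fd (\<lambda>x. f (chart_inv c x)) (transition d c (snd d p)) (fd (transition d c) (snd d p) (\<xi> d))"
    using assms d by (intro fd_chain[of _ _ "\<lambda>x. f (chart_inv c x)"] differentiable_transition) auto
  also have "fd (transition d c) (snd d p) (\<xi> d) = \<xi> c"
    using tangent_spaceD[OF assms(3) d(1) assms(1)] assms d by simp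
  finally show ?thesis using d by (simp add: tapply_def d_def[symmetric] o_def)
qed

end

locale manifold_region = manifold M
  for M :: "('a::{t2_space,second_countable_topology}, 'e::euclidean_space) atlas" +
  fixes \<Omega> :: "'a set"
  assumes open_\<Omega>: "open \<Omega>" and \<Omega>_carrier: "\<Omega> \<subseteq> carrier M"
begin

section \<open>Functions and vector fields on an open region\<close>

lemma chart_at:
  assumes "p \<in> \<Omega>" obtains c where "c \<in> M" "p \<in> fst c"
  using assms \<Omega>_carrier by (auto simp: carrier_def)

lemma open_region_image: "c \<in> M \<Longrightarrow> open (chart_image c \<Omega>)"
  by (rule open_chart_image[OF _ open_\<Omega>])

lemma smooth_functionsD:
  "f \<in> smooth_functions M \<Omega> \<Longrightarrow> c \<in> M \<Longrightarrow> smooth_on (chart_image c \<Omega>) (\<lambda>x. f (chart_inv c x))"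
  by (simp add: smooth_functions_def o_def)

text \<open>Smoothness is demanded in every chart, but near each point one chart suffices: the other
  expressions arise by composition with a transition map.\<close>

lemma smooth_functionsI:
  assumes "\<And>p. p \<in> \<Omega> \<Longrightarrow> \<exists>c\<in>M. \<exists>W. open W \<and> p \<in> W \<and> p \<in> fst c \<and>
    smooth_on (chart_image c W) (\<lambda>x. f (chart_inv c x))"
  shows "f \<in> smooth_functions M \<Omega>"
proof -
  have "smooth_on (chart_image d \<Omega>) (\<lambda>x. f (chart_inv d x))" if d: "d \<in> M" for d
  proof (rule smooth_on_local)
    fix x assume "x \<in> chart_image d \<Omega>"
    then obtain p where p: "p \<in> fst d" "p \<in> \<Omega>" "x = snd d p" by auto
    from assms[OF p(2)] obtain c W where c: "c \<in> M" "open W" "p \<in> W" "p \<in> fst c"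
      "smooth_on (chart_image c W) (\<lambda>x. f (chart_inv c x))" by blast
    define S where "S = chart_image d (W \<inter> fst c)"
    have S: "open S" unfolding S_def using c by (intro open_chart_image d open_Int open_chart)
    have "smooth_on S (\<lambda>x. f (chart_inv c (transition d c x)))"
      by (rule smooth_on_compose[OF S c(5) smooth_on_subset[OF smooth_transition[OF d c(1)]]])
        (use d in \<open>auto simp: S_def\<close>)
    then have "smooth_on S (\<lambda>x. f (chart_inv d x))"
      by (rule smooth_on_cong[OF S, THEN iffD1, rotated]) (use d c(1) in \<open>auto simp: S_def\<close>)
    then show "\<exists>T. open T \<and> x \<in> T \<and> smooth_on T (\<lambda>x. f (chart_inv d x))"
      using S p c by (auto simp: S_def)
  qed
  then show ?thesis by (simp add: smooth_functions_def o_def)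
qed

lemma vector_fieldsD:
  assumes "X \<in> \<XX> M \<Omega>"
  shows "p \<in> \<Omega> \<Longrightarrow> X p \<in> tangent_space M p" "X \<in> extensional \<Omega>"
    "c \<in> M \<Longrightarrow> smooth_on (chart_image c \<Omega>) (comp_in c X)"
  using assms by (auto simp: vector_fields_def PiE_def)

text \<open>As for functions, one chart near each point suffices; here the components are in
  addition transformed by the differential of the transition map, a linear family depending smoothly
  on the point.\<close>

lemma vector_fieldsI:
  assumes T: "\<And>p. p \<in> \<Omega> \<Longrightarrow> X p \<in> tangent_space M p" and "X \<in> extensional \<Omega>"
    and loc: "\<And>p. p \<in> \<Omega> \<Longrightarrow> \<exists>c\<in>M. \<exists>W. open W \<and> p \<in> W \<and> p \<in> fst c \<and> W \<subseteq> \<Omega> \<and>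
      smooth_on (chart_image c W) (comp_in c X)"
  shows "X \<in> \<XX> M \<Omega>"
proof -
  have "smooth_on (chart_image d \<Omega>) (comp_in d X)" if d: "d \<in> M" for d
  proof (rule smooth_on_local)
    fix x assume "x \<in> chart_image d \<Omega>"
    then obtain p where p: "p \<in> fst d" "p \<in> \<Omega>" "x = snd d p" by auto
    from loc[OF p(2)] obtain c W where c: "c \<in> M" "open W" "p \<in> W" "p \<in> fst c" "W \<subseteq> \<Omega>"
      "smooth_on (chart_image c W) (comp_in c X)" by blast
    define S where "S = chart_image d (W \<inter> fst c)"
    have S: "open S" unfolding S_def using c by (intro open_chart_image d open_Int open_chart)
    have tr: "smooth_on S (transition d c)"
      by (rule smooth_on_subset[OF smooth_transition[OF d c(1)]]) (auto simp: S_def)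
    have "smooth_on S (\<lambda>x. fd (transition c d) (transition d c x) (comp_in c X (transition d c x)))"
    proof (rule smooth_on_linear_apply[of S "\<lambda>x. fd (transition c d) (transition d c x)"
          "\<lambda>x. comp_in c X (transition d c x)", OF S])
      show "linear (fd (transition c d) (transition d c x))" if "x \<in> S" for x
        using that d c by (auto simp: S_def intro: linear_fd_transition)
      show "smooth_on S (\<lambda>x. fd (transition c d) (transition d c x) i)" for i
        by (rule smooth_on_compose[OF S smooth_on_fd[OF smooth_transition[OF c(1) d]] tr])
          (use d in \<open>auto simp: S_def\<close>)
      show "smooth_on S (\<lambda>x. comp_in c X (transition d c x))"
        by (rule smooth_on_compose[OF S c(6) tr]) (use d in \<open>auto simp: S_def\<close>)
    qed
    then have "smooth_on S (comp_in d X)"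
    proof (rule smooth_on_cong[OF S, THEN iffD1, rotated])
      fix y assume "y \<in> S"
      then obtain q where q: "q \<in> fst d" "q \<in> W" "q \<in> fst c" "y = snd d q" by (auto simp: S_def)
      then show "fd (transition c d) (transition d c y) (comp_in c X (transition d c y)) = comp_in d X y"
        using d c tangent_spaceD[OF T[of q] c(1) d] by auto
    qed
    then show "\<exists>T. open T \<and> x \<in> T \<and> smooth_on T (comp_in d X)"
      using S p c by (auto simp: S_def)
  qed
  then show ?thesis using assms by (simp add: vector_fields_def PiE_def)
qed

lemma vf_apply_chart:
  assumes "c \<in> M" "p \<in> fst c" "p \<in> \<Omega>" "X \<in> \<XX> M \<Omega>"
    and f: "(\<lambda>x. f (chart_inv c x)) differentiable (at (snd c p))"
  shows "vf_apply M X f p = fd (\<lambda>x. f (chart_inv c x)) (snd c p) (X p c)"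
  unfolding vf_apply_def by (rule tapply_chart[OF assms(1,2) vector_fieldsD(1)[OF assms(4,3)] f])

text \<open>Since \<open>K\<close> is closed, functions and vector fields multiplied by \<open>b\<close> extend smoothly by zero
  from the chart to the whole manifold. This is where the Hausdorff property enters.\<close>

lemma chart_bump:
  assumes "c \<in> M" "p \<in> fst c"
  obtains b K where "smooth_on UNIV b" "b (snd c p) = (1::real)" "closed K" "K \<subseteq> fst c"
    "\<And>q. q \<in> fst c \<Longrightarrow> q \<notin> K \<Longrightarrow> b (snd c q) = 0"
proof -
  have "open (snd c ` fst c)" using open_chart_image[OF assms(1) open_UNIV] by simp
  then obtain r where r: "r > 0" "cball (snd c p) r \<subseteq> snd c ` fst c"
    using assms(2) unfolding open_contains_cball by blast
  obtain b :: "'e \<Rightarrow> real" where b: "smooth_on UNIV b" "b (snd c p) = 1"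
    "\<And>x. x \<notin> ball (snd c p) r \<Longrightarrow> b x = 0"
    by (rule exists_bump_function[OF r(1), of "snd c p"]) blast
  define K where "K = chart_inv c ` cball (snd c p) r"
  have "compact K" unfolding K_def
    by (intro compact_continuous_image continuous_on_subset[OF continuous_on_chart_inv[OF assms(1)] r(2)])
      simp
  then have "closed K" by (rule compact_imp_closed)
  moreover have "K \<subseteq> fst c" using r(2) assms(1) by (auto simp: K_def)
  moreover have "b (snd c q) = 0" if "q \<in> fst c" "q \<notin> K" for q
  proof (rule b(3))
    show "snd c q \<notin> ball (snd c p) r"
      using that assms(1) unfolding K_def
      by (metis ball_subset_cball chart_inv_chart image_eqI subsetD)
  qed
  ultimately show thesis using that b by blast
qed

text \<open>These functions detect single components of a tangent vector, which yields the
  uniqueness hidden in the definite description of the bracket.\<close>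

lemma exists_smooth_function:
  assumes c: "c \<in> M" "p \<in> fst c" "p \<in> \<Omega>"
  obtains f where "f \<in> smooth_functions M \<Omega>" "\<And>v. fd (\<lambda>x. f (chart_inv c x)) (snd c p) v = v \<bullet> i"
proof -
  obtain b K where b: "smooth_on UNIV b" "b (snd c p) = (1::real)" "closed K" "K \<subseteq> fst c"
    "\<And>q. q \<in> fst c \<Longrightarrow> q \<notin> K \<Longrightarrow> b (snd c q) = 0"
    by (rule chart_bump[OF c(1,2)]) blast
  \<comment> \<open>The linear factor vanishes at \<open>snd c p\<close>, so the derivative of
    \<open>b\<close> does not contribute there, and \<open>b = 1\<close> leaves the differential of
    the linear factor.\<close>
  define h where "h = (\<lambda>x. b x *\<^sub>R ((x - snd c p) \<bullet> i))"
  have lin: "smooth_on UNIV (\<lambda>x. (x - snd c p) \<bullet> i)"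
    by (intro smooth_on_bounded_linear[OF bounded_linear_inner_left] smooth_on_diff
        smooth_on_ident smooth_on_const) auto
  have h: "smooth_on UNIV h" unfolding h_def
    by (intro smooth_on_scaleR b lin) auto
  define f where "f = (\<lambda>q. if q \<in> fst c then h (snd c q) else 0)"
  have "f \<in> smooth_functions M \<Omega>"
  proof (rule smooth_functionsI)
    fix q assume "q \<in> \<Omega>"
    show "\<exists>c\<in>M. \<exists>W. open W \<and> q \<in> W \<and> q \<in> fst c \<and> smooth_on (chart_image c W) (\<lambda>x. f (chart_inv c x))"
    proof (cases "q \<in> fst c")
      case True
      have "smooth_on (chart_image c (fst c)) (\<lambda>x. f (chart_inv c x))"
        by (rule smooth_on_cong[OF open_chart_image[OF c(1) open_chart[OF c(1)]], THEN iffD2,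
              OF _ smooth_on_subset[OF h]])
          (use c in \<open>auto simp: f_def\<close>)
      then show ?thesis using True c open_chart by blast
    next
      case False
      obtain d where d: "d \<in> M" "q \<in> fst d" using chart_at[OF \<open>q \<in> \<Omega>\<close>] .
      \<comment> \<open>Off the chart \<open>c\<close> any other chart will do: on the open set
        \<open>- K\<close> the extended function is identically 0.\<close>
      have "smooth_on (chart_image d (- K)) (\<lambda>x. f (chart_inv d x))"
        by (rule smooth_on_cong[OF open_chart_image[OF d(1)], THEN iffD2, OF _ _ smooth_on_const[of _ 0]])
          (use d b in \<open>auto simp: f_def h_def\<close>)
      then show ?thesis using False d b(3,4) by (intro bexI[of _ d] exI[of _ "- K"]) auto
    qed
  qed
  moreover have "fd (\<lambda>x. f (chart_inv c x)) (snd c p) v = v \<bullet> i" for v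
  proof -
    have "fd (\<lambda>x. f (chart_inv c x)) (snd c p) v = fd h (snd c p) v"
      by (rule fun_cong[OF fd_cong_open], rule open_chart_image[OF c(1) open_UNIV]) (use c in \<open>auto simp: f_def\<close>)
    also have "fd h (snd c p) v = fd (\<lambda>x. (x - snd c p) \<bullet> i) (snd c p) v"
      unfolding h_def
      by (subst fd_scaleR) (auto intro!: smooth_on_differentiable[OF b(1)] smooth_on_differentiable[OF lin]
          simp: b(2))
    also have "\<dots> = v \<bullet> i"
      by (subst fd_eqI[of _ "\<lambda>v. v \<bullet> i"]) (auto intro!: derivative_eq_intros)
    finally show ?thesis .
  qed
  ultimately show thesis by (rule that)
qed

text \<open>Identities stated for fields on \<Omega> can hereby be tested against every tangent
  vector at \<open>p\<close>, as nondegeneracy requires.\<close>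

lemma exists_vector_field:
  assumes "p \<in> \<Omega>" "\<xi> \<in> tangent_space M p"
  shows "\<exists>X\<in>\<XX> M \<Omega>. X p = \<xi>"
proof -
  obtain c where c: "c \<in> M" "p \<in> fst c" using chart_at[OF assms(1)] .
  obtain b K where b: "smooth_on UNIV b" "b (snd c p) = (1::real)" "closed K" "K \<subseteq> fst c"
    "\<And>q. q \<in> fst c \<Longrightarrow> q \<notin> K \<Longrightarrow> b (snd c q) = 0"
    by (rule chart_bump[OF c]) blast
  \<comment> \<open>Constant components in the chart \<open>c\<close>, damped by the bump function
    and continued by 0.\<close>
  define X where "X = (\<lambda>q\<in>\<Omega>. if q \<in> fst c then b (snd c q) \<odot> tvec_of M c q (\<xi> c) else tzero)"
  have "X \<in> \<XX> M \<Omega>"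
  proof (rule vector_fieldsI)
    show "X q \<in> tangent_space M q" if "q \<in> \<Omega>" for q
      using that c by (simp add: X_def tangent_space_tscale tvec_of_tangent tangent_space_tzero)
    show "X \<in> extensional \<Omega>" by (simp add: X_def)
    fix q assume "q \<in> \<Omega>"
    show "\<exists>c\<in>M. \<exists>W. open W \<and> q \<in> W \<and> q \<in> fst c \<and> W \<subseteq> \<Omega> \<and> smooth_on (chart_image c W) (comp_in c X)"
    proof (cases "q \<in> fst c")
      case True
      have "smooth_on (chart_image c \<Omega>) (\<lambda>x. b x *\<^sub>R \<xi> c)"
        by (intro smooth_on_scaleR open_region_image c smooth_on_const smooth_on_subset[OF b(1)]) simp
      then have "smooth_on (chart_image c \<Omega>) (comp_in c X)"
        by (rule smooth_on_cong[OF open_region_image[OF c(1)], THEN iffD1, rotated])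
          (use c in \<open>auto simp: X_def tscale_def\<close>)
      then show ?thesis using True c open_\<Omega> \<open>q \<in> \<Omega>\<close> by blast
    next
      case False
      obtain d where d: "d \<in> M" "q \<in> fst d" using chart_at[OF \<open>q \<in> \<Omega>\<close>] .
      have "smooth_on (chart_image d (\<Omega> - K)) (comp_in d X)"
        by (rule smooth_on_cong[OF open_chart_image[OF d(1)], THEN iffD2, OF _ _ smooth_on_const[of _ 0]])
          (use d b open_\<Omega> in \<open>auto simp: X_def tscale_def tzero_def open_Diff\<close>)
      then show ?thesis using False d b(3,4) open_\<Omega> \<open>q \<in> \<Omega>\<close>
        by (intro bexI[of _ d] exI[of _ "\<Omega> - K"]) auto
    qed
  qed
  moreover have "X p = \<xi>"
    using assms c b(2) by (simp add: X_def tvec_of_coord tscale_def)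
  ultimately show ?thesis by blast
qed

text \<open>The bracket is a definite description, so a field \<open>W\<close> with the coordinate
  formula has to be shown to exist, to act as the commutator, and to be determined by that
  action.\<close>

lemma lie_bracket_chart:
  assumes X: "X \<in> \<XX> M \<Omega>" and Y: "Y \<in> \<XX> M \<Omega>"
  shows "lie_bracket M \<Omega> X Y \<in> \<XX> M \<Omega>"
    and "c \<in> M \<Longrightarrow> p \<in> fst c \<Longrightarrow> p \<in> \<Omega> \<Longrightarrow> lie_bracket M \<Omega> X Y p c =
      fd (comp_in c Y) (snd c p) (X p c) - fd (comp_in c X) (snd c p) (Y p c)"
proof -
  define br where "br = (\<lambda>c x. fd (comp_in c Y) x (comp_in c X x) - fd (comp_in c X) x (comp_in c Y x))"
  define W where "W = (\<lambda>p\<in>\<Omega>. (\<lambda>c. if c \<in> M \<and> p \<in> fst c then br c (snd c p) else 0))"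
  have br_smooth: "smooth_on (chart_image c \<Omega>) (br c)" if "c \<in> M" for c
  proof -
    note X' = vector_fieldsD(3)[OF X that] and Y' = vector_fieldsD(3)[OF Y that]
    show ?thesis unfolding br_def
      by (intro smooth_on_diff open_region_image that)
        (rule smooth_on_linear_apply[OF open_region_image[OF that] linear_fd[OF smooth_on_differentiable[OF Y']]
            smooth_on_fd[OF Y'] X']
          smooth_on_linear_apply[OF open_region_image[OF that] linear_fd[OF smooth_on_differentiable[OF X']]
            smooth_on_fd[OF X'] Y']; assumption)+
  qed
  \<comment> \<open>The component of \<open>Y\<close> in \<open>d\<close> is the derivative of
    \<open>transition c d\<close> along \<open>Y\<close>; hence its derivative along
    \<open>X\<close> can be computed in the chart \<open>c\<close>.\<close>
  have along: "fd (comp_in d Y) (snd d p) (X p d) =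
      fd (\<lambda>y. fd (transition c d) y (comp_in c Y y)) (snd c p) (X p c)"
    if X: "X \<in> \<XX> M \<Omega>" and Y: "Y \<in> \<XX> M \<Omega>" and c: "c \<in> M" "p \<in> fst c" "p \<in> \<Omega>" and d: "d \<in> M" "p \<in> fst d"
    for c d p X Y
  proof -
    have S: "open (chart_image c (fst d \<inter> \<Omega>))"
      by (intro open_chart_image c open_Int open_chart d open_\<Omega>)
    have "fd (\<lambda>y. fd (transition c d) y (comp_in c Y y)) (snd c p) (X p c) =
        fd (\<lambda>y. comp_in d Y (transition c d y)) (snd c p) (X p c)"
      by (rule fun_cong[OF fd_cong_open], rule S)
        (use c d in \<open>auto simp: tangent_spaceD[OF vector_fieldsD(1)[OF Y], symmetric]\<close>)
    also have "fd (\<lambda>y. comp_in d Y (transition c d y)) (snd c p) (X p c) =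
        fd (comp_in d Y) (transition c d (snd c p)) (fd (transition c d) (snd c p) (X p c))"
      using c d by (intro fd_chain[of _ _ "comp_in d Y"] differentiable_transition
          smooth_on_differentiable[OF vector_fieldsD(3)[OF Y d(1)]]) auto
    also have "fd (transition c d) (snd c p) (X p c) = X p d"
      using tangent_spaceD[OF vector_fieldsD(1)[OF X]] c d by metis
    finally show ?thesis using c by simp
  qed
  have W_T: "W p \<in> tangent_space M p" if p: "p \<in> \<Omega>" for p
  proof -
    have br_transform: "br d (snd d p) = fd (transition c d) (snd c p) (br c (snd c p))"
      if c: "c \<in> M" "p \<in> fst c" and d: "d \<in> M" "p \<in> fst d" for c d
    proof -
      have S: "open (chart_image c (fst d \<inter> \<Omega>))" "snd c p \<in> chart_image c (fst d \<inter> \<Omega>)"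
        using c d p by (auto intro: open_chart_image open_chart open_\<Omega>)
      have sub: "chart_image c (fst d \<inter> \<Omega>) \<subseteq> chart_image c \<Omega>"
        "chart_image c (fst d \<inter> \<Omega>) \<subseteq> chart_image c (fst d)" by auto
      \<comment> \<open>Applied to the transition map in place of a function, the commutator
        identity becomes the transformation law of the bracket.\<close>
      note comm = fd_commutator[OF S smooth_on_subset[OF smooth_transition[OF c(1) d(1)] sub(2)]
          smooth_on_subset[OF vector_fieldsD(3)[OF X c(1)] sub(1)]
          smooth_on_subset[OF vector_fieldsD(3)[OF Y c(1)] sub(1)]]
      have "br d (snd d p) = fd (comp_in d Y) (snd d p) (X p d) - fd (comp_in d X) (snd d p) (Y p d)"
        using d by (simp add: br_def)
      also have "\<dots> = fd (\<lambda>y. fd (transition c d) y (comp_in c Y y)) (snd c p) (X p c) -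
          fd (\<lambda>y. fd (transition c d) y (comp_in c X y)) (snd c p) (Y p c)"
        by (simp only: along[OF X Y c p d] along[OF Y X c p d])
      also have "\<dots> = fd (transition c d) (snd c p) (br c (snd c p))"
        using comm c unfolding br_def by (simp only: chart_inv_chart)
      finally show ?thesis .
    qed
    have W_coord: "W p c = br c (snd c p)" if "c \<in> M" "p \<in> fst c" for c
      using p that by (simp add: W_def)
    have "W p d = fd (transition c d) (snd c p) (W p c)"
      if "c \<in> M" "d \<in> M" "p \<in> fst c" "p \<in> fst d" for c d
      unfolding W_coord[OF that(1,3)] W_coord[OF that(2,4)] by (rule br_transform[OF that(1,3,2,4)])
    then show ?thesis by (rule tangent_spaceI[rotated]) (use p in \<open>auto simp: W_def\<close>)
  qed
  have W: "W \<in> \<XX> M \<Omega>"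
  proof (rule vector_fieldsI[OF W_T])
    show "W \<in> extensional \<Omega>" by (simp add: W_def)
    fix q assume "q \<in> \<Omega>"
    obtain d where d: "d \<in> M" "q \<in> fst d" using chart_at[OF \<open>q \<in> \<Omega>\<close>] .
    have "smooth_on (chart_image d \<Omega>) (comp_in d W)"
      by (rule smooth_on_cong[OF open_region_image[OF d(1)], THEN iffD1, OF _ br_smooth[OF d(1)]])
        (use d in \<open>auto simp: W_def\<close>)
    then show "\<exists>c\<in>M. \<exists>W'. open W' \<and> q \<in> W' \<and> q \<in> fst c \<and> W' \<subseteq> \<Omega> \<and> smooth_on (chart_image c W') (comp_in c W)"
      using d open_\<Omega> \<open>q \<in> \<Omega>\<close> by blast
  qed
  have apply2: "vf_apply M X (vf_apply M Y f) p =
      fd (\<lambda>x. fd (\<lambda>x. f (chart_inv c x)) x (comp_in c Y x)) (snd c p) (X p c)"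
    if X: "X \<in> \<XX> M \<Omega>" and Y: "Y \<in> \<XX> M \<Omega>" and f: "f \<in> smooth_functions M \<Omega>"
      and c: "c \<in> M" "p \<in> fst c" "p \<in> \<Omega>" for X Y f c p
  proof -
    have S: "open (chart_image c \<Omega>)" "snd c p \<in> chart_image c \<Omega>"
      using c open_region_image by auto
    have eq: "vf_apply M Y f (chart_inv c x) = fd (\<lambda>x. f (chart_inv c x)) x (comp_in c Y x)"
      if "x \<in> chart_image c \<Omega>" for x
    proof -
      have q: "chart_inv c x \<in> fst c" "chart_inv c x \<in> \<Omega>" "snd c (chart_inv c x) = x"
        using that c by auto
      have "(\<lambda>x. f (chart_inv c x)) differentiable (at (snd c (chart_inv c x)))"
        using smooth_on_differentiable[OF smooth_functionsD[OF f c(1)] that] by (simp only: q(3))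
      from vf_apply_chart[where f = f, OF c(1) q(1,2) Y this] show ?thesis
        by (simp only: q(3))
    qed
    have "smooth_on (chart_image c \<Omega>) (\<lambda>x. fd (\<lambda>x. f (chart_inv c x)) x (comp_in c Y x))"
      by (rule smooth_on_linear_apply[OF S(1) linear_fd[OF smooth_on_differentiable[OF smooth_functionsD[OF f c(1)]]]
          smooth_on_fd[OF smooth_functionsD[OF f c(1)]] vector_fieldsD(3)[OF Y c(1)]])
    from smooth_on_differentiable[OF this S(2)]
    have "(\<lambda>x. vf_apply M Y f (chart_inv c x)) differentiable (at (snd c p))"
      using differentiable_cong_open[where f = "\<lambda>x. vf_apply M Y f (chart_inv c x)"
          and g = "\<lambda>x. fd (\<lambda>x. f (chart_inv c x)) x (comp_in c Y x)", OF S eq] by simp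
    from vf_apply_chart[where f = "vf_apply M Y f", OF c X this] show ?thesis
      using fd_cong_open[where f = "\<lambda>x. vf_apply M Y f (chart_inv c x)"
          and g = "\<lambda>x. fd (\<lambda>x. f (chart_inv c x)) x (comp_in c Y x)", OF S eq] by simp
  qed
  have W_br: "vf_apply M W f p = vf_apply M X (vf_apply M Y f) p - vf_apply M Y (vf_apply M X f) p"
    if f: "f \<in> smooth_functions M \<Omega>" and p: "p \<in> \<Omega>" for f p
  proof -
    obtain c where c: "c \<in> M" "p \<in> fst c" using chart_at[OF p] .
    have S: "open (chart_image c \<Omega>)" "snd c p \<in> chart_image c \<Omega>"
      using c p open_region_image by auto
    have "vf_apply M W f p = fd (\<lambda>x. f (chart_inv c x)) (snd c p) (br c (snd c p))"
      using vf_apply_chart[OF c p W smooth_on_differentiable[OF smooth_functionsD[OF f c(1)] S(2)]] c p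
      by (simp add: W_def)
    then show ?thesis
      using apply2[OF X Y f c p] apply2[OF Y X f c p] c
        fd_commutator[OF S smooth_functionsD[OF f c(1)] vector_fieldsD(3)[OF X c(1)] vector_fieldsD(3)[OF Y c(1)]]
      by (simp add: br_def)
  qed
  \<comment> \<open>Functions with the differential \<open>v \<bullet> i\<close> recover every
    component of a field from its action.\<close>
  have uniq: "W' = W" if W': "W' \<in> \<XX> M \<Omega>"
    and eq: "\<And>f p. f \<in> smooth_functions M \<Omega> \<Longrightarrow> p \<in> \<Omega> \<Longrightarrow> vf_apply M W' f p = vf_apply M W f p" for W'
  proof (rule extensionalityI[OF vector_fieldsD(2)[OF W'] vector_fieldsD(2)[OF W]])
    fix p assume p: "p \<in> \<Omega>"
    obtain c where c: "c \<in> M" "p \<in> fst c" using chart_at[OF p] .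
    have S: "snd c p \<in> chart_image c \<Omega>" using c p by auto
    have "W' p c \<bullet> i = W p c \<bullet> i" for i
    proof -
      obtain f where f: "f \<in> smooth_functions M \<Omega>" "\<And>v. fd (\<lambda>x. f (chart_inv c x)) (snd c p) v = v \<bullet> i"
        by (rule exists_smooth_function[OF c p, of i]) blast
      note d = smooth_on_differentiable[OF smooth_functionsD[OF f(1) c(1)] S]
      show ?thesis
        using eq[OF f(1) p] vf_apply_chart[OF c p W' d] vf_apply_chart[OF c p W d] f(2) by simp
    qed
    then have "W' p c = W p c" using euclidean_eqI by metis
    then show "W' p = W p"
      by (rule tangent_space_eqI[OF vector_fieldsD(1)[OF W' p] vector_fieldsD(1)[OF W p] c])
  qed
  have "lie_bracket M \<Omega> X Y = W"
    unfolding lie_bracket_def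
    by (rule the_equality) (auto simp: W W_br intro!: uniq)
  then show "lie_bracket M \<Omega> X Y \<in> \<XX> M \<Omega>"
    and "c \<in> M \<Longrightarrow> p \<in> fst c \<Longrightarrow> p \<in> \<Omega> \<Longrightarrow> lie_bracket M \<Omega> X Y p c =
      fd (comp_in c Y) (snd c p) (X p c) - fd (comp_in c X) (snd c p) (Y p c)"
    using W by (auto simp: W_def br_def)
qed

end

section \<open>The fundamental and Cartan tensors in a chart\<close>

text \<open>Links the one-variable derivatives in the definitions of the tensors to
  \<open>fd\<close>.\<close>

lemma deriv_line:
  fixes F :: "'b::real_normed_vector \<Rightarrow> real"
  assumes "F differentiable (at a)"
  shows "deriv (\<lambda>s. F (a + s *\<^sub>R b)) 0 = fd F a b"
proof (rule DERIV_imp_deriv)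
  have "((\<lambda>s. a + s *\<^sub>R b) has_derivative (\<lambda>h. h *\<^sub>R b)) (at 0)"
    by (auto intro!: derivative_eq_intros)
  moreover have "(F has_derivative fd F a) (at (a + 0 *\<^sub>R b))"
    using has_derivative_fd[OF assms] by simp
  ultimately have "((\<lambda>s. F (a + s *\<^sub>R b)) has_derivative (\<lambda>h. fd F a (h *\<^sub>R b))) (at 0)"
    by (rule has_derivative_compose)
  also have "(\<lambda>h. fd F a (h *\<^sub>R b)) = (*) (fd F a b)"
    by (auto simp: linear_scale[OF linear_fd[OF assms]])
  finally show "((\<lambda>s. F (a + s *\<^sub>R b)) has_real_derivative fd F a b) (at 0)"
    by (simp add: has_field_derivative_def)
qed

lemma eventually_line_in_open:
  fixes a b :: "'b::real_normed_vector"
  assumes "open U" "a \<in> U" shows "\<forall>\<^sub>F t in nhds (0::real). a + t *\<^sub>R b \<in> U"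
proof -
  have "open ((\<lambda>t. a + t *\<^sub>R b) -` U)"
    by (intro open_vimage assms continuous_intros)
  then show ?thesis using eventually_nhds_in_open[of _ 0] assms(2) by force
qed

text \<open>The inner derivative is known only while the base point \<open>a + t *\<^sub>R u\<close>
  stays in \<open>U\<close>, that is for small \<open>t\<close>; the outer derivative at 0 sees no
  other \<open>t\<close>.\<close>

lemma deriv_line2:
  fixes F :: "'b::real_normed_vector \<Rightarrow> real"
  assumes "open U" "a \<in> U" "smooth_on U F"
  shows "deriv (\<lambda>t. deriv (\<lambda>s. F (a + t *\<^sub>R u + s *\<^sub>R w)) 0) 0 = fd (\<lambda>z. fd F z w) a u"
proof -
  have "deriv (\<lambda>t. deriv (\<lambda>s. F (a + t *\<^sub>R u + s *\<^sub>R w)) 0) 0 = deriv (\<lambda>t. fd F (a + t *\<^sub>R u) w) 0"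
    by (rule deriv_cong_ev[OF eventually_mono[OF eventually_line_in_open[OF assms(1,2)]] refl])
      (rule deriv_line[OF smooth_on_differentiable[OF assms(3)]])
  also have "\<dots> = fd (\<lambda>z. fd F z w) a u"
    by (rule deriv_line[OF smooth_on_differentiable[OF smooth_on_fd[OF assms(3)] assms(2)]])
  finally show ?thesis .
qed

lemma deriv_line3:
  fixes F :: "'b::real_normed_vector \<Rightarrow> real"
  assumes "open U" "a \<in> U" "smooth_on U F"
  shows "deriv (\<lambda>s3. deriv (\<lambda>s2. deriv (\<lambda>s1. F (a + s1 *\<^sub>R w1 + s2 *\<^sub>R w2 + s3 *\<^sub>R w3)) 0) 0) 0 =
    fd (\<lambda>z. fd (\<lambda>z. fd F z w1) z w2) a w3"
proof -
  \<comment> \<open>Reordering the summands puts the outer variable next to \<open>a\<close>, so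
    that \<open>deriv_line2\<close> applies at the base point
    \<open>a + s3 *\<^sub>R w3\<close>.\<close>
  have "deriv (\<lambda>s3. deriv (\<lambda>s2. deriv (\<lambda>s1. F (a + s1 *\<^sub>R w1 + s2 *\<^sub>R w2 + s3 *\<^sub>R w3)) 0) 0) 0 =
      deriv (\<lambda>s3. deriv (\<lambda>s2. deriv (\<lambda>s1. F (a + s3 *\<^sub>R w3 + s2 *\<^sub>R w2 + s1 *\<^sub>R w1)) 0) 0) 0"
    by (simp only: add_ac)
  also have "\<dots> = deriv (\<lambda>s3. fd (\<lambda>z. fd F z w1) (a + s3 *\<^sub>R w3) w2) 0"
    by (rule deriv_cong_ev[OF eventually_mono[OF eventually_line_in_open[OF assms(1,2)]] refl])
      (rule deriv_line2[OF assms(1) _ assms(3)])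
  also have "\<dots> = fd (\<lambda>z. fd (\<lambda>z. fd F z w1) z w2) a w3"
    by (rule deriv_line[OF smooth_on_differentiable[OF smooth_on_fd[OF smooth_on_fd[OF assms(3)]] assms(2)]])
  finally show ?thesis .
qed

text \<open>Differentiate \<open>F\<close> composed with the fibre dilation \<open>\<sigma>\<close>
  in two ways and cancel one factor \<open>r\<close>. Writing the degree as \<open>Suc k\<close>
  avoids a truncated subtraction.\<close>

lemma homogeneous_fd:
  fixes F :: "'x::real_normed_vector \<times> 'y::real_normed_vector \<Rightarrow> real"
  assumes U: "open U" "\<And>x y r. (x, y) \<in> U \<Longrightarrow> r > 0 \<Longrightarrow> (x, r *\<^sub>R y) \<in> U"
    and d: "\<And>z. z \<in> U \<Longrightarrow> F differentiable (at z)"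
    and hom: "\<And>x y r. (x, y) \<in> U \<Longrightarrow> r > 0 \<Longrightarrow> F (x, r *\<^sub>R y) = r ^ Suc k * F (x, y)"
    and xy: "(x, y) \<in> U" "r > 0"
  shows "fd F (x, r *\<^sub>R y) (0, u) = r ^ k * fd F (x, y) (0, u)"
proof -
  define \<sigma> where "\<sigma> = (\<lambda>z::'x \<times> 'y. (fst z, r *\<^sub>R snd z))"
  have bl: "bounded_linear \<sigma>" unfolding \<sigma>_def
    by (intro bounded_linear_Pair bounded_linear_fst
        bounded_linear_compose[OF bounded_linear_scaleR_right bounded_linear_snd])
  have "fd F (\<sigma> (x, y)) (fd \<sigma> (x, y) (0, u)) = fd (\<lambda>z. F (\<sigma> z)) (x, y) (0, u)"
    using U(2)[OF xy]
    by (intro fd_chain[symmetric] bounded_linear_imp_differentiable[OF bl] d) (simp add: \<sigma>_def)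
  also have "\<dots> = fd (\<lambda>z. r ^ Suc k * F z) (x, y) (0, u)"
    by (rule fun_cong[OF fd_cong_open], rule U(1)) (use xy hom in \<open>auto simp: \<sigma>_def\<close>)
  also have "\<dots> = r ^ Suc k * fd F (x, y) (0, u)"
    by (rule fd_bounded_linear[OF bounded_linear_mult_right d[OF xy(1)]])
  also have "fd \<sigma> (x, y) (0, u) = r *\<^sub>R (0, u)"
    using fd_eqI[OF bounded_linear_imp_has_derivative[OF bl]] by (simp add: \<sigma>_def)
  also have "fd F (\<sigma> (x, y)) (r *\<^sub>R (0, u)) = r * fd F (x, r *\<^sub>R y) (0, u)"
    using linear_scale[OF linear_fd[OF d[OF U(2)[OF xy]]], of r "(0, u)"] by (simp add: \<sigma>_def)
  finally show ?thesis using xy(2) by simp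
qed

text \<open>Euler's relation in degree 0: \<open>H\<close> is constant on the ray through
  \<open>y\<close>.\<close>

lemma homogeneous_0_fd:
  fixes H :: "'x::real_normed_vector \<times> 'y::real_normed_vector \<Rightarrow> real"
  assumes d: "H differentiable (at (x, y))"
    and hom: "\<And>r. r > 0 \<Longrightarrow> H (x, r *\<^sub>R y) = H (x, y)"
  shows "fd H (x, y) (0, y) = 0"
proof -
  have "fd H (x, y) (0, y) = deriv (\<lambda>t. H ((x, y) + t *\<^sub>R (0, y))) 0"
    by (rule deriv_line[OF d, symmetric])
  also have "\<dots> = deriv (\<lambda>t. H (x, y)) (0::real)"
  proof (rule deriv_cong_ev[OF eventually_mono refl])
    \<comment> \<open>\<open>t > -1\<close> makes the factor \<open>1 + t\<close> positive.\<close>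
    show "\<forall>\<^sub>F t in nhds (0::real). t \<in> {-1<..}"
      by (intro eventually_nhds_in_open) auto
    show "H ((x, y) + t *\<^sub>R (0, y)) = H (x, y)" if "t \<in> {-1<..}" for t
      using hom[of "1 + t"] that by (simp add: scaleR_add_left)
  qed
  finally show ?thesis by simp
qed

context manifold_region
begin

section \<open>Sums and multiples of vector fields\<close>

lemma vf_add_in [intro]:
  assumes X: "X \<in> \<XX> M \<Omega>" and Y: "Y \<in> \<XX> M \<Omega>" shows "vf_add \<Omega> X Y \<in> \<XX> M \<Omega>"
proof (rule vector_fieldsI)
  show "vf_add \<Omega> X Y p \<in> tangent_space M p" if "p \<in> \<Omega>" for p
    using that by (simp add: vf_add_def tangent_space_tadd vector_fieldsD(1)[OF X] vector_fieldsD(1)[OF Y])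
  show "vf_add \<Omega> X Y \<in> extensional \<Omega>" by (simp add: vf_add_def)
  fix p assume "p \<in> \<Omega>"
  obtain c where c: "c \<in> M" "p \<in> fst c" using chart_at[OF \<open>p \<in> \<Omega>\<close>] .
  have "smooth_on (chart_image c \<Omega>) (\<lambda>x. comp_in c X x + comp_in c Y x)"
    by (intro smooth_on_add open_region_image c vector_fieldsD(3)[OF X] vector_fieldsD(3)[OF Y])
  then have "smooth_on (chart_image c \<Omega>) (comp_in c (vf_add \<Omega> X Y))"
    by (rule smooth_on_cong[OF open_region_image[OF c(1)], THEN iffD1, rotated])
      (use c in \<open>auto simp: vf_add_def tadd_def\<close>)
  then show "\<exists>c\<in>M. \<exists>W. open W \<and> p \<in> W \<and> p \<in> fst c \<and> W \<subseteq> \<Omega> \<and>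
      smooth_on (chart_image c W) (comp_in c (vf_add \<Omega> X Y))"
    using c open_\<Omega> \<open>p \<in> \<Omega>\<close> by blast
qed

lemma vf_scale_in [intro]:
  assumes f: "f \<in> smooth_functions M \<Omega>" and X: "X \<in> \<XX> M \<Omega>" shows "vf_scale \<Omega> f X \<in> \<XX> M \<Omega>"
proof (rule vector_fieldsI)
  show "vf_scale \<Omega> f X p \<in> tangent_space M p" if "p \<in> \<Omega>" for p
    using that by (simp add: vf_scale_def tangent_space_tscale vector_fieldsD(1)[OF X])
  show "vf_scale \<Omega> f X \<in> extensional \<Omega>" by (simp add: vf_scale_def)
  fix p assume "p \<in> \<Omega>"
  obtain c where c: "c \<in> M" "p \<in> fst c" using chart_at[OF \<open>p \<in> \<Omega>\<close>] .
  have "smooth_on (chart_image c \<Omega>) (\<lambda>x. f (chart_inv c x) *\<^sub>R comp_in c X x)"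
    by (intro smooth_on_scaleR open_region_image c vector_fieldsD(3)[OF X] smooth_functionsD[OF f])
  then have "smooth_on (chart_image c \<Omega>) (comp_in c (vf_scale \<Omega> f X))"
    by (rule smooth_on_cong[OF open_region_image[OF c(1)], THEN iffD1, rotated])
      (use c in \<open>auto simp: vf_scale_def tscale_def\<close>)
  then show "\<exists>c\<in>M. \<exists>W. open W \<and> p \<in> W \<and> p \<in> fst c \<and> W \<subseteq> \<Omega> \<and>
      smooth_on (chart_image c W) (comp_in c (vf_scale \<Omega> f X))"
    using c open_\<Omega> \<open>p \<in> \<Omega>\<close> by blast
qed

lemma vf_differentiable:
  assumes "X \<in> \<XX> M \<Omega>" "c \<in> M" "p \<in> fst c" "p \<in> \<Omega>"
  shows "comp_in c X differentiable (at (snd c p))"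
  by (rule smooth_on_differentiable[OF vector_fieldsD(3)[OF assms(1,2)]]) (use assms in auto)

end

locale finsler_field = manifold_region M \<Omega>
  for M :: "('a::{t2_space,second_countable_topology}, 'e::euclidean_space) atlas" and \<Omega> :: "'a set" +
  fixes A :: "('a \<times> ('a, 'e) tvec) set" and L :: "'a \<times> ('a, 'e) tvec \<Rightarrow> real"
    and V :: "'a \<Rightarrow> ('a, 'e) tvec"
  assumes metric: "pseudo_finsler_metric M A L" and V_admissible: "admissible M A \<Omega> V"
begin

section \<open>The metric along \<open>V\<close> in coordinates\<close>

lemma V_field: "V \<in> \<XX> M \<Omega>"
  using V_admissible by (simp add: admissible_def)

lemma V_in: "p \<in> \<Omega> \<Longrightarrow> (p, V p) \<in> A"
  using V_admissible by (simp add: admissible_def)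

definition domc :: "('a, 'e) chart \<Rightarrow> ('e \<times> 'e) set" where
  "domc c = tchart c ` {(p, \<xi>) \<in> A. p \<in> fst c}"

definition Lc :: "('a, 'e) chart \<Rightarrow> 'e \<times> 'e \<Rightarrow> real" where
  "Lc c = L \<circ> tchart_inv M c"

text \<open>Fibre derivatives are those in directions \<open>(0, u)\<close>. The base point
  \<open>(x, comp_in c V x)\<close> follows the section \<open>V\<close>, so differentiating
  \<open>g c\<close> in \<open>x\<close> also captures the dependence through
  \<open>V\<close>.\<close>

definition g :: "('a, 'e) chart \<Rightarrow> 'e \<Rightarrow> 'e \<Rightarrow> 'e \<Rightarrow> real" where
  "g c x u w = 1/2 * fd (\<lambda>z. fd (Lc c) z (0, w)) (x, comp_in c V x) (0, u)"

definition C :: "('a, 'e) chart \<Rightarrow> 'e \<Rightarrow> 'e \<Rightarrow> 'e \<Rightarrow> 'e \<Rightarrow> real" where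
  "C c x a y z = 1/4 * fd (\<lambda>z. fd (\<lambda>z. fd (Lc c) z (0, a)) z (0, y)) (x, comp_in c V x) (0, z)"

lemma A_tangent: "(p, \<xi>) \<in> A \<Longrightarrow> \<xi> \<in> tangent_space M p"
  using metric unfolding pseudo_finsler_metric_def conic_domain_def tangent_bundle_def by blast

lemma open_domc: "c \<in> M \<Longrightarrow> open (domc c)"
  using metric unfolding pseudo_finsler_metric_def conic_domain_def open_in_tangent_bundle_def domc_def
  by blast

lemma smooth_Lc: "c \<in> M \<Longrightarrow> smooth_on (domc c) (Lc c)"
  using metric unfolding pseudo_finsler_metric_def smooth_on_tangent_bundle_def domc_def Lc_def
  by blast

lemma Lc_eq: "c \<in> M \<Longrightarrow> p \<in> fst c \<Longrightarrow> \<xi> \<in> tangent_space M p \<Longrightarrow> Lc c (snd c p, \<xi> c) = L (p, \<xi>)"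
  by (simp add: Lc_def tchart_inv_def tvec_of_coord)

lemma domc_scale:
  assumes c: "c \<in> M" and xy: "(x, y) \<in> domc c" and r: "r > 0"
  shows "(x, r *\<^sub>R y) \<in> domc c" "Lc c (x, r *\<^sub>R y) = r\<^sup>2 * Lc c (x, y)"
proof -
  obtain p \<xi> where p: "(p, \<xi>) \<in> A" "p \<in> fst c" "x = snd c p" "y = \<xi> c"
    using xy by (auto simp: domc_def tchart_def)
  have s: "(p, r \<odot> \<xi>) \<in> A"
    using metric p(1) r unfolding pseudo_finsler_metric_def conic_domain_def by blast
  have L: "L (p, r \<odot> \<xi>) = r\<^sup>2 * L (p, \<xi>)"
    using metric p(1) r unfolding pseudo_finsler_metric_def by blast
  show "(x, r *\<^sub>R y) \<in> domc c"
    unfolding domc_def by (rule image_eqI[of _ _ "(p, r \<odot> \<xi>)"]) (use s p in \<open>auto simp: tchart_def tscale_def\<close>)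
  show "Lc c (x, r *\<^sub>R y) = r\<^sup>2 * Lc c (x, y)"
    using Lc_eq[OF c p(2) A_tangent[OF s]] Lc_eq[OF c p(2) A_tangent[OF p(1)]] L p
    by (simp add: tscale_def)
qed

lemma in_domc:
  assumes "c \<in> M" "x \<in> chart_image c \<Omega>" shows "(x, comp_in c V x) \<in> domc c"
proof -
  obtain p where "p \<in> fst c" "p \<in> \<Omega>" "x = snd c p" using assms(2) by auto
  then show ?thesis unfolding domc_def
    by (intro image_eqI[of _ _ "(p, V p)"]) (use assms(1) V_in in \<open>auto simp: tchart_def\<close>)
qed

lemma in_domc': "c \<in> M \<Longrightarrow> p \<in> fst c \<Longrightarrow> p \<in> \<Omega> \<Longrightarrow> (snd c p, V p c) \<in> domc c"
  using in_domc[of c "snd c p"] by auto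

lemma fundamental_tensor_chart:
  assumes c: "c \<in> M" "p \<in> fst c" "p \<in> \<Omega>" and T: "u \<in> tangent_space M p" "w \<in> tangent_space M p"
  shows "fundamental_tensor L p (V p) u w = g c (snd c p) (u c) (w c)"
proof -
  have L_line: "L (p, V p \<oplus> t \<odot> u \<oplus> s \<odot> w) =
      Lc c ((snd c p, V p c) + t *\<^sub>R (0, u c) + s *\<^sub>R (0, w c))" for s t
    using Lc_eq[OF c(1,2), of "V p \<oplus> t \<odot> u \<oplus> s \<odot> w"] T vector_fieldsD(1)[OF V_field c(3)]
    by (simp add: tangent_space_tadd tangent_space_tscale) (simp add: tadd_def tscale_def)
  show ?thesis
    unfolding fundamental_tensor_def g_def
    by (simp only: L_line deriv_line2[OF open_domc[OF c(1)] in_domc'[OF c] smooth_Lc[OF c(1)]]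
        chart_inv_chart[OF c(1,2)])
qed

lemma cartan_tensor_chart:
  assumes c: "c \<in> M" "p \<in> fst c" "p \<in> \<Omega>"
    and T: "a \<in> tangent_space M p" "u \<in> tangent_space M p" "w \<in> tangent_space M p"
  shows "cartan_tensor L p (V p) a u w = C c (snd c p) (a c) (u c) (w c)"
proof -
  have L_line: "L (p, V p \<oplus> r \<odot> a \<oplus> t \<odot> u \<oplus> s \<odot> w) =
      Lc c ((snd c p, V p c) + r *\<^sub>R (0, a c) + t *\<^sub>R (0, u c) + s *\<^sub>R (0, w c))" for r s t
    using Lc_eq[OF c(1,2), of "V p \<oplus> r \<odot> a \<oplus> t \<odot> u \<oplus> s \<odot> w"] T vector_fieldsD(1)[OF V_field c(3)]
    by (simp add: tangent_space_tadd tangent_space_tscale) (simp add: tadd_def tscale_def)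
  show ?thesis
    unfolding cartan_tensor_def C_def
    by (simp only: L_line deriv_line3[OF open_domc[OF c(1)] in_domc'[OF c] smooth_Lc[OF c(1)]]
        chart_inv_chart[OF c(1,2)])
qed

context
  fixes c assumes c: "c \<in> M"
begin

lemma smooth_Lc_fd:
  "smooth_on (domc c) (\<lambda>z. fd (Lc c) z v)"
  "smooth_on (domc c) (\<lambda>z. fd (\<lambda>z. fd (Lc c) z u) z v)"
  "smooth_on (domc c) (\<lambda>z. fd (\<lambda>z. fd (\<lambda>z. fd (Lc c) z u) z v) z w)"
  by (intro smooth_on_fd smooth_Lc c)+

lemma linear_fibre: "linear h \<Longrightarrow> linear (\<lambda>u::'e. h (0::'e, u))"
proof -
  assume "linear h"
  moreover have "linear (\<lambda>u::'e. (0::'e, u))" by (rule linearI) simp_all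
  ultimately show ?thesis using linear_compose by (force simp: o_def)
qed

lemma smooth_at_V:
  assumes "smooth_on (domc c) h" shows "smooth_on (chart_image c \<Omega>) (\<lambda>x. h (x, comp_in c V x))"
proof (rule smooth_on_compose[OF open_region_image[OF c] assms])
  have "smooth_on (chart_image c \<Omega>) (\<lambda>x. (x, 0) + (0, comp_in c V x))"
    by (intro smooth_on_add open_region_image c
        smooth_on_bounded_linear[OF bounded_linear_Pair[OF bounded_linear_ident bounded_linear_zero] _ smooth_on_ident]
        smooth_on_bounded_linear[OF bounded_linear_Pair[OF bounded_linear_zero bounded_linear_ident] _
          vector_fieldsD(3)[OF V_field c]])
  then show "smooth_on (chart_image c \<Omega>) (\<lambda>x. (x, comp_in c V x))" by simp
qed (rule in_domc[OF c])

lemma g_smooth: "smooth_on (chart_image c \<Omega>) (\<lambda>x. g c x u w)"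
  unfolding g_def by (intro smooth_on_mult_const open_region_image c smooth_at_V smooth_Lc_fd)

lemma C_smooth: "smooth_on (chart_image c \<Omega>) (\<lambda>x. C c x a u w)"
  unfolding C_def by (intro smooth_on_mult_const open_region_image c smooth_at_V smooth_Lc_fd)

lemma g_bilinear:
  assumes x: "x \<in> chart_image c \<Omega>" shows "bilinear (g c x)"
proof -
  note d = smooth_on_differentiable[OF smooth_Lc_fd(1) in_domc[OF c x]]
  have "linear (\<lambda>w. fd (\<lambda>z. fd (Lc c) z (0, w)) (x, comp_in c V x) (0, u))" for u
    by (rule linear_fd_param[OF open_domc[OF c] in_domc[OF c x], of "\<lambda>z w. fd (Lc c) z (0, w)"])
      (intro linear_fibre linear_fd smooth_on_differentiable[OF smooth_Lc[OF c]] d; assumption)+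
  moreover have "linear (\<lambda>u. fd (\<lambda>z. fd (Lc c) z (0, w)) (x, comp_in c V x) (0, u))" for w
    by (intro linear_fibre linear_fd d)
  ultimately show ?thesis
    unfolding g_def bilinear_def by (intro conjI allI linear_multI)
qed

lemma g_sym: "x \<in> chart_image c \<Omega> \<Longrightarrow> g c x u w = g c x w u"
  unfolding g_def
  using Ck_on_symmetric[OF open_domc[OF c] smooth_onD[OF smooth_Lc[OF c]] in_domc[OF c], of x "(0, u)" "(0, w)"]
  by simp

lemma C_sym: "x \<in> chart_image c \<Omega> \<Longrightarrow> C c x a u w = C c x a w u"
  unfolding C_def
  using Ck_on_symmetric[OF open_domc[OF c] smooth_onD[OF smooth_Lc_fd(1)] in_domc[OF c], of x "(0, a)" "(0, u)" "(0, w)"]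
  by simp

lemma C_linear:
  assumes x: "x \<in> chart_image c \<Omega>"
  shows "linear (\<lambda>a. C c x a u w)" "linear (\<lambda>u. C c x a u w)"
proof -
  note d2 = smooth_on_differentiable[OF smooth_Lc_fd(2)]
  have 1: "linear (\<lambda>a. fd (\<lambda>z. fd (Lc c) z (0, a)) y (0, u))" if "y \<in> domc c" for y u
    by (rule linear_fd_param[OF open_domc[OF c] that, of "\<lambda>z w. fd (Lc c) z (0, w)"])
      (intro linear_fibre linear_fd smooth_on_differentiable[OF smooth_Lc[OF c]]
        smooth_on_differentiable[OF smooth_Lc_fd(1) that]; assumption)+
  have "linear (\<lambda>a. fd (\<lambda>z. fd (\<lambda>z. fd (Lc c) z (0, a)) z (0, u)) (x, comp_in c V x) (0, w))"
    by (rule linear_fd_param[OF open_domc[OF c] in_domc[OF c x],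
          of "\<lambda>z a. fd (\<lambda>z. fd (Lc c) z (0, a)) z (0, u)"])
      (intro 1 d2[OF in_domc[OF c x]]; assumption)+
  then show "linear (\<lambda>a. C c x a u w)" unfolding C_def by (rule linear_multI)
  have "linear (\<lambda>u. fd (\<lambda>z. fd (\<lambda>z. fd (Lc c) z (0, a)) z (0, u)) (x, comp_in c V x) (0, w))"
    by (rule linear_fd_param[OF open_domc[OF c] in_domc[OF c x],
          of "\<lambda>z u. fd (\<lambda>z. fd (Lc c) z (0, a)) z (0, u)"])
      (intro linear_fibre linear_fd smooth_on_differentiable[OF smooth_Lc_fd(1)] d2[OF in_domc[OF c x]]; assumption)+
  then show "linear (\<lambda>u. C c x a u w)" unfolding C_def by (rule linear_multI)
qed

text \<open>The degree on the fibres drops from 2 to 1 to 0 with the first two derivatives, and the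
  third is taken along the ray through \<open>V\<close>.\<close>

lemma C_V:
  assumes x: "x \<in> chart_image c \<Omega>" shows "C c x a u (comp_in c V x) = 0"
proof -
  have 1: "fd (Lc c) (x, r *\<^sub>R y) (0, a) = r ^ 1 * fd (Lc c) (x, y) (0, a)"
    if "(x, y) \<in> domc c" "r > 0" for x y r
    by (rule homogeneous_fd[OF open_domc[OF c] domc_scale(1)[OF c] _ _ that])
      (auto simp: domc_scale(2)[OF c] power2_eq_square intro: smooth_on_differentiable[OF smooth_Lc[OF c]])
  have 2: "fd (\<lambda>z. fd (Lc c) z (0, a)) (x, r *\<^sub>R y) (0, u) = r ^ 0 * fd (\<lambda>z. fd (Lc c) z (0, a)) (x, y) (0, u)"
    if "(x, y) \<in> domc c" "r > 0" for x y r
    by (rule homogeneous_fd[OF open_domc[OF c] domc_scale(1)[OF c] _ _ that])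
      (auto simp: 1 intro: smooth_on_differentiable[OF smooth_Lc_fd(1)])
  show ?thesis unfolding C_def
    using homogeneous_0_fd[OF smooth_on_differentiable[OF smooth_Lc_fd(2) in_domc[OF c x]], of "(0, a)" "(0, u)"]
      2[OF in_domc[OF c x]] by simp
qed

lemma g_nondegenerate:
  assumes x: "x \<in> chart_image c \<Omega>" and 0: "\<And>w. g c x u w = 0" shows "u = 0"
proof -
  obtain p where p: "p \<in> fst c" "p \<in> \<Omega>" "x = snd c p" using x by auto
  have "fundamental_tensor L p (V p) (tvec_of M c p u) w = 0" if "w \<in> tangent_space M p" for w
    using fundamental_tensor_chart[OF c p(1,2) tvec_of_tangent[OF c p(1)] that, of u] 0 c p by simp
  moreover have "\<forall>(p, v)\<in>A. \<forall>u\<in>tangent_space M p.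
        (\<forall>w\<in>tangent_space M p. fundamental_tensor L p v u w = 0) \<longrightarrow> u = tzero"
    using metric unfolding pseudo_finsler_metric_def by blast
  ultimately have "tvec_of M c p u = tzero"
    using V_in[OF p(2)] tvec_of_tangent[OF c p(1), of u] by blast
  then show "u = 0" using tvec_of_same[OF c p(1), of u] by (simp add: tzero_def)
qed

end

section \<open>Local solutions and uniqueness at a point\<close>

definition is_christoffel :: "('a, 'e) chart \<Rightarrow> ('e \<Rightarrow> 'e \<Rightarrow> 'e \<Rightarrow> 'e) \<Rightarrow> bool" where
  "is_christoffel c \<Gamma> \<longleftrightarrow> (\<forall>x\<in>chart_image c \<Omega>. bilinear (\<Gamma> x) \<and> (\<forall>u w. \<Gamma> x u w = \<Gamma> x w u) \<and>
     (\<forall>u y z. fd (\<lambda>x. g c x y z) x u = g c x (\<Gamma> x u y) z + g c x y (\<Gamma> x u z) +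
       2 * C c x (fd (comp_in c V) x u + \<Gamma> x u (comp_in c V x)) y z)) \<and>
     (\<forall>u w. smooth_on (chart_image c \<Omega>) (\<lambda>x. \<Gamma> x u w))"

definition christoffel :: "('a, 'e) chart \<Rightarrow> 'e \<Rightarrow> 'e \<Rightarrow> 'e \<Rightarrow> 'e" where
  "christoffel c = (SOME \<Gamma>. is_christoffel c \<Gamma>)"

lemma christoffel:
  assumes c: "c \<in> M" shows "is_christoffel c (christoffel c)"
proof (rule exists_christoffel[of "chart_image c \<Omega>" "g c" "C c" "comp_in c V",
    OF open_region_image[OF c] g_bilinear[OF c] g_sym[OF c] g_smooth[OF c] g_nondegenerate[OF c]
      C_linear[OF c] C_sym[OF c] C_V[OF c] C_smooth[OF c] vector_fieldsD(3)[OF V_field c]])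
  fix \<Gamma> assume "\<And>x. x \<in> chart_image c \<Omega> \<Longrightarrow> bilinear (\<Gamma> x)"
    "\<And>x u w. x \<in> chart_image c \<Omega> \<Longrightarrow> \<Gamma> x u w = \<Gamma> x w u"
    "\<And>u w. smooth_on (chart_image c \<Omega>) (\<lambda>x. \<Gamma> x u w)"
    "\<And>x u y z. x \<in> chart_image c \<Omega> \<Longrightarrow> fd (\<lambda>x. g c x y z) x u = g c x (\<Gamma> x u y) z + g c x y (\<Gamma> x u z) +
      2 * C c x (fd (comp_in c V) x u + \<Gamma> x u (comp_in c V x)) y z"
  then have "is_christoffel c \<Gamma>" unfolding is_christoffel_def by (intro conjI ballI allI)
  then show ?thesis unfolding christoffel_def by (rule someI[of "is_christoffel c"])
qed

definition nabla :: "('a, 'e) chart \<Rightarrow> ('a \<Rightarrow> ('a, 'e) tvec) \<Rightarrow> ('a \<Rightarrow> ('a, 'e) tvec) \<Rightarrow> 'a \<Rightarrow> ('a, 'e) tvec" where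
  "nabla c X Y p = tvec_of M c p
     (fd (comp_in c Y) (snd c p) (X p c) + christoffel c (snd c p) (X p c) (Y p c))"

text \<open>Here \<open>D X Y\<close> is a tangent vector at the fixed point \<open>p\<close>, so
  the result serves both for the local solutions of two charts and for two global
  connections.\<close>

lemma compatible_unique_at:
  assumes p: "p \<in> \<Omega>"
    and T: "\<And>X Y. X \<in> \<XX> M \<Omega> \<Longrightarrow> Y \<in> \<XX> M \<Omega> \<Longrightarrow> D X Y \<in> tangent_space M p"
      "\<And>X Y. X \<in> \<XX> M \<Omega> \<Longrightarrow> Y \<in> \<XX> M \<Omega> \<Longrightarrow> D' X Y \<in> tangent_space M p"
    and torsion: "\<And>X Y. X \<in> \<XX> M \<Omega> \<Longrightarrow> Y \<in> \<XX> M \<Omega> \<Longrightarrow> D X Y \<ominus> D Y X = D' X Y \<ominus> D' Y X"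
    and D: "\<And>X Y Z. X \<in> \<XX> M \<Omega> \<Longrightarrow> Y \<in> \<XX> M \<Omega> \<Longrightarrow> Z \<in> \<XX> M \<Omega> \<Longrightarrow>
      K X Y Z = fundamental_tensor L p (V p) (D X Y) (Z p) + fundamental_tensor L p (V p) (Y p) (D X Z) +
        2 * cartan_tensor L p (V p) (D X V) (Y p) (Z p)"
    and D': "\<And>X Y Z. X \<in> \<XX> M \<Omega> \<Longrightarrow> Y \<in> \<XX> M \<Omega> \<Longrightarrow> Z \<in> \<XX> M \<Omega> \<Longrightarrow>
      K X Y Z = fundamental_tensor L p (V p) (D' X Y) (Z p) + fundamental_tensor L p (V p) (Y p) (D' X Z) +
        2 * cartan_tensor L p (V p) (D' X V) (Y p) (Z p)"
    and XY: "X \<in> \<XX> M \<Omega>" "Y \<in> \<XX> M \<Omega>"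
  shows "D X Y = D' X Y"
proof -
  obtain c where c: "c \<in> M" "p \<in> fst c" using chart_at[OF p] .
  have x: "snd c p \<in> chart_image c \<Omega>" using c p by auto
  note F = fundamental_tensor_chart[OF c p] and Ca = cartan_tensor_chart[OF c p]
    and vT = vector_fieldsD(1)[OF _ p]
  have "D X Y c = D' X Y c"
  proof (rule almost_compatible_unique[where g = "g c (snd c p)" and C = "C c (snd c p)" and V = V
        and F = "\<XX> M \<Omega>" and ev = "\<lambda>X. X p c" and D = "\<lambda>X Y. D X Y c" and D' = "\<lambda>X Y. D' X Y c" and K = K])
    show "bilinear (g c (snd c p))" by (rule g_bilinear[OF c(1) x])
    show "g c (snd c p) u w = g c (snd c p) w u" for u w by (rule g_sym[OF c(1) x])
    show "u = 0" if "\<And>w. g c (snd c p) u w = 0" for u by (rule g_nondegenerate[OF c(1) x that])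
    show "linear (\<lambda>a. C c (snd c p) a y z)" for y z by (rule C_linear[OF c(1) x])
    show "C c (snd c p) a y z = C c (snd c p) a z y" for a y z by (rule C_sym[OF c(1) x])
    show "C c (snd c p) a y (V p c) = 0" for a y using C_V[OF c(1) x] c by simp
    show "V \<in> \<XX> M \<Omega>" by (rule V_field)
    show "\<exists>Z\<in>\<XX> M \<Omega>. Z p c = w" for w
      using exists_vector_field[OF p tvec_of_tangent[OF c, of w]] tvec_of_same[OF c, of w] by metis
    show "D X Y c - D Y X c = D' X Y c - D' Y X c" if "X \<in> \<XX> M \<Omega>" "Y \<in> \<XX> M \<Omega>" for X Y
      using fun_cong[OF torsion[OF that], of c] by (simp add: tsub_def)
    show "K X Y Z = g c (snd c p) (D X Y c) (Z p c) + g c (snd c p) (Y p c) (D X Z c) +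
        2 * C c (snd c p) (D X V c) (Y p c) (Z p c)"
      if "X \<in> \<XX> M \<Omega>" "Y \<in> \<XX> M \<Omega>" "Z \<in> \<XX> M \<Omega>" for X Y Z
      using D[OF that] by (simp add: F Ca vT T that V_field)
    show "K X Y Z = g c (snd c p) (D' X Y c) (Z p c) + g c (snd c p) (Y p c) (D' X Z c) +
        2 * C c (snd c p) (D' X V c) (Y p c) (Z p c)"
      if "X \<in> \<XX> M \<Omega>" "Y \<in> \<XX> M \<Omega>" "Z \<in> \<XX> M \<Omega>" for X Y Z
      using D'[OF that] by (simp add: F Ca vT T that V_field)
  qed (rule XY)+
  then show ?thesis by (rule tangent_space_eqI[OF T(1)[OF XY] T(2)[OF XY] c])
qed

section \<open>The connection\<close>

lemma christoffel_bilinear: "c \<in> M \<Longrightarrow> x \<in> chart_image c \<Omega> \<Longrightarrow> bilinear (christoffel c x)"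
  using christoffel[of c] unfolding is_christoffel_def by blast

lemma christoffel_sym: "c \<in> M \<Longrightarrow> x \<in> chart_image c \<Omega> \<Longrightarrow> christoffel c x u w = christoffel c x w u"
  using christoffel[of c] unfolding is_christoffel_def by blast

lemma christoffel_smooth: "c \<in> M \<Longrightarrow> smooth_on (chart_image c \<Omega>) (\<lambda>x. christoffel c x u w)"
  using christoffel[of c] unfolding is_christoffel_def by blast

lemma christoffel_compatible:
  "c \<in> M \<Longrightarrow> x \<in> chart_image c \<Omega> \<Longrightarrow> fd (\<lambda>x. g c x y z) x u =
    g c x (christoffel c x u y) z + g c x y (christoffel c x u z) +
    2 * C c x (fd (comp_in c V) x u + christoffel c x u (comp_in c V x)) y z"
  using christoffel[of c] unfolding is_christoffel_def by blast

section \<open>The covariant derivative in one chart\<close>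

lemma nabla_tangent: "c \<in> M \<Longrightarrow> p \<in> fst c \<Longrightarrow> nabla c X Y p \<in> tangent_space M p"
  unfolding nabla_def by (rule tvec_of_tangent)

lemma nabla_coord: "c \<in> M \<Longrightarrow> p \<in> fst c \<Longrightarrow> nabla c X Y p c =
    fd (comp_in c Y) (snd c p) (X p c) + christoffel c (snd c p) (X p c) (Y p c)"
  unfolding nabla_def by (rule tvec_of_same)

lemma nabla_torsion_free:
  assumes c: "c \<in> M" "p \<in> fst c" "p \<in> \<Omega>" and X: "X \<in> \<XX> M \<Omega>" and Y: "Y \<in> \<XX> M \<Omega>"
  shows "nabla c X Y p \<ominus> nabla c Y X p = lie_bracket M \<Omega> X Y p"
proof (rule tangent_space_eqI[OF _ _ c(1,2)])
  show "nabla c X Y p \<ominus> nabla c Y X p \<in> tangent_space M p"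
    by (intro tangent_space_tsub nabla_tangent c)
  show "lie_bracket M \<Omega> X Y p \<in> tangent_space M p"
    by (rule vector_fieldsD(1)[OF lie_bracket_chart(1)[OF X Y] c(3)])
  have "snd c p \<in> chart_image c \<Omega>" using c by auto
  from christoffel_sym[OF c(1) this, of "X p c" "Y p c"]
  show "(nabla c X Y p \<ominus> nabla c Y X p) c = lie_bracket M \<Omega> X Y p c"
    by (simp add: tsub_def nabla_coord[OF c(1,2)] lie_bracket_chart(2)[OF X Y c])
qed

lemma nabla_compatible:
  assumes c: "c \<in> M" "p \<in> fst c" "p \<in> \<Omega>"
    and X: "X \<in> \<XX> M \<Omega>" and Y: "Y \<in> \<XX> M \<Omega>" and Z: "Z \<in> \<XX> M \<Omega>"
  shows "vf_apply M X (\<lambda>q. fundamental_tensor L q (V q) (Y q) (Z q)) p =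
      fundamental_tensor L p (V p) (nabla c X Y p) (Z p) +
      fundamental_tensor L p (V p) (Y p) (nabla c X Z p) +
      2 * cartan_tensor L p (V p) (nabla c X V p) (Y p) (Z p)"
proof -
  define x where "x = snd c p"
  have S: "open (chart_image c \<Omega>)" "x \<in> chart_image c \<Omega>"
    using c open_region_image by (auto simp: x_def)
  have px: "chart_inv c x = p" using c by (simp add: x_def)
  note bil = g_bilinear[OF c(1)] and sm = g_smooth[OF c(1)]
    and Y' = vector_fieldsD(3)[OF Y c(1)] and Z' = vector_fieldsD(3)[OF Z c(1)]
  define h where "h = (\<lambda>y. g c y (comp_in c Y y) (comp_in c Z y))"
  define f where "f = (\<lambda>q. fundamental_tensor L q (V q) (Y q) (Z q))"
  have eq: "f (chart_inv c y) = h y" if "y \<in> chart_image c \<Omega>" for y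
  proof -
    from that obtain q where q: "q \<in> fst c" "q \<in> \<Omega>" "y = snd c q" by auto
    have "f q = g c (snd c q) (Y q c) (Z q c)" unfolding f_def
      by (rule fundamental_tensor_chart[OF c(1) q(1,2) vector_fieldsD(1)[OF Y q(2)] vector_fieldsD(1)[OF Z q(2)]])
    then show ?thesis using c(1) q by (simp add: h_def)
  qed
  have "smooth_on (chart_image c \<Omega>) h" unfolding h_def
    by (rule smooth_on_bilinear_apply[OF S(1) bil sm Y' Z'])
  then have "h differentiable (at x)" by (rule smooth_on_differentiable[OF _ S(2)])
  then have d: "(\<lambda>y. f (chart_inv c y)) differentiable (at (snd c p))"
    using differentiable_cong_open[where f = "\<lambda>y. f (chart_inv c y)" and g = h, OF S eq]
    by (simp add: x_def)
  have "vf_apply M X f p = fd (\<lambda>y. f (chart_inv c y)) x (X p c)"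
    unfolding x_def by (rule vf_apply_chart[OF c X d])
  also have "\<dots> = fd h x (X p c)"
    using fd_cong_open[where f = "\<lambda>y. f (chart_inv c y)" and g = h, OF S eq] by simp
  also have "\<dots> = fd (\<lambda>y. g c y (Y p c) (Z p c)) x (X p c) +
      g c x (fd (comp_in c Y) x (X p c)) (Z p c) + g c x (Y p c) (fd (comp_in c Z) x (X p c))"
    unfolding h_def
    using fd_bilinear_apply[OF S bil smooth_on_differentiable[OF sm S(2)]
        smooth_on_differentiable[OF Y' S(2)] smooth_on_differentiable[OF Z' S(2)]]
    by (simp add: px)
  \<comment> \<open>The derivative of \<open>g c\<close> with frozen arguments is replaced by the
    Christoffel identity; each \<open>\<Gamma>\<close> term then joins the derivative of the
    matching component.\<close>
  also have "\<dots> = g c x (nabla c X Y p c) (Z p c) + g c x (Y p c) (nabla c X Z p c) +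
      2 * C c x (nabla c X V p c) (Y p c) (Z p c)"
    using christoffel_compatible[OF c(1) S(2), of "Y p c" "Z p c" "X p c"]
    by (simp add: nabla_coord[OF c(1,2)] x_def[symmetric] px bilinear_ladd[OF bil[OF S(2)]]
        bilinear_radd[OF bil[OF S(2)]])
  also have "\<dots> = fundamental_tensor L p (V p) (nabla c X Y p) (Z p) +
      fundamental_tensor L p (V p) (Y p) (nabla c X Z p) +
      2 * cartan_tensor L p (V p) (nabla c X V p) (Y p) (Z p)"
    using c by (simp add: fundamental_tensor_chart cartan_tensor_chart nabla_tangent
        vector_fieldsD(1)[OF Y] vector_fieldsD(1)[OF Z] x_def)
  finally show ?thesis by (simp add: f_def)
qed

text \<open>The bracket and the left hand side of compatibility mention no chart, so the solutions
  of both charts satisfy the same identities at \<open>p\<close>.\<close>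

lemma nabla_chart_independent:
  assumes c: "c \<in> M" "p \<in> fst c" and d: "d \<in> M" "p \<in> fst d" and p: "p \<in> \<Omega>"
    and "X \<in> \<XX> M \<Omega>" "Y \<in> \<XX> M \<Omega>"
  shows "nabla c X Y p = nabla d X Y p"
proof (rule compatible_unique_at[where D = "\<lambda>X Y. nabla c X Y p" and D' = "\<lambda>X Y. nabla d X Y p"
      and K = "\<lambda>X Y Z. vf_apply M X (\<lambda>q. fundamental_tensor L q (V q) (Y q) (Z q)) p", OF p])
  show "nabla c X Y p \<ominus> nabla c Y X p = nabla d X Y p \<ominus> nabla d Y X p"
    if "X \<in> \<XX> M \<Omega>" "Y \<in> \<XX> M \<Omega>" for X Y
    using nabla_torsion_free[OF c p that] nabla_torsion_free[OF d p that] by simp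
qed (intro nabla_tangent nabla_compatible assms; assumption)+

definition connection :: "('a \<Rightarrow> ('a, 'e) tvec) \<Rightarrow> ('a \<Rightarrow> ('a, 'e) tvec) \<Rightarrow> 'a \<Rightarrow> ('a, 'e) tvec" where
  "connection = (\<lambda>X\<in>\<XX> M \<Omega>. \<lambda>Y\<in>\<XX> M \<Omega>. \<lambda>p\<in>\<Omega>. nabla (SOME c. c \<in> M \<and> p \<in> fst c) X Y p)"

lemma connection_chart:
  assumes c: "c \<in> M" "p \<in> fst c" "p \<in> \<Omega>" and "X \<in> \<XX> M \<Omega>" "Y \<in> \<XX> M \<Omega>"
  shows "connection X Y p = nabla c X Y p"
proof -
  have "(SOME c. c \<in> M \<and> p \<in> fst c) \<in> M \<and> p \<in> fst (SOME c. c \<in> M \<and> p \<in> fst c)"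
    using someI[of "\<lambda>c. c \<in> M \<and> p \<in> fst c" c] c by simp
  then have "nabla (SOME c. c \<in> M \<and> p \<in> fst c) X Y p = nabla c X Y p"
    using nabla_chart_independent[OF _ _ assms] by simp
  then show ?thesis
    using assms by (simp add: connection_def)
qed

text \<open>The chart selected in \<open>connection\<close> may jump from point to point; by
  \<open>connection_chart\<close> one fixed chart around \<open>p\<close> computes all nearby
  values.\<close>

lemma connection_field:
  assumes X: "X \<in> \<XX> M \<Omega>" and Y: "Y \<in> \<XX> M \<Omega>" shows "connection X Y \<in> \<XX> M \<Omega>"
proof (rule vector_fieldsI)
  show "connection X Y \<in> extensional \<Omega>" using X Y by (simp add: connection_def)
  fix p assume p: "p \<in> \<Omega>"
  obtain c where c: "c \<in> M" "p \<in> fst c" using chart_at[OF p] .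
  show "connection X Y p \<in> tangent_space M p"
    unfolding connection_chart[OF c p X Y] by (rule nabla_tangent[OF c])
  note S = open_region_image[OF c(1)]
    and X' = vector_fieldsD(3)[OF X c(1)] and Y' = vector_fieldsD(3)[OF Y c(1)]
  have "smooth_on (chart_image c \<Omega>)
      (\<lambda>x. fd (comp_in c Y) x (comp_in c X x) + christoffel c x (comp_in c X x) (comp_in c Y x))"
    by (rule smooth_on_add[OF S])
      (rule smooth_on_linear_apply[OF S linear_fd[OF smooth_on_differentiable[OF Y']] smooth_on_fd[OF Y'] X']
        smooth_on_bilinear_apply[OF S christoffel_bilinear[OF c(1)] christoffel_smooth[OF c(1)] X' Y']; assumption)+
  then have "smooth_on (chart_image c \<Omega>) (comp_in c (connection X Y))"
  proof (rule smooth_on_cong[OF S, THEN iffD1, rotated])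
    fix x assume "x \<in> chart_image c \<Omega>"
    then obtain q where q: "q \<in> fst c" "q \<in> \<Omega>" "x = snd c q" by auto
    show "fd (comp_in c Y) x (comp_in c X x) + christoffel c x (comp_in c X x) (comp_in c Y x) =
        comp_in c (connection X Y) x"
      using connection_chart[OF c(1) q(1,2) X Y] c(1) q by (simp add: nabla_coord)
  qed
  then show "\<exists>c\<in>M. \<exists>W. open W \<and> p \<in> W \<and> p \<in> fst c \<and> W \<subseteq> \<Omega> \<and>
      smooth_on (chart_image c W) (comp_in c (connection X Y))"
    using c open_\<Omega> p by blast
qed

lemma vector_fields_eqI:
  assumes "X \<in> \<XX> M \<Omega>" "Y \<in> \<XX> M \<Omega>"
    and "\<And>c p. c \<in> M \<Longrightarrow> p \<in> fst c \<Longrightarrow> p \<in> \<Omega> \<Longrightarrow> X p c = Y p c"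
  shows "X = Y"
proof (rule extensionalityI[OF vector_fieldsD(2)[OF assms(1)] vector_fieldsD(2)[OF assms(2)]])
  fix p assume p: "p \<in> \<Omega>"
  obtain c where c: "c \<in> M" "p \<in> fst c" using chart_at[OF p] .
  show "X p = Y p"
    by (rule tangent_space_eqI[OF vector_fieldsD(1)[OF assms(1) p] vector_fieldsD(1)[OF assms(2) p] c
        assms(3)[OF c p]])
qed

lemma connection_coord:
  assumes "c \<in> M" "p \<in> fst c" "p \<in> \<Omega>" "X \<in> \<XX> M \<Omega>" "Y \<in> \<XX> M \<Omega>"
  shows "connection X Y p c = fd (comp_in c Y) (snd c p) (X p c) + christoffel c (snd c p) (X p c) (Y p c)"
  by (simp add: connection_chart[OF assms] nabla_coord[OF assms(1,2)])

lemma connection_affine: "affine_connection M \<Omega> connection"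
proof -
  have x: "snd c p \<in> chart_image c \<Omega>" if "p \<in> fst c" "p \<in> \<Omega>" for c p
    using that by auto
  have add1: "connection (vf_add \<Omega> X X') Y = vf_add \<Omega> (connection X Y) (connection X' Y)"
    if X: "X \<in> \<XX> M \<Omega>" "X' \<in> \<XX> M \<Omega>" and Y: "Y \<in> \<XX> M \<Omega>" for X X' Y
  proof (rule vector_fields_eqI)
    fix c p assume c: "c \<in> M" "p \<in> fst c" "p \<in> \<Omega>"
    show "connection (vf_add \<Omega> X X') Y p c = vf_add \<Omega> (connection X Y) (connection X' Y) p c"
      using linear_add[OF linear_fd[OF vf_differentiable[OF Y c]]]
        bilinear_ladd[OF christoffel_bilinear[OF c(1) x[OF c(2,3)]]] c(3)
      by (simp add: connection_coord[OF c] X Y vf_add_in) (simp add: vf_add_def tadd_def connection_coord[OF c] X Y)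
  qed (intro connection_field vf_add_in that)+
  have scale1: "connection (vf_scale \<Omega> f X) Y = vf_scale \<Omega> f (connection X Y)"
    if f: "f \<in> smooth_functions M \<Omega>" and X: "X \<in> \<XX> M \<Omega>" and Y: "Y \<in> \<XX> M \<Omega>" for f X Y
  proof (rule vector_fields_eqI)
    fix c p assume c: "c \<in> M" "p \<in> fst c" "p \<in> \<Omega>"
    show "connection (vf_scale \<Omega> f X) Y p c = vf_scale \<Omega> f (connection X Y) p c"
      using linear_scale[OF linear_fd[OF vf_differentiable[OF Y c]]]
        bilinear_lmul[OF christoffel_bilinear[OF c(1) x[OF c(2,3)]]] c(3)
      by (simp add: connection_coord[OF c] f X Y vf_scale_in)
        (simp add: vf_scale_def tscale_def connection_coord[OF c] X Y scaleR_add_right)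
  qed (intro connection_field vf_scale_in that)+
  have add2: "connection X (vf_add \<Omega> Y Y') = vf_add \<Omega> (connection X Y) (connection X Y')"
    if X: "X \<in> \<XX> M \<Omega>" and Y: "Y \<in> \<XX> M \<Omega>" "Y' \<in> \<XX> M \<Omega>" for X Y Y'
  proof (rule vector_fields_eqI)
    fix c p assume c: "c \<in> M" "p \<in> fst c" "p \<in> \<Omega>"
    have "fd (comp_in c (vf_add \<Omega> Y Y')) (snd c p) (X p c) =
        fd (\<lambda>x. comp_in c Y x + comp_in c Y' x) (snd c p) (X p c)"
      by (rule fun_cong[OF fd_cong_open], rule open_region_image[OF c(1)])
        (use c in \<open>auto simp: vf_add_def tadd_def\<close>)
    then have "fd (comp_in c (vf_add \<Omega> Y Y')) (snd c p) (X p c) =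
        fd (comp_in c Y) (snd c p) (X p c) + fd (comp_in c Y') (snd c p) (X p c)"
      using fd_add[OF vf_differentiable[OF Y(1) c] vf_differentiable[OF Y(2) c]] by simp
    then show "connection X (vf_add \<Omega> Y Y') p c = vf_add \<Omega> (connection X Y) (connection X Y') p c"
      using bilinear_radd[OF christoffel_bilinear[OF c(1) x[OF c(2,3)]]] c(3)
      by (simp add: connection_coord[OF c] X Y vf_add_in) (simp add: vf_add_def tadd_def connection_coord[OF c] X Y)
  qed (intro connection_field vf_add_in that)+
  \<comment> \<open>Argued point by point: \<open>vector_fields_eqI\<close> would require the right
    hand side to be a smooth field beforehand, hence smoothness of
    \<open>vf_apply M X f\<close>.\<close>
  have leibniz: "connection X (vf_scale \<Omega> f Y) =
      vf_add \<Omega> (vf_scale \<Omega> (vf_apply M X f) Y) (vf_scale \<Omega> f (connection X Y))"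
    if f: "f \<in> smooth_functions M \<Omega>" and X: "X \<in> \<XX> M \<Omega>" and Y: "Y \<in> \<XX> M \<Omega>" for f X Y
  proof (rule extensionalityI)
    show "connection X (vf_scale \<Omega> f Y) \<in> extensional \<Omega>"
      by (intro vector_fieldsD(2) connection_field vf_scale_in that)
    show "vf_add \<Omega> (vf_scale \<Omega> (vf_apply M X f) Y) (vf_scale \<Omega> f (connection X Y)) \<in> extensional \<Omega>"
      by (simp add: vf_add_def)
    fix p assume p: "p \<in> \<Omega>"
    obtain c where c: "c \<in> M" "p \<in> fst c" using chart_at[OF p] .
    note cp = c p
    have df: "(\<lambda>x. f (chart_inv c x)) differentiable (at (snd c p))"
      by (rule smooth_on_differentiable[OF smooth_functionsD[OF f c(1)] x[OF c(2) p]])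
    have "fd (comp_in c (vf_scale \<Omega> f Y)) (snd c p) (X p c) =
        fd (\<lambda>x. f (chart_inv c x) *\<^sub>R comp_in c Y x) (snd c p) (X p c)"
      by (rule fun_cong[OF fd_cong_open], rule open_region_image[OF c(1)])
        (use cp in \<open>auto simp: vf_scale_def tscale_def\<close>)
    also have "\<dots> = f p *\<^sub>R fd (comp_in c Y) (snd c p) (X p c) + vf_apply M X f p *\<^sub>R Y p c"
      using fd_scaleR[OF df vf_differentiable[OF Y cp]] vf_apply_chart[OF cp X df] c by simp
    finally have fd: "fd (comp_in c (vf_scale \<Omega> f Y)) (snd c p) (X p c) =
        f p *\<^sub>R fd (comp_in c Y) (snd c p) (X p c) + vf_apply M X f p *\<^sub>R Y p c" .
    show "connection X (vf_scale \<Omega> f Y) p =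
        vf_add \<Omega> (vf_scale \<Omega> (vf_apply M X f) Y) (vf_scale \<Omega> f (connection X Y)) p"
    proof (rule tangent_space_eqI[OF _ _ c])
      show "connection X (vf_scale \<Omega> f Y) p \<in> tangent_space M p"
        by (intro vector_fieldsD(1) connection_field vf_scale_in that p)
      show "vf_add \<Omega> (vf_scale \<Omega> (vf_apply M X f) Y) (vf_scale \<Omega> f (connection X Y)) p \<in> tangent_space M p"
        using p by (simp add: vf_add_def vf_scale_def tangent_space_tadd tangent_space_tscale
            vector_fieldsD(1)[OF Y] vector_fieldsD(1)[OF connection_field[OF X Y]])
      show "connection X (vf_scale \<Omega> f Y) p c =
          vf_add \<Omega> (vf_scale \<Omega> (vf_apply M X f) Y) (vf_scale \<Omega> f (connection X Y)) p c"
        using bilinear_rmul[OF christoffel_bilinear[OF c(1) x[OF c(2) p]]] p fd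
        by (simp add: connection_coord[OF cp] f X Y vf_scale_in)
          (simp add: vf_add_def tadd_def vf_scale_def tscale_def connection_coord[OF cp] X Y scaleR_add_right)
    qed
  qed
  have "connection \<in> \<XX> M \<Omega> \<rightarrow>\<^sub>E \<XX> M \<Omega> \<rightarrow>\<^sub>E \<XX> M \<Omega>"
  proof (rule PiE_I)
    fix X assume X: "X \<in> \<XX> M \<Omega>"
    show "connection X \<in> \<XX> M \<Omega> \<rightarrow>\<^sub>E \<XX> M \<Omega>"
      by (rule PiE_I) (auto simp: connection_field X, simp add: connection_def X)
  qed (simp add: connection_def)
  then show ?thesis
    unfolding affine_connection_def by (intro conjI ballI add1 scale1 add2 leibniz)
qed

end

theorem proposition2p3:
  fixes M :: "('a::{t2_space,second_countable_topology}, 'e::euclidean_space) atlas"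
    and A :: "('a \<times> ('a, 'e) tvec) set"
    and L :: "'a \<times> ('a, 'e) tvec \<Rightarrow> real"
    and \<Omega> :: "'a set"
    and V :: "'a \<Rightarrow> ('a, 'e) tvec"
  assumes "smooth_manifold M"
    and "pseudo_finsler_metric M A L"
    and "open \<Omega>" and "\<Omega> \<subseteq> carrier M"
    and "admissible M A \<Omega> V"
  shows "\<exists>!D. affine_connection M \<Omega> D \<and>
    (\<forall>X\<in>\<XX> M \<Omega>. \<forall>Y\<in>\<XX> M \<Omega>. vf_sub \<Omega> (D X Y) (D Y X) = lie_bracket M \<Omega> X Y) \<and>
    (\<forall>X\<in>\<XX> M \<Omega>. \<forall>Y\<in>\<XX> M \<Omega>. \<forall>Z\<in>\<XX> M \<Omega>. \<forall>p\<in>\<Omega>.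
      vf_apply M X (\<lambda>q. fundamental_tensor L q (V q) (Y q) (Z q)) p =
        fundamental_tensor L p (V p) (D X Y p) (Z p) +
        fundamental_tensor L p (V p) (Y p) (D X Z p) +
        2 * cartan_tensor L p (V p) (D X V p) (Y p) (Z p))" (is "\<exists>!D. ?P D")
proof -
  interpret finsler_field M \<Omega> A L V
    by unfold_locales (rule assms)+
  have torsion: "vf_sub \<Omega> (connection X Y) (connection Y X) = lie_bracket M \<Omega> X Y"
    if X: "X \<in> \<XX> M \<Omega>" and Y: "Y \<in> \<XX> M \<Omega>" for X Y
  proof (rule extensionalityI[OF _ vector_fieldsD(2)[OF lie_bracket_chart(1)[OF X Y]]])
    fix p assume p: "p \<in> \<Omega>"
    obtain c where c: "c \<in> M" "p \<in> fst c" using chart_at[OF p] .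
    show "vf_sub \<Omega> (connection X Y) (connection Y X) p = lie_bracket M \<Omega> X Y p"
      using nabla_torsion_free[OF c p X Y] p
      by (simp add: vf_sub_def connection_chart[OF c p] X Y)
  qed (simp add: vf_sub_def)
  have compatible: "vf_apply M X (\<lambda>q. fundamental_tensor L q (V q) (Y q) (Z q)) p =
        fundamental_tensor L p (V p) (connection X Y p) (Z p) +
        fundamental_tensor L p (V p) (Y p) (connection X Z p) +
        2 * cartan_tensor L p (V p) (connection X V p) (Y p) (Z p)"
    if "X \<in> \<XX> M \<Omega>" "Y \<in> \<XX> M \<Omega>" "Z \<in> \<XX> M \<Omega>" and p: "p \<in> \<Omega>" for X Y Z p
  proof -
    obtain c where c: "c \<in> M" "p \<in> fst c" using chart_at[OF p] .
    show ?thesis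
      using nabla_compatible[OF c p that(1-3)] by (simp add: connection_chart[OF c p] that V_field)
  qed
  show ?thesis
  proof (rule ex1I[of _ connection])
    show "?P connection"
      by (intro conjI ballI connection_affine torsion compatible)
    fix D assume D: "?P D"
    then have D_in: "D \<in> \<XX> M \<Omega> \<rightarrow>\<^sub>E \<XX> M \<Omega> \<rightarrow>\<^sub>E \<XX> M \<Omega>"
      by (simp add: affine_connection_def)
    have D_field: "D X Y \<in> \<XX> M \<Omega>" if "X \<in> \<XX> M \<Omega>" "Y \<in> \<XX> M \<Omega>" for X Y
      using PiE_mem[OF PiE_mem[OF D_in that(1)] that(2)] .
    have conn_in: "connection \<in> \<XX> M \<Omega> \<rightarrow>\<^sub>E \<XX> M \<Omega> \<rightarrow>\<^sub>E \<XX> M \<Omega>"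
      using connection_affine by (simp add: affine_connection_def)
    have D_torsion: "D X Y p \<ominus> D Y X p = lie_bracket M \<Omega> X Y p"
      if "X \<in> \<XX> M \<Omega>" "Y \<in> \<XX> M \<Omega>" "p \<in> \<Omega>" for X Y p
    proof -
      have "vf_sub \<Omega> (D X Y) (D Y X) = lie_bracket M \<Omega> X Y" using D that by blast
      from fun_cong[OF this, of p] show ?thesis using that by (simp add: vf_sub_def)
    qed
    have conn_torsion: "connection X Y p \<ominus> connection Y X p = lie_bracket M \<Omega> X Y p"
      if "X \<in> \<XX> M \<Omega>" "Y \<in> \<XX> M \<Omega>" "p \<in> \<Omega>" for X Y p
      using fun_cong[OF torsion[OF that(1,2)], of p] that by (simp add: vf_sub_def)
    \<comment> \<open>Both connections share the bracket and the same left hand side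
      \<open>K\<close>, so uniqueness at the single point \<open>p\<close> applies.\<close>
    have "D X Y p = connection X Y p" if XY: "X \<in> \<XX> M \<Omega>" "Y \<in> \<XX> M \<Omega>" and p: "p \<in> \<Omega>" for X Y p
    proof (rule compatible_unique_at[where D = "\<lambda>X Y. D X Y p" and D' = "\<lambda>X Y. connection X Y p"
          and K = "\<lambda>X Y Z. vf_apply M X (\<lambda>q. fundamental_tensor L q (V q) (Y q) (Z q)) p", OF p])
      show "D X Y p \<ominus> D Y X p = connection X Y p \<ominus> connection Y X p"
        if "X \<in> \<XX> M \<Omega>" "Y \<in> \<XX> M \<Omega>" for X Y
        using D_torsion[OF that p] conn_torsion[OF that p] by simp
      show "vf_apply M X (\<lambda>q. fundamental_tensor L q (V q) (Y q) (Z q)) p =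
          fundamental_tensor L p (V p) (D X Y p) (Z p) + fundamental_tensor L p (V p) (Y p) (D X Z p) +
          2 * cartan_tensor L p (V p) (D X V p) (Y p) (Z p)"
        if "X \<in> \<XX> M \<Omega>" "Y \<in> \<XX> M \<Omega>" "Z \<in> \<XX> M \<Omega>" for X Y Z
        using D that p by blast
    qed (intro vector_fieldsD(1)[OF D_field] vector_fieldsD(1)[OF connection_field] compatible XY p; assumption)+
    \<comment> \<open>Extensionality raises the equality from points to fields, then to each of the
      two field arguments.\<close>
    then have "D X Y = connection X Y" if "X \<in> \<XX> M \<Omega>" "Y \<in> \<XX> M \<Omega>" for X Y
      using that vector_fieldsD(2)[OF D_field[OF that]] vector_fieldsD(2)[OF connection_field[OF that]]
      by (intro extensionalityI[of _ \<Omega>]) auto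
    then have "D X = connection X" if "X \<in> \<XX> M \<Omega>" for X
      using that by (intro PiE_ext[OF PiE_mem[OF D_in that] PiE_mem[OF conn_in that]])
    then show "D = connection"
      by (intro PiE_ext[OF D_in conn_in])
  qed
qed

end
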